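(* Let $a,b\in\{e^{i\phi}:\phi\in[0,\pi)\}$ with $a\neq b$, and let $u=u(a)$, $v=u(b)$, where $$u(z)=\frac12\begin{bmatrix}1&1&1&1\\1&iz&-1&-iz\\1&-1&1&-1\\1&-iz&-1&iz\end{bmatrix}.$$ Suppose that $(\overline ab)^m=1$ for some even integer $m\ge4$, where $m$ is the smallest positive even integer with this property. Then: (i) if $m=4$, then $\mathrm{Ang}_R(R_u,R_v)=\{\pi/2\}$; (ii) if $m\ge6$, then $\mathrm{Ang}_R(R_u,R_v)=\left\{\frac{2k\pi}{m}:k=1,2,\ldots,\left\lfloor\frac{m-2}{4}\right\rfloor\right\}$.
   Context: The matrices $u(z)$, $z=e^{i\phi}$, $\phi\in[0,\pi)$, form the one-parameter family of pairwise Hadamard inequivalent $4\times4$ complex Hadamard matrices. Spin model subfactors (for $n=4$). $M_n$ is the algebra of complex $n\times n$ matrices, $\Delta_n\subset M_n$ the diagonal subalgebra, $E_{ij}$ the matrix units, $J_n=\frac1n\sum_{i,j}E_{ij}$. A complex Hadamard matrix means here a unitary $u\in M_n$ all of whose entries have modulus $1/\sqrt n$. Consider the tower $A_{-1}=\Delta_n\subset A_0=M_n\subset A_1=\Delta_n\otimes M_n\subset A_2=M_n\otimes M_n\subset\cdots$, i.e. $A_{2k}=M_n^{\otimes (k+1)}$, $A_{2k+1}=\Delta_n\otimes M_n^{\otimes(k+1)}$, where $A_{2k}\subset A_{2k+1}$ via $x\mapsto I_n\otimes x$ and $A_{2k+1}\subset A_{2k+2}$ is induced by $\Delta_n\subset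 M_n$. This is a tower of Jones basic constructions with Jones projections $e_{2k+1}=\sum_i E_{ii}\otimes E_{ii}\otimes I_n^{\otimes k}\in A_{2k+1}$ ($k\ge0$) and $e_{2k}=J_n\otimes I_n^{\otimes k}\in A_{2k}$ ($k\ge 1$). $R$ is the hyperfinite $II_1$ factor obtained as the SOT-closure of $\bigcup_k A_k$ in the GNS representation of the normalized trace. The spin model subfactor $R_u\subset R$ is the von Neumann subalgebra generated by $u\Delta_nu^*\subset A_0$ and all $e_j$, $j\ge1$. The same $R$ and $e_j$ are used for $u$ and $v$. Sano-Watatani angle. For projections $p,q$ on a Hilbert space $\mathcal H$, let $\mathcal H_0$ be the orthogonal complement of the sum of the ranges of $p\wedge q$, $p\wedge q^\perp$, $p^\perp\wedge q$, $p^\perp\wedge q^\perp$. The angle operator $\Theta(p,q)$ is the positive operator on $p\mathcal H_0$ with spectrum in $[0,\pi/2]$ determined by $\cos^2\Theta(p,q)=pqp|_{p\mathcal H_0}$ ($0$ and $\pi/2$ are not eigenvalues). Set $\mathrm{Ang}(p,q)=\mathrm{sp}\,\Theta(p,q)$ if $pq\ne qp$, and $\mathrm{Ang}(p,q)=\{\pi/2\}$ otherwise. For von Neumann subalgebras $\mathcal P,\mathcal Q$ of a finite von Neumann algebra $\mathcal M$ with faithful normal tracial state, $\mathrm{Ang}_{\mathcal M}(\mathcal P,\mathcal Q)=\mathrm{Ang}(e_{\mathcal P},e_{\mathcal Q})$, where $e_{\mathcal P},e_{\mathcal Q}$ are the projections of $L^2(\mathcal M)$ onto $L^2(\mathcal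 P),L^2(\mathcal Q)$. *)

theory Defs
  imports "HOL-Analysis.Analysis"
begin

section \<open>Complex Hilbert spaces and operators\<close>

text \<open>The library only provides real inner product spaces. The inner product is linear in the
  first argument; \<open>banach\<close> contributes the underlying real normed space and its completeness.\<close>

class complex_hilbert_space = banach +
  fixes scaleC :: "complex \<Rightarrow> 'a \<Rightarrow> 'a" (infixr "*\<^sub>C" 75)
    and cinner :: "'a \<Rightarrow> 'a \<Rightarrow> complex"
  assumes scaleC_add_right: "c *\<^sub>C (x + y) = c *\<^sub>C x + c *\<^sub>C y"
    and scaleC_add_left: "(c + d) *\<^sub>C x = c *\<^sub>C x + d *\<^sub>C x"
    and scaleC_scaleC: "c *\<^sub>C (d *\<^sub>C x) = (c * d) *\<^sub>C x"
    and scaleC_of_real: "complex_of_real r *\<^sub>C x = r *\<^sub>R x"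
    and cinner_commute: "cinner x y = cnj (cinner y x)"
    and cinner_add_left: "cinner (x + y) z = cinner x z + cinner y z"
    and cinner_scaleC_left: "cinner (c *\<^sub>C x) y = c * cinner x y"
    and cinner_self: "cinner x x = complex_of_real ((norm x)\<^sup>2)"

definition bounded_clinear :: "('h::complex_hilbert_space \<Rightarrow> 'h) \<Rightarrow> bool" where
  "bounded_clinear T \<longleftrightarrow> bounded_linear T \<and> (\<forall>c \<xi>. T (c *\<^sub>C \<xi>) = c *\<^sub>C T \<xi>)"

definition is_adjoint :: "('h::complex_hilbert_space \<Rightarrow> 'h) \<Rightarrow> ('h \<Rightarrow> 'h) \<Rightarrow> bool" where
  "is_adjoint T S \<longleftrightarrow> (\<forall>\<xi> \<eta>. cinner (T \<xi>) \<eta> = cinner \<xi> (S \<eta>))"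

definition orth_compl :: "'h::complex_hilbert_space set \<Rightarrow> 'h set" where
  "orth_compl S = {\<xi>. \<forall>\<eta>\<in>S. cinner \<xi> \<eta> = 0}"

text \<open>Orthogonal projection onto a closed subspace.\<close>

definition proj :: "'h::complex_hilbert_space set \<Rightarrow> 'h \<Rightarrow> 'h" where
  "proj S \<xi> = (THE \<eta>. \<eta> \<in> S \<and> \<xi> - \<eta> \<in> orth_compl S)"

text \<open>The function space \<open>'h \<Rightarrow> 'h\<close> carries the topology of pointwise convergence with respect to
  the norm topology of \<open>'h\<close>, so on bounded operators \<open>closure\<close> is closure in the strong operator
  topology.\<close>

definition sot_closure :: "('h::complex_hilbert_space \<Rightarrow> 'h) set \<Rightarrow> ('h \<Rightarrow> 'h) set" where
  "sot_closure N = closure N \<inter> {T. bounded_clinear T}"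

definition von_neumann_algebra :: "('h::complex_hilbert_space \<Rightarrow> 'h) set \<Rightarrow> bool" where
  "von_neumann_algebra N \<longleftrightarrow>
     (\<forall>T\<in>N. bounded_clinear T) \<and>
     id \<in> N \<and>
     (\<forall>S\<in>N. \<forall>T\<in>N. (\<lambda>\<xi>. S \<xi> + T \<xi>) \<in> N) \<and>
     (\<forall>c. \<forall>T\<in>N. (\<lambda>\<xi>. c *\<^sub>C T \<xi>) \<in> N) \<and>
     (\<forall>S\<in>N. \<forall>T\<in>N. S \<circ> T \<in> N) \<and>
     (\<forall>T\<in>N. \<exists>S\<in>N. is_adjoint T S) \<and>
     sot_closure N = N"

definition generated_vN_subalgebra ::
    "('h::complex_hilbert_space \<Rightarrow> 'h) set \<Rightarrow> ('h \<Rightarrow> 'h) set \<Rightarrow> ('h \<Rightarrow> 'h) set" where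
  "generated_vN_subalgebra M G = \<Inter>{N. von_neumann_algebra N \<and> N \<subseteq> M \<and> G \<subseteq> N}"


section \<open>The angle between two projections\<close>

text \<open>Operators on a closed subspace \<open>K\<close> are functions on \<open>K\<close>; only their values on \<open>K\<close> matter.\<close>

definition bounded_operator_on :: "'h::complex_hilbert_space set \<Rightarrow> ('h \<Rightarrow> 'h) \<Rightarrow> bool" where
  "bounded_operator_on K T \<longleftrightarrow>
     T ` K \<subseteq> K \<and>
     (\<forall>\<xi>\<in>K. \<forall>\<eta>\<in>K. T (\<xi> + \<eta>) = T \<xi> + T \<eta>) \<and>
     (\<forall>c. \<forall>\<xi>\<in>K. T (c *\<^sub>C \<xi>) = c *\<^sub>C T \<xi>) \<and>
     (\<exists>B. \<forall>\<xi>\<in>K. norm (T \<xi>) \<le> B * norm \<xi>)"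

definition spectrum_on :: "'h::complex_hilbert_space set \<Rightarrow> ('h \<Rightarrow> 'h) \<Rightarrow> complex set" where
  "spectrum_on K T = {z. \<not> (\<exists>S. bounded_operator_on K S \<and>
     (\<forall>\<xi>\<in>K. S (T \<xi> - z *\<^sub>C \<xi>) = \<xi> \<and> T (S \<xi>) - z *\<^sub>C S \<xi> = \<xi>))}"

text \<open>The cosine of a bounded operator, by its power series.\<close>

definition op_cos :: "('h::complex_hilbert_space \<Rightarrow> 'h) \<Rightarrow> 'h \<Rightarrow> 'h" where
  "op_cos T \<xi> = (\<Sum>n. cos_coeff n *\<^sub>R (T ^^ n) \<xi>)"

text \<open>The range of \<open>p \<and> q\<close> is the intersection of the ranges of \<open>p\<close> and \<open>q\<close>, and that of
  \<open>p\<^sup>\<bottom>\<close> is the range of \<open>1 - p\<close>.\<close>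

definition generic_part ::
    "('h::complex_hilbert_space \<Rightarrow> 'h) \<Rightarrow> ('h \<Rightarrow> 'h) \<Rightarrow> 'h set" where
  "generic_part p q =
     (let p' = (\<lambda>\<xi>. \<xi> - p \<xi>); q' = (\<lambda>\<xi>. \<xi> - q \<xi>) in
      orth_compl {\<alpha> + \<beta> + \<gamma> + \<delta> | \<alpha> \<beta> \<gamma> \<delta>.
        \<alpha> \<in> range p \<inter> range q \<and> \<beta> \<in> range p \<inter> range q' \<and>
        \<gamma> \<in> range p' \<inter> range q \<and> \<delta> \<in> range p' \<inter> range q'})"

definition is_angle_operator ::
    "('h::complex_hilbert_space \<Rightarrow> 'h) \<Rightarrow> ('h \<Rightarrow> 'h) \<Rightarrow> ('h \<Rightarrow> 'h) \<Rightarrow> bool" where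
  "is_angle_operator p q \<Theta> \<longleftrightarrow>
     (let K = p ` generic_part p q in
      \<Theta> \<in> extensional K \<and>
      bounded_operator_on K \<Theta> \<and>
      (\<forall>\<xi>\<in>K. cinner (\<Theta> \<xi>) \<xi> \<in> \<real>\<^sub>\<ge>\<^sub>0) \<and>
      spectrum_on K \<Theta> \<subseteq> complex_of_real ` {0..pi / 2} \<and>
      (\<forall>\<xi>\<in>K. op_cos \<Theta> (op_cos \<Theta> \<xi>) = p (q (p \<xi>))))"

definition angle_operator ::
    "('h::complex_hilbert_space \<Rightarrow> 'h) \<Rightarrow> ('h \<Rightarrow> 'h) \<Rightarrow> 'h \<Rightarrow> 'h" where
  "angle_operator p q = (THE \<Theta>. is_angle_operator p q \<Theta>)"

definition Ang_proj :: "('h::complex_hilbert_space \<Rightarrow> 'h) \<Rightarrow> ('h \<Rightarrow> 'h) \<Rightarrow> real set" where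
  "Ang_proj p q =
     (if p \<circ> q \<noteq> q \<circ> p
      then {t. complex_of_real t \<in> spectrum_on (p ` generic_part p q) (angle_operator p q)}
      else {pi / 2})"

text \<open>For a finite von Neumann algebra \<open>M\<close> on \<open>'h\<close> whose trace is the vector state of a cyclic
  vector \<open>\<Omega>\<close>, the space \<open>'h\<close> is \<open>L\<^sup>2(M)\<close>, and \<open>L\<^sup>2(P)\<close> is the closure of \<open>P\<Omega>\<close> for each
  von Neumann subalgebra \<open>P\<close>.\<close>

definition L2_space :: "'h::complex_hilbert_space \<Rightarrow> ('h \<Rightarrow> 'h) set \<Rightarrow> 'h set" where
  "L2_space \<Omega> P = closure ((\<lambda>T. T \<Omega>) ` P)"

definition Ang ::
    "'h::complex_hilbert_space \<Rightarrow> ('h \<Rightarrow> 'h) set \<Rightarrow> ('h \<Rightarrow> 'h) set \<Rightarrow> real set" where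
  "Ang \<Omega> P Q = Ang_proj (proj (L2_space \<Omega> P)) (proj (L2_space \<Omega> Q))"


section \<open>The tower of algebras\<close>

type_synonym mat4 = "complex^4^4"

definition diag_mats :: "mat4 set" where
  "diag_mats = {d. \<forall>i j. i \<noteq> j \<longrightarrow> d $ i $ j = 0}"

definition adj :: "mat4 \<Rightarrow> mat4" where
  "adj x = (\<chi> i j. cnj (x $ j $ i))"

definition E :: "4 \<Rightarrow> 4 \<Rightarrow> mat4" where
  "E i j = (\<chi> r s. if r = i \<and> s = j then 1 else 0)"

definition J :: mat4 where
  "J = (1 / 4) *\<^sub>R (\<Sum>i\<in>UNIV. \<Sum>j\<in>UNIV. E i j)"

text \<open>The \<open>N\<close>-fold tensor power of the \<open>4 \<times> 4\<close> matrices consists of the matrices indexed by words of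
  length \<open>N\<close>. Tensor factors are counted from the right, and the inclusions of the tower add factors
  on the left. So that these inclusions become set inclusions, \<open>x\<close> is represented by
  \<open>\<cdots> \<otimes> 1 \<otimes> 1 \<otimes> x\<close>, an infinite matrix indexed by sequences: position \<open>i\<close> of a sequence belongs to the
  \<open>i\<close>-th tensor factor from the right.\<close>

type_synonym inf_mat = "(nat \<Rightarrow> 4) \<Rightarrow> (nat \<Rightarrow> 4) \<Rightarrow> complex"

definition word :: "nat \<Rightarrow> (nat \<Rightarrow> 4) \<Rightarrow> 4 list" where
  "word N r = map r (rev [0..<N])"

definition amplify :: "nat \<Rightarrow> (4 list \<Rightarrow> 4 list \<Rightarrow> complex) \<Rightarrow> inf_mat" where
  "amplify N x = (\<lambda>r s. if \<forall>i\<ge>N. r i = s i then x (word N r) (word N s) else 0)"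

text \<open>\<open>tensor [x\<^sub>1, \<dots>, x\<^sub>N]\<close> is \<open>\<cdots> \<otimes> 1 \<otimes> x\<^sub>1 \<otimes> \<cdots> \<otimes> x\<^sub>N\<close>.\<close>

definition tensor :: "mat4 list \<Rightarrow> inf_mat" where
  "tensor xs = amplify (length xs) (\<lambda>v w. \<Prod>i<length xs. xs ! i $ (v ! i) $ (w ! i))"

definition tower :: "nat \<Rightarrow> inf_mat set" where
  "tower n =
     (if even n then range (amplify (n div 2 + 1))
      else amplify (n div 2 + 2) ` {x. \<forall>v w. hd v \<noteq> hd w \<longrightarrow> x v w = 0})"

definition tower_union :: "inf_mat set" where
  "tower_union = (\<Union>n. tower n)"

definition im_add :: "inf_mat \<Rightarrow> inf_mat \<Rightarrow> inf_mat" where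
  "im_add x y = (\<lambda>r s. x r s + y r s)"

definition im_scale :: "complex \<Rightarrow> inf_mat \<Rightarrow> inf_mat" where
  "im_scale c x = (\<lambda>r s. c * x r s)"

text \<open>Matrices in the tower have only finitely many nonzero entries in each row.\<close>

definition im_mult :: "inf_mat \<Rightarrow> inf_mat \<Rightarrow> inf_mat" where
  "im_mult x y = (\<lambda>r t. \<Sum>s | x r s \<noteq> 0. x r s * y s t)"

definition im_adj :: "inf_mat \<Rightarrow> inf_mat" where
  "im_adj x = (\<lambda>r s. cnj (x s r))"

definition im_one :: inf_mat where
  "im_one = (\<lambda>r s. if r = s then 1 else 0)"

definition jones :: "nat \<Rightarrow> inf_mat" where
  "jones n =
     (let k = n div 2 in
      if odd n then (\<lambda>r s. \<Sum>i\<in>UNIV. tensor (E i i # E i i # replicate k (mat 1)) r s)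
      else tensor (J # replicate k (mat 1)))"


section \<open>The hyperfinite factor and its spin model subfactors\<close>

text \<open>\<open>(\<pi>, \<Omega>)\<close> is a GNS representation, on \<open>'h\<close>, of the normalized trace on the union of the tower.
  Values of \<open>\<pi>\<close> outside this union are irrelevant.\<close>

definition is_gns :: "(inf_mat \<Rightarrow> 'h::complex_hilbert_space \<Rightarrow> 'h) \<Rightarrow> 'h \<Rightarrow> bool" where
  "is_gns \<pi> \<Omega> \<longleftrightarrow>
     (\<forall>x\<in>tower_union. bounded_clinear (\<pi> x)) \<and>
     (\<forall>x\<in>tower_union. \<forall>y\<in>tower_union. \<pi> (im_add x y) = (\<lambda>\<xi>. \<pi> x \<xi> + \<pi> y \<xi>)) \<and>
     (\<forall>c. \<forall>x\<in>tower_union. \<pi> (im_scale c x) = (\<lambda>\<xi>. c *\<^sub>C \<pi> x \<xi>)) \<and>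
     (\<forall>x\<in>tower_union. \<forall>y\<in>tower_union. \<pi> (im_mult x y) = \<pi> x \<circ> \<pi> y) \<and>
     \<pi> im_one = id \<and>
     (\<forall>x\<in>tower_union. is_adjoint (\<pi> x) (\<pi> (im_adj x))) \<and>
     (\<forall>N x. cinner (\<pi> (amplify N x) \<Omega>) \<Omega> = (\<Sum>w | length w = N. x w w) / 4 ^ N) \<and>
     closure ((\<lambda>x. \<pi> x \<Omega>) ` tower_union) = UNIV"

definition hyperfinite_R :: "(inf_mat \<Rightarrow> 'h::complex_hilbert_space \<Rightarrow> 'h) \<Rightarrow> ('h \<Rightarrow> 'h) set" where
  "hyperfinite_R \<pi> = sot_closure (\<pi> ` tower_union)"

definition spin_subfactor ::
    "(inf_mat \<Rightarrow> 'h::complex_hilbert_space \<Rightarrow> 'h) \<Rightarrow> mat4 \<Rightarrow> ('h \<Rightarrow> 'h) set" where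
  "spin_subfactor \<pi> u = generated_vN_subalgebra (hyperfinite_R \<pi>)
     (\<pi> ` ({tensor [u ** d ** adj u] | d. d \<in> diag_mats} \<union> {jones j | j. j \<ge> 1}))"

definition hadamard_u :: "complex \<Rightarrow> mat4" where
  "hadamard_u z = (1 / 2) *\<^sub>R
     vector [vector [1,       1,  1,        1],
             vector [1,  \<i> * z, -1, -(\<i> * z)],
             vector [1,      -1,  1,       -1],
             vector [1, -(\<i> * z), -1,  \<i> * z]]"

end

theory Submission
  imports Defs "HOL-Computational_Algebra.Fundamental_Theorem_Algebra"
begin

text \<open>For a *-algebra \<open>N\<close> of tower elements, \<open>L\<^sup>2\<close> of the generated von Neumann algebra is the
  closure of \<open>N\<Omega>\<close>, because the strong closure of a *-algebra is already closed under adjoints. In a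
  basis adapted to \<open>u(z)\<close>, the algebras generated by \<open>u(z) \<Delta> u(z)\<^sup>*\<close> and finitely many Jones projections
  have matrix units \<open>W z \<alpha> \<beta>\<close> indexed by words, which depend on \<open>z\<close> only through phases. The vectors
  \<open>W a \<alpha> \<beta> \<Omega>\<close> and \<open>W b \<alpha> \<beta> \<Omega>\<close> span a space of dimension at most two invariant under both
  projections \<open>p\<close> and \<open>q\<close>. Hence \<open>W a \<alpha> \<beta> \<Omega>\<close> is an eigenvector of \<open>p q p\<close>, with eigenvalue
  \<open>\<bar>1 + s\<^sup>d\<bar>\<^sup>2 / 4\<close> where \<open>s = (cnj a * b)\<^sup>2\<close> is a primitive root of unity of order \<open>m / 2\<close>, and every
  integer \<open>d\<close> occurs. So \<open>p q p\<close> has finite spectrum, and the angle operator is determined on each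
  of its eigenspaces.\<close>

section \<open>Complex Hilbert spaces\<close>

text \<open>Exchanging columns 2 and 4 of \<open>u(z)\<close> gives \<open>u(-z)\<close>, so the
  conjugated diagonal algebra depends only on \<open>z^2\<close>; hence the squares in the phases
  and the restriction to even \<open>m\<close>. The trace averages over the bit \<open>x\<close> of
  one extra tensor factor on the left, and the two values of this bit give the two summands of an
  eigenvalue. A common prefix of the two words at most exchanges these summands, so their mean
  \<open>corr\<close> is the same at every level of the tower. This is why
  \<open>W a \<alpha> \<beta> \<Omega>\<close> is projected to a multiple of a single vector,
  although the target is a limit over all levels. The mean of two unit numbers has as modulus the
  absolute cosine of half the angle between them; that angle is a multiple of
  \<open>4 pi / m\<close>, which gives \<open>2 k pi / m\<close>. The angles 0 and
  \<open>pi / 2\<close> are discarded with the non-generic part, and for \<open>m = 4\<close>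
  nothing else is left. The angle operator is a definite description: a competing operator is known
  only through its positivity, its spectrum and its squared cosine, and need not be diagonal a
  priori. Uniqueness is therefore obtained from polynomial inequalities.\<close>

lemma scaleC_one [simp]: "1 *\<^sub>C (x::'h::complex_hilbert_space) = x"
  using scaleC_of_real[of 1 x] by simp

lemma scaleC_zero_left [simp]: "0 *\<^sub>C (x::'h::complex_hilbert_space) = 0"
  using scaleC_of_real[of 0 x] by simp

lemma scaleC_zero_right [simp]: "c *\<^sub>C (0::'h::complex_hilbert_space) = 0"
  using scaleC_scaleC[of c 0 "0::'h"] by simp

lemma scaleC_minus_left [simp]: "(- c) *\<^sub>C (x::'h::complex_hilbert_space) = - (c *\<^sub>C x)"
  using scaleC_add_left[of c "-c" x] by (simp add: eq_neg_iff_add_eq_0 add.commute)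

lemma scaleC_minus_right [simp]: "c *\<^sub>C (- x::'h::complex_hilbert_space) = - (c *\<^sub>C x)"
  using scaleC_add_right[of c x "-x"] by (simp add: eq_neg_iff_add_eq_0 add.commute)

lemma scaleC_diff_right: "c *\<^sub>C (x - y::'h::complex_hilbert_space) = c *\<^sub>C x - c *\<^sub>C y"
  using scaleC_add_right[of c x "-y"] by simp

lemma scaleC_diff_left: "(c - d) *\<^sub>C (x::'h::complex_hilbert_space) = c *\<^sub>C x - d *\<^sub>C x"
  using scaleC_add_left[of c "-d" x] by simp

lemma scaleC_sum_right: "c *\<^sub>C (\<Sum>i\<in>I. f i) = (\<Sum>i\<in>I. c *\<^sub>C (f i::'h::complex_hilbert_space))"
  by (induction I rule: infinite_finite_induct) (auto simp: scaleC_add_right)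

lemma scaleC_sum_left: "(\<Sum>i\<in>I. f i) *\<^sub>C x = (\<Sum>i\<in>I. f i *\<^sub>C (x::'h::complex_hilbert_space))"
  by (induction I rule: infinite_finite_induct) (auto simp: scaleC_add_left)

lemma cinner_add_right: "cinner x (y + z::'h::complex_hilbert_space) = cinner x y + cinner x z"
  by (metis cinner_add_left cinner_commute complex_cnj_add)

lemma cinner_scaleC_right: "cinner x (c *\<^sub>C y::'h::complex_hilbert_space) = cnj c * cinner x y"
  by (metis cinner_scaleC_left cinner_commute complex_cnj_mult)

lemma cinner_scaleR_left: "cinner (r *\<^sub>R x) (y::'h::complex_hilbert_space) = of_real r * cinner x y"
  by (metis cinner_scaleC_left scaleC_of_real)

lemma cinner_scaleR_right: "cinner x (r *\<^sub>R y::'h::complex_hilbert_space) = of_real r * cinner x y"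
  by (metis cinner_scaleC_right scaleC_of_real complex_cnj_complex_of_real)

lemma cinner_zero_left [simp]: "cinner 0 (y::'h::complex_hilbert_space) = 0"
  by (metis cinner_scaleC_left mult_zero_left scaleC_zero_left)

lemma cinner_zero_right [simp]: "cinner y (0::'h::complex_hilbert_space) = 0"
  by (metis cinner_commute cinner_zero_left complex_cnj_zero)

lemma cinner_minus_left [simp]: "cinner (- x) (y::'h::complex_hilbert_space) = - cinner x y"
  using cinner_scaleC_left[of "-1" x y] by simp

lemma cinner_minus_right [simp]: "cinner x (- y::'h::complex_hilbert_space) = - cinner x y"
  using cinner_scaleC_right[of x "-1" y] by simp

lemma cinner_diff_left: "cinner (x - y) (z::'h::complex_hilbert_space) = cinner x z - cinner y z"
  using cinner_add_left[of x "-y" z] by simp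

lemma cinner_diff_right: "cinner x (y - z::'h::complex_hilbert_space) = cinner x y - cinner x z"
  using cinner_add_right[of x y "-z"] by simp

lemma cinner_sum_left: "cinner (\<Sum>i\<in>I. f i) (y::'h::complex_hilbert_space) = (\<Sum>i\<in>I. cinner (f i) y)"
  by (induction I rule: infinite_finite_induct) (auto simp: cinner_add_left)

lemma cinner_sum_right: "cinner y (\<Sum>i\<in>I. f i::'h::complex_hilbert_space) = (\<Sum>i\<in>I. cinner y (f i))"
  by (induction I rule: infinite_finite_induct) (auto simp: cinner_add_right)

lemmas cinner_simps = cinner_add_left cinner_add_right cinner_diff_left cinner_diff_right
  cinner_scaleC_left cinner_scaleC_right

lemma norm_sq_cinner: "(norm (x::'h::complex_hilbert_space))\<^sup>2 = Re (cinner x x)"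
  by (simp add: cinner_self)

lemma cinner_eq_0_iff [simp]: "cinner x x = 0 \<longleftrightarrow> (x::'h::complex_hilbert_space) = 0"
  by (simp add: cinner_self)

lemma norm_scaleC: "norm (c *\<^sub>C (x::'h::complex_hilbert_space)) = cmod c * norm x"
proof -
  have "complex_of_real ((norm (c *\<^sub>C x))\<^sup>2) = c * cnj c * of_real ((norm x)\<^sup>2)"
    by (simp only: cinner_self[symmetric] cinner_scaleC_left cinner_scaleC_right mult_ac)
  also have "\<dots> = of_real ((cmod c * norm x)\<^sup>2)"
    by (simp only: power_mult_distrib of_real_mult complex_norm_square)
  finally show ?thesis
    by (metis of_real_eq_iff norm_ge_zero mult_nonneg_nonneg power2_eq_imp_eq)
qed

lemma norm_add_sq:
  "(norm (x + y::'h::complex_hilbert_space))\<^sup>2 = (norm x)\<^sup>2 + 2 * Re (cinner x y) + (norm y)\<^sup>2"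
proof -
  have "Re (cinner y x) = Re (cinner x y)" by (subst cinner_commute) simp
  thus ?thesis by (simp add: norm_sq_cinner cinner_simps)
qed

lemma norm_diff_sq:
  "(norm (x - y::'h::complex_hilbert_space))\<^sup>2 = (norm x)\<^sup>2 - 2 * Re (cinner x y) + (norm y)\<^sup>2"
  using norm_add_sq[of x "-y"] by simp

text \<open>For small \<open>e\<close> the first-order term dominates. This turns the minimality of
  a distance into orthogonality in the projection theorem.\<close>

lemma quadratic_nonneg_imp_zero:
  fixes c d :: real
  assumes "\<And>e. e > 0 \<Longrightarrow> 0 \<le> - 2 * e * c + e\<^sup>2 * c * d" and "c \<ge> 0" "d \<ge> 0"
  shows "c = 0"
proof (rule ccontr)
  assume "c \<noteq> 0"
  hence c: "c > 0" using assms by simp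
  define e where "e = 1 / (1 + d)"
  have e: "e > 0" "e * d < 1" using assms(3) by (auto simp: e_def)
  have "0 \<le> e * c * (e * d - 2)" using assms(1)[OF e(1)] by (simp add: algebra_simps power2_eq_square)
  moreover have "e * c * (e * d - 2) < 0"
    using e c by (intro mult_pos_neg mult_pos_pos) auto
  ultimately show False by simp
qed

lemma cinner_Cauchy_Schwarz: "cmod (cinner x y) \<le> norm (x::'h::complex_hilbert_space) * norm y"
proof (cases "y = 0")
  case False
  define c where "c = cinner x y / of_real ((norm y)\<^sup>2)"
  have "0 \<le> (norm (x - c *\<^sub>C y))\<^sup>2" by simp
  also have "\<dots> = (norm x)\<^sup>2 - 2 * Re (cnj c * cinner x y) + (cmod c * norm y)\<^sup>2"
    by (simp only: norm_diff_sq cinner_scaleC_right norm_scaleC)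
  also have "Re (cnj c * cinner x y) = (cmod (cinner x y))\<^sup>2 / (norm y)\<^sup>2"
  proof -
    have "cnj c * cinner x y = of_real ((cmod (cinner x y))\<^sup>2 / (norm y)\<^sup>2)"
      unfolding of_real_divide complex_norm_square[of "cinner x y"] by (simp add: c_def mult.commute)
    thus ?thesis by simp
  qed
  also have "(cmod c * norm y)\<^sup>2 = (cmod (cinner x y))\<^sup>2 / (norm y)\<^sup>2"
    using False
    by (simp add: c_def norm_divide norm_power power_divide power_mult_distrib) (simp add: power2_eq_square power4_eq_xxxx)
  finally have "(cmod (cinner x y))\<^sup>2 / (norm y)\<^sup>2 \<le> (norm x)\<^sup>2" by simp
  hence "(cmod (cinner x y))\<^sup>2 \<le> (norm x * norm y)\<^sup>2"
    using False by (simp add: field_simps power_mult_distrib)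
  thus ?thesis by (rule power2_le_imp_le) simp
qed simp

lemma bounded_linear_scaleC: "bounded_linear (\<lambda>x::'h::complex_hilbert_space. c *\<^sub>C x)"
proof (rule bounded_linear_intro[where K = "cmod c"])
  show "c *\<^sub>C (r *\<^sub>R x) = r *\<^sub>R (c *\<^sub>C x)" for r and x :: 'h
    by (metis scaleC_of_real scaleC_scaleC mult.commute)
qed (auto simp: scaleC_add_right norm_scaleC)

lemma scaleC_scaleR: "c *\<^sub>C (r *\<^sub>R (x::'h::complex_hilbert_space)) = r *\<^sub>R (c *\<^sub>C x)"
  by (metis scaleC_of_real scaleC_scaleC mult.commute)

lemma bounded_linear_cinner_left: "bounded_linear (\<lambda>x. cinner x (y::'h::complex_hilbert_space))"
  by (rule bounded_linear_intro[where K = "norm y"])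
    (auto simp: cinner_add_left cinner_scaleR_left scaleR_conv_of_real cinner_Cauchy_Schwarz)

lemma bounded_linear_cinner_right: "bounded_linear (\<lambda>y. cinner (x::'h::complex_hilbert_space) y)"
  by (rule bounded_linear_intro[where K = "norm x"])
    (auto simp: cinner_add_right cinner_scaleR_right scaleR_conv_of_real cinner_Cauchy_Schwarz
      mult.commute[of _ "norm x"])

section \<open>Complex subspaces and their closures\<close>

definition csubspace :: "'h::complex_hilbert_space set \<Rightarrow> bool" where
  "csubspace S \<longleftrightarrow> 0 \<in> S \<and> (\<forall>x\<in>S. \<forall>y\<in>S. x + y \<in> S) \<and> (\<forall>c. \<forall>x\<in>S. c *\<^sub>C x \<in> S)"

lemma csubspace_0: "csubspace S \<Longrightarrow> 0 \<in> S"
  and csubspace_add: "csubspace S \<Longrightarrow> x \<in> S \<Longrightarrow> y \<in> S \<Longrightarrow> x + y \<in> S"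
  and csubspace_scaleC: "csubspace S \<Longrightarrow> x \<in> S \<Longrightarrow> c *\<^sub>C x \<in> S"
  by (auto simp: csubspace_def)

lemma csubspace_scaleR: "csubspace S \<Longrightarrow> x \<in> S \<Longrightarrow> r *\<^sub>R x \<in> S"
  by (metis csubspace_scaleC scaleC_of_real)

lemma csubspace_minus: "csubspace S \<Longrightarrow> x \<in> S \<Longrightarrow> - x \<in> S"
  using csubspace_scaleC[of S x "-1"] by simp

lemma csubspace_diff: "csubspace S \<Longrightarrow> x \<in> S \<Longrightarrow> y \<in> S \<Longrightarrow> x - y \<in> S"
  using csubspace_add[of S x "-y"] csubspace_minus[of S y] by simp

lemma csubspace_sum: "csubspace S \<Longrightarrow> (\<And>i. i \<in> I \<Longrightarrow> f i \<in> S) \<Longrightarrow> (\<Sum>i\<in>I. f i) \<in> S"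
  by (induction I rule: infinite_finite_induct) (auto simp: csubspace_0 csubspace_add)

lemma csubspace_closure:
  assumes "csubspace (S::'h::complex_hilbert_space set)"
  shows "csubspace (closure S)"
  unfolding csubspace_def
proof (intro conjI ballI allI)
  show "0 \<in> closure S" using assms csubspace_0 closure_subset by blast
next
  fix x y assume "x \<in> closure S" "y \<in> closure S"
  then obtain f g where f: "\<And>n. f n \<in> S" "f \<longlonglongrightarrow> x" and g: "\<And>n. g n \<in> S" "g \<longlonglongrightarrow> y"
    by (metis closure_sequential)
  have "(\<lambda>n. f n + g n) \<longlonglongrightarrow> x + y" by (intro tendsto_add f g)
  thus "x + y \<in> closure S"
    unfolding closure_sequential using csubspace_add[OF assms f(1) g(1)]
    by (intro exI[of _ "\<lambda>n. f n + g n"]) auto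
next
  fix c x assume "x \<in> closure S"
  then obtain f where f: "\<And>n. f n \<in> S" "f \<longlonglongrightarrow> x"
    by (metis closure_sequential)
  have "(\<lambda>n. c *\<^sub>C f n) \<longlonglongrightarrow> c *\<^sub>C x"
    by (intro bounded_linear.tendsto[OF bounded_linear_scaleC] f)
  thus "c *\<^sub>C x \<in> closure S"
    unfolding closure_sequential using csubspace_scaleC[OF assms f(1)]
    by (intro exI[of _ "\<lambda>n. c *\<^sub>C f n"]) auto
qed

subsection \<open>Orthogonal projections\<close>

text \<open>The families \<open>\<xi>\<close> over a finite index set form a Hilbert space. This is its projection
  theorem for the closure of \<open>V\<close>: \<open>r\<close> is the component of \<open>z\<close> orthogonal to \<open>V\<close>.\<close>

lemma orthogonal_component_exists:
  fixes V :: "('i \<Rightarrow> 'h::complex_hilbert_space) set"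
  assumes I: "finite I"
    and V0: "(\<lambda>_. 0) \<in> V"
    and V1: "\<And>c v w. v \<in> V \<Longrightarrow> w \<in> V \<Longrightarrow> (\<lambda>i. v i + c *\<^sub>C w i) \<in> V"
  shows "\<exists>r. (\<forall>v\<in>V. (\<Sum>i\<in>I. cinner (v i) (r i)) = 0) \<and>
             (\<forall>e>0. \<exists>v\<in>V. \<forall>i\<in>I. norm (z i - v i - r i) < e)"
proof -
  define Q where "Q f = (\<Sum>i\<in>I. (norm (f i))\<^sup>2)" for f :: "'i \<Rightarrow> 'h"
  have Q0: "Q f \<ge> 0" for f by (auto simp: Q_def intro: sum_nonneg)
  define D where "D = (\<lambda>v. Q (\<lambda>i. z i - v i)) ` V"
  define d where "d = Inf D"
  have bdd: "bdd_below D" unfolding D_def using Q0 by (intro bdd_belowI[of _ 0]) auto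
  have d_le: "d \<le> Q (\<lambda>i. z i - v i)" if "v \<in> V" for v
    unfolding d_def using that by (intro cInf_lower bdd) (auto simp: D_def)
  have "\<exists>v\<in>V. Q (\<lambda>i. z i - v i) < d + 1 / real (Suc k)" for k
  proof -
    have "Inf D < d + 1 / real (Suc k)" by (simp add: d_def)
    moreover have "D \<noteq> {}" using V0 by (auto simp: D_def)
    ultimately obtain y where "y \<in> D" "y < d + 1 / real (Suc k)" by (meson cInf_lessD)
    thus ?thesis by (auto simp: D_def)
  qed
  then obtain v where v: "\<And>k. v k \<in> V" "\<And>k. Q (\<lambda>i. z i - v k i) < d + 1 / real (Suc k)"
    by metis
  \<comment> \<open>Both \<open>v j\<close> and \<open>v k\<close> are almost closest to
    \<open>z\<close>, and their midpoint \<open>w\<close>, being in \<open>V\<close>, is no closer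
    than \<open>d\<close>; the parallelogram law then makes them close to each other.\<close>
  have par: "Q (\<lambda>i. v j i - v k i) \<le> 2 / real (Suc j) + 2 / real (Suc k)" for j k
  proof -
    define w where "w = (\<lambda>i. (1/2) *\<^sub>C v j i + (1/2) *\<^sub>C v k i)"
    have "(\<lambda>i. (\<lambda>i. (\<lambda>_. 0) i + (1/2) *\<^sub>C v j i) i + (1/2) *\<^sub>C v k i) \<in> V"
      using v(1) V0 by (intro V1)
    hence w: "w \<in> V" by (simp add: w_def)
    have "(norm (a - b))\<^sup>2 = 2 * (norm (y - a))\<^sup>2 + 2 * (norm (y - b))\<^sup>2
            - 4 * (norm (y - ((1/2) *\<^sub>C a + (1/2) *\<^sub>C b)))\<^sup>2" for a b y :: 'h
    proof -
      define p q where "p = y - a" and "q = y - b"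
      have "y - ((1/2) *\<^sub>C a + (1/2) *\<^sub>C b) = (1/2) *\<^sub>C (p + q)"
      proof -
        have "y = (1/2) *\<^sub>C y + (1/2) *\<^sub>C y" by (simp flip: scaleC_add_left)
        thus ?thesis unfolding p_def q_def by (simp add: scaleC_diff_right scaleC_add_right)
      qed
      moreover have "a - b = q - p" by (simp add: p_def q_def)
      moreover have "(norm ((1/2) *\<^sub>C (p + q)))\<^sup>2 = (norm (p + q))\<^sup>2 / 4"
        by (simp add: norm_scaleC power2_eq_square)
      moreover have "Re (cinner q p) = Re (cinner p q)" by (subst cinner_commute) simp
      ultimately show ?thesis
        unfolding p_def[symmetric] q_def[symmetric] by (simp add: norm_diff_sq norm_add_sq)
    qed
    note law = this
    have "Q (\<lambda>i. v j i - v k i) = 2 * Q (\<lambda>i. z i - v j i) + 2 * Q (\<lambda>i. z i - v k i)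
             - 4 * Q (\<lambda>i. z i - w i)"
      unfolding Q_def w_def sum_distrib_left sum.distrib[symmetric] sum_subtractf[symmetric]
      by (intro sum.cong refl law)
    moreover have "2 / real (Suc j) = 2 * (1 / real (Suc j))" "2 / real (Suc k) = 2 * (1 / real (Suc k))"
      by simp_all
    ultimately show ?thesis using v(2)[of j] v(2)[of k] d_le[OF w] by linarith
  qed
  have "Cauchy (\<lambda>k. v k i)" if i: "i \<in> I" for i
    unfolding Cauchy_def
  proof (intro allI impI)
    fix e :: real assume e: "e > 0"
    obtain M where M: "real M > 4 / e\<^sup>2" using reals_Archimedean2 by blast
    show "\<exists>M. \<forall>m\<ge>M. \<forall>n\<ge>M. dist (v m i) (v n i) < e"
    proof (intro exI allI impI)
      fix m n assume mn: "m \<ge> M" "n \<ge> M"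
      have "(norm (v m i - v n i))\<^sup>2 \<le> Q (\<lambda>i. v m i - v n i)"
        unfolding Q_def using I i by (intro member_le_sum) auto
      also have "\<dots> \<le> 2 / real (Suc m) + 2 / real (Suc n)" by (rule par)
      also have "\<dots> \<le> 2 / real (Suc M) + 2 / real (Suc M)"
        using mn by (intro add_mono divide_left_mono) auto
      also have "\<dots> < e\<^sup>2"
      proof -
        have "4 < e\<^sup>2 * real M" using M e by (simp add: field_simps)
        also have "\<dots> \<le> e\<^sup>2 * real (Suc M)" by (intro mult_left_mono) auto
        finally have "4 < e\<^sup>2 * real (Suc M)" .
        hence "4 / real (Suc M) < e\<^sup>2" by (subst pos_divide_less_eq) auto
        thus ?thesis by simp
      qed
      finally show "dist (v m i) (v n i) < e"
        using e by (simp add: dist_norm power_less_imp_less_base)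
    qed
  qed
  hence "\<forall>i. \<exists>l. i \<in> I \<longrightarrow> (\<lambda>k. v k i) \<longlonglongrightarrow> l"
    by (meson Cauchy_convergent_iff convergent_def)
  then obtain l where l: "\<And>i. i \<in> I \<Longrightarrow> (\<lambda>k. v k i) \<longlonglongrightarrow> l i" by metis
  define r where "r = (\<lambda>i. z i - l i)"
  have Ql: "(\<lambda>k. Q (\<lambda>i. z i - v k i + w i)) \<longlonglongrightarrow> Q (\<lambda>i. r i + w i)" for w
    unfolding Q_def r_def by (intro tendsto_intros l)
  have Qr: "Q r \<le> d"
  proof -
    have "(\<lambda>k. d + 1 / real (Suc k)) \<longlonglongrightarrow> d + 0"
      by (intro tendsto_add tendsto_const LIMSEQ_Suc lim_1_over_n)
    moreover have "(\<lambda>k. Q (\<lambda>i. z i - v k i)) \<longlonglongrightarrow> Q r" using Ql[of "\<lambda>_. 0"] by simp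
    ultimately show ?thesis
      using v(2) by (intro LIMSEQ_le[of _ _ "\<lambda>k. d + 1 / real (Suc k)"]) (auto intro: less_imp_le)
  qed
  have dr: "d \<le> Q (\<lambda>i. r i + c *\<^sub>C w i)" if "w \<in> V" for w c
  proof (rule LIMSEQ_le_const[OF Ql[of "\<lambda>i. c *\<^sub>C w i"]], intro exI allI impI)
    fix k
    have "z i - v k i + c *\<^sub>C w i = z i - (v k i + (- c) *\<^sub>C w i)" for i by simp
    thus "d \<le> Q (\<lambda>i. z i - v k i + c *\<^sub>C w i)"
      using d_le[OF V1[OF v(1)[of k] that, of "-c"]] by (simp only:)
  qed
  have orth: "(\<Sum>i\<in>I. cinner (w i) (r i)) = 0" if w: "w \<in> V" for w
  proof -
    define g where "g = (\<Sum>i\<in>I. cinner (w i) (r i))"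
    have gc: "(\<Sum>i\<in>I. cinner (r i) (w i)) = cnj g"
      by (simp add: g_def cinner_commute[of "r _"])
    have "0 \<le> - 2 * e * (cmod g)\<^sup>2 + e\<^sup>2 * (cmod g)\<^sup>2 * Q w" if "e > 0" for e
    proof -
      \<comment> \<open>Moving \<open>r\<close> in this direction changes \<open>Q\<close> to first
        order by \<open>- 2 * e * (cmod g)^2\<close>, which minimality forbids unless
        \<open>g = 0\<close>.\<close>
      define c where "c = - of_real e * cnj g"
      have "Q (\<lambda>i. r i + c *\<^sub>C w i) = Q r + 2 * Re (\<Sum>i\<in>I. cinner (r i) (c *\<^sub>C w i)) + (cmod c)\<^sup>2 * Q w"
        unfolding Q_def
        by (simp add: norm_add_sq norm_scaleC sum.distrib power_mult_distrib Re_sum sum_distrib_left)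
      also have "(\<Sum>i\<in>I. cinner (r i) (c *\<^sub>C w i)) = cnj c * cnj g"
        by (simp add: cinner_scaleC_right gc flip: sum_distrib_left)
      also have "\<dots> = of_real (- e * (cmod g)\<^sup>2)"
        using complex_norm_square[of g] by (simp add: c_def mult_ac)
      also have "(cmod c)\<^sup>2 = e\<^sup>2 * (cmod g)\<^sup>2"
        by (simp add: c_def norm_mult power_mult_distrib)
      finally show ?thesis using dr[OF w, of c] Qr by simp
    qed
    hence "(cmod g)\<^sup>2 = 0" using Q0 by (intro quadratic_nonneg_imp_zero[of _ "Q w"]) auto
    thus ?thesis by (simp add: g_def)
  qed
  have "\<exists>v\<in>V. \<forall>i\<in>I. norm (z i - v i - r i) < e" if "e > 0" for e
  proof -
    have "eventually (\<lambda>k. \<forall>i\<in>I. norm (v k i - l i) < e) sequentially"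
      using l that by (intro eventually_ball_finite I ballI) (auto simp: tendsto_iff dist_norm)
    then obtain k where "\<forall>i\<in>I. norm (v k i - l i) < e"
      by (auto simp: eventually_sequentially)
    thus ?thesis using v(1) by (intro bexI[of _ "v k"]) (auto simp: r_def norm_minus_commute)
  qed
  thus ?thesis using orth by blast
qed

lemma orth_complD: "\<xi> \<in> orth_compl S \<Longrightarrow> \<eta> \<in> S \<Longrightarrow> cinner \<xi> \<eta> = 0"
  by (simp add: orth_compl_def)

lemma orth_complD': "\<xi> \<in> orth_compl S \<Longrightarrow> \<eta> \<in> S \<Longrightarrow> cinner \<eta> \<xi> = 0"
  by (metis cinner_commute complex_cnj_zero orth_complD)

lemma projection_unique:
  assumes S: "csubspace S" and "\<eta> \<in> S" "\<xi> - \<eta> \<in> orth_compl S" "\<zeta> \<in> S" "\<xi> - \<zeta> \<in> orth_compl S"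
  shows "\<eta> = \<zeta>"
proof -
  have "\<eta> - \<zeta> \<in> S" using assms by (simp add: csubspace_diff)
  hence "cinner (\<xi> - \<zeta>) (\<eta> - \<zeta>) - cinner (\<xi> - \<eta>) (\<eta> - \<zeta>) = 0"
    using assms(3,5) by (simp add: orth_complD)
  hence "cinner (\<eta> - \<zeta>) (\<eta> - \<zeta>) = 0" by (simp flip: cinner_diff_left)
  thus ?thesis by simp
qed

text \<open>Families over the unit type are single vectors, so this is the one-component case of
  \<open>orthogonal_component_exists\<close>.\<close>

lemma projection_exists:
  assumes S: "csubspace S" "closed S"
  shows "\<exists>\<eta>\<in>S. \<xi> - \<eta> \<in> orth_compl S"
proof -
  obtain r where r: "\<forall>v\<in>(\<lambda>s (_::unit). s) ` S. (\<Sum>i\<in>{()}. cinner (v i) (r i)) = 0"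
      "\<forall>e>0. \<exists>v\<in>(\<lambda>s (_::unit). s) ` S. \<forall>i\<in>{()}. norm (\<xi> - v i - r i) < e"
  proof -
    have "(\<lambda>i. v i + c *\<^sub>C w i) \<in> (\<lambda>s (_::unit). s) ` S"
      if "v \<in> (\<lambda>s (_::unit). s) ` S" "w \<in> (\<lambda>s (_::unit). s) ` S" for c v w
      using that S(1) by (auto intro!: image_eqI csubspace_add csubspace_scaleC)
    thus ?thesis
      using orthogonal_component_exists[of "{()}" "(\<lambda>s (_::unit). s) ` S" "\<lambda>_. \<xi>"] S(1) that
      by (auto simp: csubspace_0)
  qed
  have "\<xi> - r () \<in> closure S"
    unfolding closure_approachable dist_norm using r(2)
    by (force simp: norm_minus_commute algebra_simps)
  moreover have "r () \<in> orth_compl S" using r(1)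
    by (auto simp: orth_compl_def) (metis cinner_commute complex_cnj_zero)
  ultimately show ?thesis using S(2) by (intro bexI[of _ "\<xi> - r ()"]) auto
qed

lemma proj_eqI:
  assumes "csubspace S" "\<eta> \<in> S" "\<xi> - \<eta> \<in> orth_compl S"
  shows "proj S \<xi> = \<eta>"
  unfolding proj_def using assms projection_unique by (intro the_equality) blast+

lemma proj_in: "csubspace S \<Longrightarrow> closed S \<Longrightarrow> proj S \<xi> \<in> S"
  using projection_exists[of S \<xi>] proj_eqI[of S _ \<xi>] by auto

lemma proj_orth: "csubspace S \<Longrightarrow> closed S \<Longrightarrow> \<xi> - proj S \<xi> \<in> orth_compl S"
  using projection_exists[of S \<xi>] proj_eqI[of S _ \<xi>] by auto

lemma proj_id: "csubspace S \<Longrightarrow> \<xi> \<in> S \<Longrightarrow> proj S \<xi> = \<xi>"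
  by (intro proj_eqI) (auto simp: orth_compl_def)

lemma cinner_proj:
  assumes "csubspace S" "closed S"
  shows "cinner (proj S \<xi>) \<eta> = cinner \<xi> (proj S \<eta>)"
proof -
  have "cinner (proj S \<xi>) (\<eta> - proj S \<eta>) = 0" "cinner (\<xi> - proj S \<xi>) (proj S \<eta>) = 0"
    using orth_complD'[OF proj_orth] orth_complD[OF proj_orth] proj_in assms by blast+
  thus ?thesis by (simp add: cinner_simps)
qed

lemma csubspace_orth_compl: "csubspace (orth_compl S)"
  by (auto simp: csubspace_def orth_compl_def cinner_simps)

lemma proj_add:
  assumes "csubspace S" "closed S"
  shows "proj S (\<xi> + \<eta>) = proj S \<xi> + proj S \<eta>"
proof (rule proj_eqI)
  have "\<xi> + \<eta> - (proj S \<xi> + proj S \<eta>) = (\<xi> - proj S \<xi>) + (\<eta> - proj S \<eta>)" by simp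
  thus "\<xi> + \<eta> - (proj S \<xi> + proj S \<eta>) \<in> orth_compl S"
    using assms by (simp only:) (intro csubspace_add csubspace_orth_compl proj_orth)
qed (use assms in \<open>auto intro: csubspace_add proj_in\<close>)

lemma proj_scaleC:
  assumes "csubspace S" "closed S"
  shows "proj S (c *\<^sub>C \<xi>) = c *\<^sub>C proj S \<xi>"
proof (rule proj_eqI)
  show "c *\<^sub>C \<xi> - c *\<^sub>C proj S \<xi> \<in> orth_compl S"
    using assms by (simp only: scaleC_diff_right[symmetric]) (intro csubspace_scaleC csubspace_orth_compl proj_orth)
qed (use assms in \<open>auto intro: csubspace_scaleC proj_in\<close>)

lemma norm_proj_le:
  assumes "csubspace S" "closed S"
  shows "norm (proj S \<xi>) \<le> norm \<xi>"
proof -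
  have "cinner (proj S \<xi>) (\<xi> - proj S \<xi>) = 0" using orth_complD'[OF proj_orth] proj_in assms by blast
  hence "(norm (proj S \<xi> + (\<xi> - proj S \<xi>)))\<^sup>2 = (norm (proj S \<xi>))\<^sup>2 + (norm (\<xi> - proj S \<xi>))\<^sup>2"
    unfolding norm_add_sq by simp
  hence "(norm (proj S \<xi>))\<^sup>2 \<le> (norm \<xi>)\<^sup>2" by simp
  thus ?thesis by (rule power2_le_imp_le) simp
qed

lemma bounded_linear_proj:
  assumes "csubspace S" "closed S"
  shows "bounded_linear (proj S)"
proof (rule bounded_linear_intro[where K = 1])
  show "proj S (r *\<^sub>R x) = r *\<^sub>R proj S x" for r x
    using proj_scaleC[OF assms, of "of_real r" x] by (simp add: scaleC_of_real)
qed (auto simp: proj_add norm_proj_le assms)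

lemma riesz_representation:
  fixes f :: "'h::complex_hilbert_space \<Rightarrow> complex"
  assumes f: "bounded_linear f" "\<And>c x. f (c *\<^sub>C x) = c * f x"
  shows "\<exists>y. \<forall>x. f x = cinner x y"
proof (cases "\<forall>x. f x = 0")
  case False
  then obtain z where z: "f z \<noteq> 0" by blast
  interpret bounded_linear f by fact
  define N where "N = {x. f x = 0}"
  have N: "csubspace N" by (auto simp: N_def csubspace_def zero add f)
  have "closed N" unfolding N_def
    by (intro closed_Collect_eq continuous_intros continuous_on f(1)) 
  define r where "r = z - proj N z"
  have "f (proj N z) = 0" using proj_in[OF N \<open>closed N\<close>] by (auto simp: N_def)
  hence fr: "f r \<noteq> 0" using z by (simp add: r_def diff)
  hence r0: "r \<noteq> 0" using zero by auto
  have r: "r \<in> orth_compl N" unfolding r_def by (rule proj_orth) fact+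
  define y where "y = (cnj (f r) / of_real ((norm r)\<^sup>2)) *\<^sub>C r"
  have "f x = cinner x y" for x
  proof -
    have "x - (f x / f r) *\<^sub>C r \<in> N" using fr by (simp add: N_def diff f(2))
    hence "cinner (x - (f x / f r) *\<^sub>C r) r = 0" using r orth_complD' by blast
    hence "cinner x r = f x / f r * of_real ((norm r)\<^sup>2)" by (simp add: cinner_simps cinner_self)
    thus ?thesis using fr r0 by (simp add: y_def cinner_scaleC_right)
  qed
  thus ?thesis by blast
qed (auto intro: exI[of _ 0])

section \<open>Von Neumann algebras\<close>

lemma bounded_clinear_add: "bounded_clinear T \<Longrightarrow> T (x + y) = T x + T y"
  and bounded_clinear_scaleC: "bounded_clinear T \<Longrightarrow> T (c *\<^sub>C x) = c *\<^sub>C T x"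
  and bounded_clinear_zero: "bounded_clinear T \<Longrightarrow> T 0 = 0"
  and bounded_clinear_diff: "bounded_clinear T \<Longrightarrow> T (x - y) = T x - T y"
  and bounded_clinear_sum: "bounded_clinear T \<Longrightarrow> T (\<Sum>i\<in>I. f i) = (\<Sum>i\<in>I. T (f i))"
  unfolding bounded_clinear_def
  by (auto simp: linear_add linear_0 linear_diff linear_sum bounded_linear.linear)

lemma bounded_clinearI:
  assumes "\<And>x y. T (x + y) = T x + T y" "\<And>c x. T (c *\<^sub>C x) = c *\<^sub>C T x" "\<And>x. norm (T x) \<le> K * norm x"
  shows "bounded_clinear T"
  unfolding bounded_clinear_def
proof (intro conjI)
  show "bounded_linear T"
  proof (rule bounded_linear_intro[where K = K])
    show "T (r *\<^sub>R x) = r *\<^sub>R T x" for r x using assms(2)[of "of_real r" x] by (simp add: scaleC_of_real)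
  qed (use assms in \<open>auto simp: mult.commute\<close>)
qed (use assms in auto)

lemma bounded_clinear_bound: "bounded_clinear T \<Longrightarrow> \<exists>K>0. \<forall>x. norm (T x) \<le> K * norm x"
  unfolding bounded_clinear_def by (metis bounded_linear.pos_bounded mult.commute)

lemma bounded_clinear_id: "bounded_clinear id"
  by (rule bounded_clinearI[where K = 1]) auto

lemma bounded_clinear_plus:
  "bounded_clinear S \<Longrightarrow> bounded_clinear T \<Longrightarrow> bounded_clinear (\<lambda>\<xi>. S \<xi> + T \<xi>)"
  unfolding bounded_clinear_def by (auto simp: scaleC_add_right intro: bounded_linear_add)

lemma bounded_clinear_mult: "bounded_clinear T \<Longrightarrow> bounded_clinear (\<lambda>\<xi>. c *\<^sub>C T \<xi>)"
  unfolding bounded_clinear_def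
  by (auto simp: scaleC_scaleC mult.commute intro: bounded_linear_compose[OF bounded_linear_scaleC])

lemma bounded_clinear_comp: "bounded_clinear S \<Longrightarrow> bounded_clinear T \<Longrightarrow> bounded_clinear (S \<circ> T)"
  unfolding bounded_clinear_def o_def by (auto intro: bounded_linear_compose)

section \<open>Adjoints and the strong operator closure\<close>

lemma is_adjoint_sym: "is_adjoint T S \<Longrightarrow> is_adjoint S T"
  unfolding is_adjoint_def by (metis cinner_commute)

lemma adjoint_exists:
  fixes T :: "'h::complex_hilbert_space \<Rightarrow> 'h"
  assumes T: "bounded_clinear T"
  shows "\<exists>S. bounded_clinear S \<and> is_adjoint T S"
proof -
  have "\<exists>y. \<forall>x. cinner (T x) \<eta> = cinner x y" for \<eta>
  proof (rule riesz_representation)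
    show "bounded_linear (\<lambda>x. cinner (T x) \<eta>)"
      using T bounded_linear_compose[OF bounded_linear_cinner_left, of T]
      by (simp add: bounded_clinear_def)
  qed (use T in \<open>simp add: bounded_clinear_scaleC cinner_scaleC_left\<close>)
  then obtain S where S: "\<And>\<eta> x. cinner (T x) \<eta> = cinner x (S \<eta>)" by metis
  have eqI: "u = v" if "\<And>x. cinner x u = cinner x v" for u v :: 'h
  proof -
    have "cinner (u - v) (u - v) = 0" using that[of "u - v"] by (simp add: cinner_diff_right)
    thus ?thesis by simp
  qed
  obtain K where K: "\<forall>x. norm (T x) \<le> K * norm x" using bounded_clinear_bound[OF T] by blast
  have "bounded_clinear S"
  proof (rule bounded_clinearI[where K = K])
    fix x
    show "norm (S x) \<le> K * norm x"
    proof (cases "S x = 0")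
      case True
      have "0 \<le> norm (T x)" by simp
      also have "\<dots> \<le> K * norm x" using K by blast
      finally show ?thesis using True by simp
    next
      case False
      have "(norm (S x))\<^sup>2 = cmod (cinner (T (S x)) x)"
        by (simp add: S cinner_self norm_power)
      also have "\<dots> \<le> norm (T (S x)) * norm x" by (rule cinner_Cauchy_Schwarz)
      also have "\<dots> \<le> K * norm (S x) * norm x" using K by (intro mult_right_mono) auto
      finally show ?thesis using False by (simp add: power2_eq_square)
    qed
  qed (auto intro!: eqI simp: cinner_simps simp flip: S)
  thus ?thesis using S by (auto simp: is_adjoint_def)
qed

text \<open>A basic neighbourhood of the product topology restricts only finitely many coordinates,
  here the vectors in \<open>F\<close>, and finitely many radii have a common lower bound.\<close>

lemma in_sot_closure_iff:
  fixes T :: "'h::complex_hilbert_space \<Rightarrow> 'h"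
  shows "T \<in> closure N \<longleftrightarrow> (\<forall>F e. finite F \<longrightarrow> e > 0 \<longrightarrow> (\<exists>S\<in>N. \<forall>\<xi>\<in>F. norm (S \<xi> - T \<xi>) < e))"
proof
  assume T: "T \<in> closure N"
  show "\<forall>F e. finite F \<longrightarrow> e > 0 \<longrightarrow> (\<exists>S\<in>N. \<forall>\<xi>\<in>F. norm (S \<xi> - T \<xi>) < e)"
  proof (intro allI impI)
    fix F :: "'h set" and e :: real assume F: "finite F" and e: "e > 0"
    define U where "U = {S. \<forall>i\<in>F. S (id i) \<in> ball (T i) e}"
    have "open U" unfolding U_def using F by (intro product_topology_basis'[where x = id]) auto
    moreover have "T \<in> U" using e by (simp add: U_def)
    ultimately have "N \<inter> U \<noteq> {}" using T unfolding closure_iff_nhds_not_empty by blast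
    thus "\<exists>S\<in>N. \<forall>\<xi>\<in>F. norm (S \<xi> - T \<xi>) < e"
      by (auto simp: U_def dist_norm norm_minus_commute)
  qed
next
  assume *: "\<forall>F e. finite F \<longrightarrow> e > 0 \<longrightarrow> (\<exists>S\<in>N. \<forall>\<xi>\<in>F. norm (S \<xi> - T \<xi>) < e)"
  show "T \<in> closure N"
    unfolding closure_iff_nhds_not_empty
  proof (intro allI impI)
    fix A V assume "V \<subseteq> A" "open V" "T \<in> V"
    then obtain X where X: "T \<in> Pi\<^sub>E UNIV X" "\<And>i. open (X i)" "finite {i. X i \<noteq> UNIV}" "Pi\<^sub>E UNIV X \<subseteq> V"
      using product_topology_open_contains_basis[of "\<lambda>_. euclidean" UNIV V T]
      by (auto simp: open_fun_def)
    define F where "F = {i. X i \<noteq> UNIV}"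
    have "\<forall>i. \<exists>e>0. ball (T i) e \<subseteq> X i"
      using X(1,2) by (metis PiE_mem UNIV_I openE)
    then obtain d where d: "\<And>i. d i > 0" "\<And>i. ball (T i) (d i) \<subseteq> X i" by metis
    \<comment> \<open>The inserted 1 keeps the minimum defined when no coordinate is
      restricted.\<close>
    define e where "e = Min (insert 1 (d ` F))"
    have "finite F" using X(3) by (simp add: F_def)
    hence e: "e > 0" "\<And>i. i \<in> F \<Longrightarrow> e \<le> d i" using d(1) by (auto simp: e_def)
    obtain S where S: "S \<in> N" "\<forall>\<xi>\<in>F. norm (S \<xi> - T \<xi>) < e" using * \<open>finite F\<close> e(1) by blast
    have "S i \<in> X i" for i
    proof (cases "i \<in> F")
      case True
      hence "S i \<in> ball (T i) (d i)" using S(2) e(2)[OF True]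
        by (auto simp: dist_norm norm_minus_commute intro: less_le_trans)
      thus ?thesis using d(2) by blast
    qed (simp add: F_def)
    hence "S \<in> Pi\<^sub>E UNIV X" by (simp add: PiE_UNIV_domain)
    thus "N \<inter> A \<noteq> {}" using X(4) S(1) \<open>V \<subseteq> A\<close> by blast
  qed
qed

definition star_algebra :: "('h::complex_hilbert_space \<Rightarrow> 'h) set \<Rightarrow> bool" where
  "star_algebra N \<longleftrightarrow>
     (\<forall>T\<in>N. bounded_clinear T) \<and>
     id \<in> N \<and>
     (\<forall>S\<in>N. \<forall>T\<in>N. (\<lambda>\<xi>. S \<xi> + T \<xi>) \<in> N) \<and>
     (\<forall>c. \<forall>T\<in>N. (\<lambda>\<xi>. c *\<^sub>C T \<xi>) \<in> N) \<and>
     (\<forall>S\<in>N. \<forall>T\<in>N. S \<circ> T \<in> N) \<and>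
     (\<forall>T\<in>N. \<exists>S\<in>N. is_adjoint T S)"

lemma star_algebra_add:
  "star_algebra N \<Longrightarrow> S \<in> N \<Longrightarrow> T \<in> N \<Longrightarrow> (\<lambda>\<xi>. S \<xi> + T \<xi>) \<in> N"
  by (auto simp: star_algebra_def)

lemma von_neumann_algebra_iff: "von_neumann_algebra N \<longleftrightarrow> star_algebra N \<and> sot_closure N = N"
  by (auto simp: von_neumann_algebra_def star_algebra_def)

text \<open>Taking adjoints is not continuous for the strong topology. But a vector tuple orthogonal to
  all \<open>(A \<xi>)\<^sub>\<xi>\<close> with \<open>A \<in> N\<close> is orthogonal to \<open>(T\<^sup>* \<xi>)\<^sub>\<xi>\<close>, by moving the adjoint to the other side.\<close>

lemma adjoint_in_sot_closure:
  assumes N: "star_algebra N" and T: "T \<in> sot_closure N" and S: "bounded_clinear S" "is_adjoint T S"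
  shows "S \<in> sot_closure N"
proof -
  have "\<exists>A\<in>N. \<forall>\<xi>\<in>F. norm (A \<xi> - S \<xi>) < e" if F: "finite F" and e: "e > 0" for F e
  proof -
    have N': "(\<lambda>_. 0) \<in> N"
    proof -
      have "(\<lambda>\<xi>. 0 *\<^sub>C id \<xi>) \<in> N" using N unfolding star_algebra_def by blast
      thus ?thesis by simp
    qed
    \<comment> \<open>\<open>r\<close> is the component, orthogonal to \<open>N\<close>, of the
      tuple of the vectors \<open>S \<xi>\<close> with \<xi> in \<open>F\<close>.\<close>
    obtain r where r: "\<And>A. A \<in> N \<Longrightarrow> (\<Sum>\<xi>\<in>F. cinner (A \<xi>) (r \<xi>)) = 0"
        "\<And>e. e > 0 \<Longrightarrow> \<exists>A\<in>N. \<forall>\<xi>\<in>F. norm (S \<xi> - A \<xi> - r \<xi>) < e"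
    proof -
      have vw: "(\<lambda>i. v i + c *\<^sub>C w i) \<in> N" if "v \<in> N" "w \<in> N" for c v w
      proof -
        have "(\<lambda>i. c *\<^sub>C w i) \<in> N" using N that unfolding star_algebra_def by blast
        thus ?thesis using star_algebra_add[OF N that(1), of "\<lambda>i. c *\<^sub>C w i"] by blast
      qed
      obtain r where "(\<forall>v\<in>N. (\<Sum>i\<in>F. cinner (v i) (r i)) = 0) \<and>
             (\<forall>e>0. \<exists>v\<in>N. \<forall>i\<in>F. norm (S i - v i - r i) < e)"
        using orthogonal_component_exists[of F N S, OF F N' vw] by blast
      thus ?thesis using that[of r] by blast
    qed
    \<comment> \<open>With the adjoint moved to the other side, \<open>T\<close> has to be
      approximated at the vectors \<open>r \<xi>\<close>, not at \<xi>. The approximating operator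
      has its adjoint in \<open>N\<close>, whose tuple is orthogonal to \<open>r\<close>.\<close>
    have Sr: "(\<Sum>\<xi>\<in>F. cinner (S \<xi>) (r \<xi>)) = 0"
    proof -
      have *: "cmod (\<Sum>\<xi>\<in>F. cinner (S \<xi>) (r \<xi>)) \<le> d * (\<Sum>\<xi>\<in>F. norm \<xi>)" if d: "d > 0" for d
      proof -
        obtain A where A: "A \<in> N" "\<forall>\<eta>\<in>r ` F. norm (A \<eta> - T \<eta>) < d"
          using T F d unfolding sot_closure_def Int_iff in_sot_closure_iff by blast
        obtain B where B: "B \<in> N" "is_adjoint A B" using N A by (auto simp: star_algebra_def)
        have "(\<Sum>\<xi>\<in>F. cinner (S \<xi>) (r \<xi>)) = (\<Sum>\<xi>\<in>F. cinner \<xi> (T (r \<xi>)))"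
          using is_adjoint_sym[OF S(2)] by (simp add: is_adjoint_def)
        also have "\<dots> = (\<Sum>\<xi>\<in>F. cinner \<xi> (T (r \<xi>) - A (r \<xi>)))"
          using r(1)[OF B(1)] is_adjoint_sym[OF B(2)]
          by (simp add: is_adjoint_def cinner_diff_right sum_subtractf)
        also have "cmod \<dots> \<le> (\<Sum>\<xi>\<in>F. norm \<xi> * d)"
          using A(2) by (intro sum_norm_le order.trans[OF cinner_Cauchy_Schwarz] mult_left_mono)
            (auto simp: norm_minus_commute intro: less_imp_le)
        finally show ?thesis by (simp add: sum_distrib_left mult.commute)
      qed
      have "cmod (\<Sum>\<xi>\<in>F. cinner (S \<xi>) (r \<xi>)) \<le> 0 + e" if e: "e > 0" for e
      proof -
        define s where "s = (\<Sum>\<xi>\<in>F. norm \<xi>)"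
        have s: "s \<ge> 0" by (simp add: s_def sum_nonneg)
        have "e / (1 + s) * s \<le> e" using s e by (simp add: field_simps)
        thus ?thesis using *[of "e / (1 + s)"] s e by (simp add: s_def)
      qed
      hence "cmod (\<Sum>\<xi>\<in>F. cinner (S \<xi>) (r \<xi>)) \<le> 0" by (rule field_le_epsilon)
      thus ?thesis by simp
    qed
    \<comment> \<open>\<open>r\<close> is a limit of tuples of vectors
      \<open>S \<xi> - A \<xi>\<close>, all of which are orthogonal to \<open>r\<close>; hence it is
      orthogonal to itself.\<close>
    have r0: "r \<xi> = 0" if x: "\<xi> \<in> F" for \<xi>
    proof -
      define s where "s = (\<Sum>\<xi>\<in>F. norm (r \<xi>))"
      have s: "s \<ge> 0" by (simp add: s_def sum_nonneg)
      have *: "(norm (r \<xi>))\<^sup>2 \<le> d * s" if d: "d > 0" for d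
      proof -
        obtain A where A: "A \<in> N" "\<forall>\<xi>\<in>F. norm (S \<xi> - A \<xi> - r \<xi>) < d" using r(2)[OF d] by blast
        have "(norm (r \<xi>))\<^sup>2 \<le> (\<Sum>\<xi>\<in>F. (norm (r \<xi>))\<^sup>2)" using F x by (intro member_le_sum) auto
        also have "\<dots> = cmod (\<Sum>\<xi>\<in>F. cinner (r \<xi>) (r \<xi>))"
          by (simp add: cinner_self sum_nonneg flip: of_real_power of_real_sum)
        also have "(\<Sum>\<xi>\<in>F. cinner (r \<xi>) (r \<xi>)) = - (\<Sum>\<xi>\<in>F. cinner (S \<xi> - A \<xi> - r \<xi>) (r \<xi>))"
          using Sr r(1)[OF A(1)] by (simp add: cinner_diff_left sum_subtractf)
        also have "cmod \<dots> \<le> (\<Sum>\<xi>\<in>F. d * norm (r \<xi>))"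
          using A(2) by (simp only: norm_minus_cancel)
            (intro sum_norm_le order.trans[OF cinner_Cauchy_Schwarz] mult_right_mono, auto intro: less_imp_le)
        finally show ?thesis by (simp add: s_def sum_distrib_left)
      qed
      have "(norm (r \<xi>))\<^sup>2 \<le> 0 + e" if e: "e > 0" for e
      proof -
        have "e / (1 + s) * s \<le> e" using s e by (simp add: field_simps)
        thus ?thesis using *[of "e / (1 + s)"] s e by simp
      qed
      hence "(norm (r \<xi>))\<^sup>2 \<le> 0" by (rule field_le_epsilon)
      thus ?thesis by simp
    qed
    obtain A where "A \<in> N" "\<forall>\<xi>\<in>F. norm (S \<xi> - A \<xi> - r \<xi>) < e" using r(2)[OF e] by blast
    thus ?thesis using r0 by (auto simp: norm_minus_commute)
  qed
  thus ?thesis using S(1) by (simp add: sot_closure_def in_sot_closure_iff)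
qed

lemma sot_closure_mono: "M \<subseteq> N \<Longrightarrow> sot_closure M \<subseteq> sot_closure N"
  unfolding sot_closure_def using closure_mono by blast

lemma subset_sot_closure: "star_algebra N \<Longrightarrow> N \<subseteq> sot_closure N"
  unfolding sot_closure_def star_algebra_def using closure_subset by blast

lemma von_neumann_algebra_sot_closure:
  assumes N: "star_algebra N"
  shows "von_neumann_algebra (sot_closure N)"
  unfolding von_neumann_algebra_iff
proof
  show "sot_closure (sot_closure N) = sot_closure N"
  proof
    have "closure (sot_closure N) \<subseteq> closure N"
      by (intro closure_minimal) (auto simp: sot_closure_def)
    thus "sot_closure (sot_closure N) \<subseteq> sot_closure N" by (auto simp: sot_closure_def)
    show "sot_closure N \<subseteq> sot_closure (sot_closure N)"
      using closure_subset by (force simp: sot_closure_def)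
  qed
  show "star_algebra (sot_closure N)"
    unfolding star_algebra_def
  proof (intro conjI ballI allI)
    show "id \<in> sot_closure N" using N subset_sot_closure by (auto simp: star_algebra_def)
  next
    fix S T assume S: "S \<in> sot_closure N" and T: "T \<in> sot_closure N"
    have "\<exists>A\<in>N. \<forall>\<xi>\<in>F. norm (A \<xi> - (S \<xi> + T \<xi>)) < e" if F: "finite F" "e > 0" for F e
    proof -
      obtain A B where AB: "A \<in> N" "\<forall>\<xi>\<in>F. norm (A \<xi> - S \<xi>) < e / 2"
          "B \<in> N" "\<forall>\<xi>\<in>F. norm (B \<xi> - T \<xi>) < e / 2"
      proof -
        have "e / 2 > 0" using F by simp
        thus ?thesis using S T F(1) that unfolding sot_closure_def Int_iff in_sot_closure_iff by blast
      qed
      have "norm (A \<xi> + B \<xi> - (S \<xi> + T \<xi>)) < e" if "\<xi> \<in> F" for \<xi>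
      proof -
        have "A \<xi> + B \<xi> - (S \<xi> + T \<xi>) = (A \<xi> - S \<xi>) + (B \<xi> - T \<xi>)" by simp
        also have "norm \<dots> < e" using AB that by (intro norm_triangle_lt) force
        finally show ?thesis .
      qed
      thus ?thesis using N AB by (intro bexI[of _ "\<lambda>\<xi>. A \<xi> + B \<xi>"]) (auto simp: star_algebra_def)
    qed
    thus "(\<lambda>\<xi>. S \<xi> + T \<xi>) \<in> sot_closure N"
      using S T by (auto simp: sot_closure_def in_sot_closure_iff bounded_clinear_plus)
    have "\<exists>A\<in>N. \<forall>\<xi>\<in>F. norm (A \<xi> - S (T \<xi>)) < e" if F: "finite F" "e > 0" for F e
    proof -
      have bS: "bounded_clinear S" using S by (simp add: sot_closure_def)
      \<comment> \<open>Composition is only separately continuous. So \<open>B\<close> is chosen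
        first, its error scaled by the bound \<open>K\<close> of \<open>S\<close>, and
        \<open>A\<close> afterwards, close to \<open>S\<close> at the finitely many vectors
        \<open>B \<xi>\<close>.\<close>
      obtain K where K: "K > 0" "\<And>x. norm (S x) \<le> K * norm x"
        using bounded_clinear_bound[OF bS] by blast
      have "e / (2 * K) > 0" using F K by simp
      then obtain B where B: "B \<in> N" "\<forall>\<xi>\<in>F. norm (B \<xi> - T \<xi>) < e / (2 * K)"
        using T F(1) unfolding sot_closure_def Int_iff in_sot_closure_iff by blast
      have "finite (B ` F)" "e / 2 > 0" using F by auto
      then obtain A where A: "A \<in> N" "\<forall>\<eta>\<in>B ` F. norm (A \<eta> - S \<eta>) < e / 2"
        using S unfolding sot_closure_def Int_iff in_sot_closure_iff by blast
      have "norm (A (B \<xi>) - S (T \<xi>)) < e" if "\<xi> \<in> F" for \<xi>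
      proof -
        have "norm (S (B \<xi> - T \<xi>)) \<le> K * norm (B \<xi> - T \<xi>)" by (rule K)
        also have "\<dots> < K * (e / (2 * K))" using B that K by (intro mult_strict_left_mono) auto
        finally have "norm (S (B \<xi>) - S (T \<xi>)) < e / 2"
          using K by (simp add: bounded_clinear_diff[OF bS])
        moreover have "norm (A (B \<xi>) - S (B \<xi>)) < e / 2" using A that by auto
        moreover have "A (B \<xi>) - S (T \<xi>) = (A (B \<xi>) - S (B \<xi>)) + (S (B \<xi>) - S (T \<xi>))" by simp
        ultimately show ?thesis by (metis norm_triangle_lt add_strict_mono field_sum_of_halves)
      qed
      thus ?thesis using N A B by (intro bexI[of _ "A \<circ> B"]) (auto simp: star_algebra_def)
    qed
    thus "S \<circ> T \<in> sot_closure N"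
      using S T by (auto simp: sot_closure_def in_sot_closure_iff bounded_clinear_comp)
  next
    fix c T assume T: "T \<in> sot_closure N"
    have "\<exists>A\<in>N. \<forall>\<xi>\<in>F. norm (A \<xi> - c *\<^sub>C T \<xi>) < e" if F: "finite F" "e > 0" for F e
    proof -
      have "e / (1 + cmod c) > 0" using F by (simp add: add_pos_nonneg)
      then obtain B where B: "B \<in> N" "\<forall>\<xi>\<in>F. norm (B \<xi> - T \<xi>) < e / (1 + cmod c)"
        using T F unfolding sot_closure_def Int_iff in_sot_closure_iff by blast
      have "norm (c *\<^sub>C B \<xi> - c *\<^sub>C T \<xi>) < e" if "\<xi> \<in> F" for \<xi>
      proof -
        have "norm (c *\<^sub>C B \<xi> - c *\<^sub>C T \<xi>) \<le> (1 + cmod c) * norm (B \<xi> - T \<xi>)"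
          by (simp add: norm_scaleC mult_right_mono flip: scaleC_diff_right)
        also have "\<dots> < (1 + cmod c) * (e / (1 + cmod c))"
          using B that by (intro mult_strict_left_mono) (auto simp: add_pos_nonneg)
        also have "\<dots> = e" by (simp add: add_pos_nonneg less_imp_neq[symmetric])
        finally show ?thesis .
      qed
      thus ?thesis using N B by (intro bexI[of _ "\<lambda>\<xi>. c *\<^sub>C B \<xi>"]) (auto simp: star_algebra_def)
    qed
    thus "(\<lambda>\<xi>. c *\<^sub>C T \<xi>) \<in> sot_closure N"
      using T by (auto simp: sot_closure_def in_sot_closure_iff bounded_clinear_mult)
  next
    fix T assume T: "T \<in> sot_closure N"
    thus "bounded_clinear T" by (simp add: sot_closure_def)
    then obtain S where "bounded_clinear S" "is_adjoint T S" using adjoint_exists by blast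
    thus "\<exists>S\<in>sot_closure N. is_adjoint T S" using adjoint_in_sot_closure[OF N T] by blast
  qed
qed

text \<open>There is no rule for adjoints: if the generating set is closed under them, so is the
  algebra, by \<open>star_algebra_op_algebra\<close>.\<close>

inductive_set op_algebra :: "('h::complex_hilbert_space \<Rightarrow> 'h) set \<Rightarrow> ('h \<Rightarrow> 'h) set"
  for G where
    op_algebra_id: "id \<in> op_algebra G"
  | op_algebra_gen: "T \<in> G \<Longrightarrow> T \<in> op_algebra G"
  | op_algebra_add: "S \<in> op_algebra G \<Longrightarrow> T \<in> op_algebra G \<Longrightarrow> (\<lambda>\<xi>. S \<xi> + T \<xi>) \<in> op_algebra G"
  | op_algebra_scale: "T \<in> op_algebra G \<Longrightarrow> (\<lambda>\<xi>. c *\<^sub>C T \<xi>) \<in> op_algebra G"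
  | op_algebra_comp: "S \<in> op_algebra G \<Longrightarrow> T \<in> op_algebra G \<Longrightarrow> S \<circ> T \<in> op_algebra G"

lemma star_algebra_op_algebra:
  assumes "\<And>T. T \<in> G \<Longrightarrow> bounded_clinear T" "\<And>T. T \<in> G \<Longrightarrow> \<exists>S\<in>G. is_adjoint T S"
  shows "star_algebra (op_algebra G)"
proof -
  have "bounded_clinear T" if "T \<in> op_algebra G" for T using that
    by induction (blast intro: assms bounded_clinear_id bounded_clinear_plus bounded_clinear_mult
        bounded_clinear_comp)+
  moreover have "\<exists>S\<in>op_algebra G. is_adjoint T S" if "T \<in> op_algebra G" for T using that
  proof induction
    case op_algebra_id
    show ?case by (rule bexI[of _ id]) (auto simp: is_adjoint_def op_algebra.intros)
  next
    case (op_algebra_gen T)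
    thus ?case using assms(2) op_algebra.op_algebra_gen by blast
  next
    case (op_algebra_add S T)
    then obtain S' T' where "S' \<in> op_algebra G" "is_adjoint S S'" "T' \<in> op_algebra G" "is_adjoint T T'"
      by blast
    thus ?case by (intro bexI[of _ "\<lambda>\<xi>. S' \<xi> + T' \<xi>"])
        (auto simp: is_adjoint_def cinner_simps intro: op_algebra.intros)
  next
    case (op_algebra_scale T c)
    then obtain T' where "T' \<in> op_algebra G" "is_adjoint T T'" by blast
    thus ?case by (intro bexI[of _ "\<lambda>\<xi>. cnj c *\<^sub>C T' \<xi>"])
        (auto simp: is_adjoint_def cinner_simps intro: op_algebra.intros)
  next
    case (op_algebra_comp S T)
    then obtain S' T' where "S' \<in> op_algebra G" "is_adjoint S S'" "T' \<in> op_algebra G" "is_adjoint T T'"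
      by blast
    thus ?case by (intro bexI[of _ "T' \<circ> S'"]) (auto simp: is_adjoint_def intro: op_algebra.intros)
  qed
  ultimately show ?thesis unfolding star_algebra_def by (auto intro: op_algebra.intros)
qed

lemma op_algebra_minimal:
  assumes "star_algebra N" "G \<subseteq> N"
  shows "op_algebra G \<subseteq> N"
proof
  fix T assume "T \<in> op_algebra G"
  thus "T \<in> N" by induction (use assms in \<open>unfold star_algebra_def, blast+\<close>)
qed

text \<open>The strong closure of the generated algebra is itself one of the algebras being
  intersected, and it is contained in each of them.\<close>

lemma generated_vN_subalgebra_eq:
  assumes M: "von_neumann_algebra M" and "G \<subseteq> M" and adj: "\<And>T. T \<in> G \<Longrightarrow> \<exists>S\<in>G. is_adjoint T S"
  shows "generated_vN_subalgebra M G = sot_closure (op_algebra G)"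
proof
  have M': "star_algebra M" "sot_closure M = M" using M by (auto simp: von_neumann_algebra_iff)
  have G: "star_algebra (op_algebra G)"
    using adj M'(1) assms(2) by (intro star_algebra_op_algebra) (auto simp: star_algebra_def)
  have "sot_closure (op_algebra G) \<subseteq> M"
    using sot_closure_mono[OF op_algebra_minimal[OF M'(1) assms(2)]] M'(2) by simp
  thus "generated_vN_subalgebra M G \<subseteq> sot_closure (op_algebra G)"
    unfolding generated_vN_subalgebra_def
    using von_neumann_algebra_sot_closure[OF G] subset_sot_closure[OF G]
    by (intro Inter_lower) (auto intro: op_algebra_gen)
  show "sot_closure (op_algebra G) \<subseteq> generated_vN_subalgebra M G"
    unfolding generated_vN_subalgebra_def
  proof (intro Inter_greatest)
    fix N assume "N \<in> {N. von_neumann_algebra N \<and> N \<subseteq> M \<and> G \<subseteq> N}"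
    hence "star_algebra N" "sot_closure N = N" "G \<subseteq> N" by (auto simp: von_neumann_algebra_iff)
    thus "sot_closure (op_algebra G) \<subseteq> N" using sot_closure_mono op_algebra_minimal by blast
  qed
qed

text \<open>Strong approximation at the single vector \<Omega> is norm approximation, so the strong
  closure adds nothing that the norm closure does not add anyway.\<close>

lemma L2_space_sot_closure: 
  assumes "star_algebra N"
  shows "L2_space \<Omega> (sot_closure N) = closure ((\<lambda>T. T \<Omega>) ` N)"
  unfolding L2_space_def
proof (rule antisym)
  show "closure ((\<lambda>T. T \<Omega>) ` N) \<subseteq> closure ((\<lambda>T. T \<Omega>) ` sot_closure N)"
    using subset_sot_closure[OF assms] by (intro closure_mono) blast
  show "closure ((\<lambda>T. T \<Omega>) ` sot_closure N) \<subseteq> closure ((\<lambda>T. T \<Omega>) ` N)"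
  proof (rule closure_minimal)
    show "(\<lambda>T. T \<Omega>) ` sot_closure N \<subseteq> closure ((\<lambda>T. T \<Omega>) ` N)"
    proof clarify
      fix T assume T: "T \<in> sot_closure N"
      have *: "\<forall>e>0. \<exists>S\<in>N. norm (S \<Omega> - T \<Omega>) < e"
      proof (intro allI impI)
        fix e :: real assume "e > 0"
        with T obtain S where "S \<in> N" "\<forall>\<xi>\<in>{\<Omega>}. norm (S \<xi> - T \<xi>) < e"
          unfolding sot_closure_def Int_iff in_sot_closure_iff by blast
        thus "\<exists>S\<in>N. norm (S \<Omega> - T \<Omega>) < e" by blast
      qed
      show "T \<Omega> \<in> closure ((\<lambda>T. T \<Omega>) ` N)"
        unfolding closure_approachable dist_norm using * by blast
    qed
  qed simp
qed

section \<open>Polynomials in a bounded operator\<close>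

text \<open>Horner's scheme. In \<open>bounded_op\<close> the operator is linear only on
  \<open>K\<close>, so most laws of this calculus carry a membership hypothesis.\<close>

definition op_poly :: "complex poly \<Rightarrow> ('h::complex_hilbert_space \<Rightarrow> 'h) \<Rightarrow> 'h \<Rightarrow> 'h" where
  "op_poly p T = fold_coeffs (\<lambda>a f \<xi>. a *\<^sub>C \<xi> + T (f \<xi>)) p (\<lambda>_. 0)"

lemma op_poly_0 [simp]: "op_poly 0 T \<xi> = 0"
  by (simp add: op_poly_def)

locale bounded_op =
  fixes K :: "'h::complex_hilbert_space set" and T :: "'h \<Rightarrow> 'h"
  assumes K: "csubspace K" and T: "bounded_operator_on K T"
begin

lemma T_in: "\<xi> \<in> K \<Longrightarrow> T \<xi> \<in> K"
  and T_add: "\<xi> \<in> K \<Longrightarrow> \<eta> \<in> K \<Longrightarrow> T (\<xi> + \<eta>) = T \<xi> + T \<eta>"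
  and T_scaleC: "\<xi> \<in> K \<Longrightarrow> T (c *\<^sub>C \<xi>) = c *\<^sub>C T \<xi>"
  using T by (auto simp: bounded_operator_on_def)

lemma T_zero: "T 0 = 0"
  using T_scaleC[of 0 0] csubspace_0[OF K] by simp

lemma T_minus: "\<xi> \<in> K \<Longrightarrow> T (- \<xi>) = - T \<xi>"
  using T_scaleC[of \<xi> "-1"] by simp

lemma T_sum: "(\<And>i. i \<in> I \<Longrightarrow> f i \<in> K) \<Longrightarrow> T (\<Sum>i\<in>I. f i) = (\<Sum>i\<in>I. T (f i))"
  by (induction I rule: infinite_finite_induct) (auto simp: T_zero T_add csubspace_sum[OF K])

lemma T_bound: "\<exists>B>0. \<forall>\<xi>\<in>K. norm (T \<xi>) \<le> B * norm \<xi>"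
proof -
  obtain B where B: "\<forall>\<xi>\<in>K. norm (T \<xi>) \<le> B * norm \<xi>"
    using T by (auto simp: bounded_operator_on_def)
  have "norm (T \<xi>) \<le> max B 1 * norm \<xi>" if "\<xi> \<in> K" for \<xi>
    using B that by (meson max.cobounded1 mult_right_mono norm_ge_zero order.trans)
  thus ?thesis by (intro exI[of _ "max B 1"]) auto
qed

lemma op_poly_pCons: "op_poly (pCons a p) T \<xi> = a *\<^sub>C \<xi> + T (op_poly p T \<xi>)"
  by (cases "p = 0 \<and> a = 0") (auto simp: op_poly_def T_zero)

lemma op_poly_in: "\<xi> \<in> K \<Longrightarrow> op_poly p T \<xi> \<in> K"
  by (induction p) (auto simp: op_poly_pCons csubspace_0[OF K] intro!: csubspace_add[OF K] csubspace_scaleC[OF K] T_in)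

lemma op_poly_const: "op_poly [:a:] T \<xi> = a *\<^sub>C \<xi>"
  by (simp add: op_poly_pCons T_zero)

lemma op_poly_linear_factor: "\<xi> \<in> K \<Longrightarrow> op_poly [:-z, 1:] T \<xi> = T \<xi> - z *\<^sub>C \<xi>"
  by (simp add: op_poly_pCons T_zero)

lemma op_poly_vec_add:
  "\<xi> \<in> K \<Longrightarrow> \<eta> \<in> K \<Longrightarrow> op_poly p T (\<xi> + \<eta>) = op_poly p T \<xi> + op_poly p T \<eta>"
  by (induction p) (auto simp: op_poly_pCons scaleC_add_right T_add op_poly_in)

lemma op_poly_vec_scaleC: "\<xi> \<in> K \<Longrightarrow> op_poly p T (c *\<^sub>C \<xi>) = c *\<^sub>C op_poly p T \<xi>"
  by (induction p) (auto simp: op_poly_pCons scaleC_add_right T_scaleC op_poly_in scaleC_scaleC mult.commute)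

lemma bounded_operator_on_op_poly: "bounded_operator_on K (op_poly p T)"
proof -
  obtain B where B: "B > 0" "\<forall>\<xi>\<in>K. norm (T \<xi>) \<le> B * norm \<xi>" using T_bound by blast
  have "\<exists>C. \<forall>\<xi>\<in>K. norm (op_poly p T \<xi>) \<le> C * norm \<xi>"
  proof (induction p)
    case (pCons a p)
    then obtain C where C: "\<forall>\<xi>\<in>K. norm (op_poly p T \<xi>) \<le> C * norm \<xi>" by blast
    have "norm (op_poly (pCons a p) T \<xi>) \<le> (cmod a + B * C) * norm \<xi>" if "\<xi> \<in> K" for \<xi>
    proof -
      have "norm (op_poly (pCons a p) T \<xi>) \<le> norm (a *\<^sub>C \<xi>) + norm (T (op_poly p T \<xi>))"
        unfolding op_poly_pCons by (rule norm_triangle_ineq)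
      also have "norm (T (op_poly p T \<xi>)) \<le> B * norm (op_poly p T \<xi>)" using B that op_poly_in by blast
      also have "\<dots> \<le> B * (C * norm \<xi>)" using B C that by (intro mult_left_mono) auto
      finally show ?thesis by (simp add: norm_scaleC algebra_simps)
    qed
    thus ?case by blast
  qed (auto intro: exI[of _ 0])
  thus ?thesis
    by (auto simp: bounded_operator_on_def op_poly_in op_poly_vec_add op_poly_vec_scaleC)
qed

lemma op_poly_add: "\<xi> \<in> K \<Longrightarrow> op_poly (p + q) T \<xi> = op_poly p T \<xi> + op_poly q T \<xi>"
  by (induction p q rule: poly_induct2) (auto simp: op_poly_pCons T_add op_poly_in scaleC_add_left)

lemma op_poly_smult: "\<xi> \<in> K \<Longrightarrow> op_poly (smult c p) T \<xi> = c *\<^sub>C op_poly p T \<xi>"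
  by (induction p) (auto simp: op_poly_pCons scaleC_add_right T_scaleC op_poly_in scaleC_scaleC)

lemma op_poly_diff: "\<xi> \<in> K \<Longrightarrow> op_poly (p - q) T \<xi> = op_poly p T \<xi> - op_poly q T \<xi>"
  using op_poly_add[of \<xi> p "smult (-1) q"] op_poly_smult[of \<xi> "-1" q] by simp

lemma op_poly_sum: "\<xi> \<in> K \<Longrightarrow> op_poly (\<Sum>i\<in>I. f i) T \<xi> = (\<Sum>i\<in>I. op_poly (f i) T \<xi>)"
  by (induction I rule: infinite_finite_induct) (auto simp: op_poly_add)

lemma op_poly_mult: "\<xi> \<in> K \<Longrightarrow> op_poly (p * q) T \<xi> = op_poly p T (op_poly q T \<xi>)"
  by (induction p) (auto simp: mult_pCons_left op_poly_add op_poly_smult op_poly_pCons)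

lemma op_poly_monom: "\<xi> \<in> K \<Longrightarrow> op_poly (monom a n) T \<xi> = a *\<^sub>C (T ^^ n) \<xi>"
proof (induction n)
  case (Suc n)
  have "(T ^^ n) \<xi> \<in> K" for n using Suc.prems by (induction n) (auto intro: T_in)
  thus ?case using Suc by (simp add: monom_Suc op_poly_pCons T_scaleC)
qed (simp add: monom_0 op_poly_const)

lemma op_poly_eigen: "\<xi> \<in> K \<Longrightarrow> T \<xi> = z *\<^sub>C \<xi> \<Longrightarrow> op_poly p T \<xi> = poly p z *\<^sub>C \<xi>"
  by (induction p) (auto simp: op_poly_pCons T_scaleC scaleC_add_left scaleC_scaleC mult.commute)

text \<open>Over the complex numbers \<open>q\<close> splits into linear factors; each factor
  \<open>T - z\<close> has a bounded inverse and is thus bounded below, and lower bounds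
  multiply.\<close>

lemma op_poly_bounded_below:
  assumes "q \<noteq> 0" "\<And>z. poly q z = 0 \<Longrightarrow> z \<notin> spectrum_on K T"
  shows "\<exists>d>0. \<forall>\<xi>\<in>K. d * norm \<xi> \<le> norm (op_poly q T \<xi>)"
  using assms
proof (induction "degree q" arbitrary: q rule: less_induct)
  case less
  show ?case
  proof (cases "degree q = 0")
    case True
    then obtain a where "q = [:a:]" by (rule degree_eq_zeroE)
    thus ?thesis using less.prems(1) by (intro exI[of _ "cmod a"]) (auto simp: op_poly_const norm_scaleC)
  next
    case False
    then obtain z where z: "poly q z = 0"
      using fundamental_theorem_of_algebra[of q] by (auto simp: constant_degree)
    then obtain r where r: "q = [:-z, 1:] * r" by (auto simp: poly_eq_0_iff_dvd dvd_def)
    have r0: "r \<noteq> 0" using r less.prems(1) by auto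
    have "degree q = 1 + degree r" unfolding r using r0 by (subst degree_mult_eq) auto
    then obtain d where d: "d > 0" "\<forall>\<xi>\<in>K. d * norm \<xi> \<le> norm (op_poly r T \<xi>)"
      using less.hyps[of r] r0 less.prems(2) unfolding r by auto
    obtain S where S: "bounded_operator_on K S" "\<And>\<xi>. \<xi> \<in> K \<Longrightarrow> S (T \<xi> - z *\<^sub>C \<xi>) = \<xi>"
      using less.prems(2)[OF z] by (auto simp: spectrum_on_def)
    obtain B where B: "B > 0" "\<forall>\<xi>\<in>K. norm (S \<xi>) \<le> B * norm \<xi>"
      using bounded_op.T_bound[of K S] S(1) K by (auto simp: bounded_op_def)
    have "d / B * norm \<xi> \<le> norm (op_poly q T \<xi>)" if \<xi>: "\<xi> \<in> K" for \<xi>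
    proof -
      let ?\<eta> = "op_poly r T \<xi>"
      have \<eta>: "?\<eta> \<in> K" using \<xi> by (rule op_poly_in)
      have q: "op_poly q T \<xi> = T ?\<eta> - z *\<^sub>C ?\<eta>"
        unfolding r op_poly_mult[OF \<xi>] op_poly_linear_factor[OF \<eta>] ..
      have "d * norm \<xi> \<le> norm ?\<eta>" using d \<xi> by blast
      also have "\<dots> = norm (S (op_poly q T \<xi>))" unfolding q using S(2)[OF \<eta>] by simp
      also have "\<dots> \<le> B * norm (op_poly q T \<xi>)" using B \<xi> op_poly_in by blast
      finally show ?thesis using B by (simp add: field_simps)
    qed
    thus ?thesis using d B by (intro exI[of _ "d / B"]) auto
  qed
qed

text \<open>Polarization: the defect \<open>b\<close> of symmetry vanishes on the diagonal, so
  testing it at \<open>\<xi> + \<eta>\<close> and at \<xi> plus \<i> times \<eta> makes it vanish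
  everywhere.\<close>

lemma real_form_imp_symmetric:
  assumes "\<And>\<xi>. \<xi> \<in> K \<Longrightarrow> cinner (T \<xi>) \<xi> \<in> \<real>" and xy: "\<xi> \<in> K" "\<eta> \<in> K"
  shows "cinner (T \<xi>) \<eta> = cinner \<xi> (T \<eta>)"
proof -
  define b where "b x y = cinner (T x) y - cinner x (T y)" for x y
  have b0: "b x x = 0" if "x \<in> K" for x
    using assms(1)[OF that] cinner_commute[of x "T x"] by (simp add: b_def Reals_cnj_iff)
  have "b (\<xi> + \<eta>) (\<xi> + \<eta>) = b \<xi> \<xi> + b \<xi> \<eta> + b \<eta> \<xi> + b \<eta> \<eta>"
    using xy by (simp add: b_def T_add cinner_simps)
  hence 1: "b \<xi> \<eta> + b \<eta> \<xi> = 0"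
    using b0[OF xy(1)] b0[OF xy(2)] b0[OF csubspace_add[OF K xy]] by simp
  have i\<eta>: "\<i> *\<^sub>C \<eta> \<in> K" using K xy by (simp add: csubspace_scaleC)
  have "b (\<xi> + \<i> *\<^sub>C \<eta>) (\<xi> + \<i> *\<^sub>C \<eta>) = b \<xi> \<xi> - \<i> * b \<xi> \<eta> + \<i> * b \<eta> \<xi> + b \<eta> \<eta>"
    using xy i\<eta> by (simp add: b_def T_add T_scaleC cinner_simps algebra_simps)
  hence "\<i> * (b \<eta> \<xi> - b \<xi> \<eta>) = 0"
    using b0[OF xy(1)] b0[OF xy(2)] b0[OF csubspace_add[OF K xy(1) i\<eta>]] by (simp add: algebra_simps)
  hence "b \<xi> \<eta> = 0" using 1 by (simp add: algebra_simps)
  thus ?thesis by (simp add: b_def)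
qed

end

section \<open>Positivity of real polynomials in a symmetric operator\<close>

locale symmetric_op = bounded_op +
  assumes sym: "\<xi> \<in> K \<Longrightarrow> \<eta> \<in> K \<Longrightarrow> cinner (T \<xi>) \<eta> = cinner \<xi> (T \<eta>)"
begin

lemma op_poly_symmetric:
  assumes p: "\<And>i. coeff p i \<in> \<real>" and \<xi>: "\<xi> \<in> K" and \<eta>: "\<eta> \<in> K"
  shows "cinner (op_poly p T \<xi>) \<eta> = cinner \<xi> (op_poly p T \<eta>)"
  using p \<eta>
proof (induction p arbitrary: \<eta>)
  case (pCons a p)
  have a: "a \<in> \<real>" and p: "coeff p i \<in> \<real>" for i
    using pCons.prems(1)[of 0] pCons.prems(1)[of "Suc i"] by auto
  have "op_poly p T (T \<eta>) = T (op_poly p T \<eta>)"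
    using op_poly_mult[of \<eta> p "[:0, 1:]"] op_poly_mult[of \<eta> "[:0, 1:]" p] pCons.prems(2)
      op_poly_linear_factor[of \<eta> 0] op_poly_linear_factor[of "op_poly p T \<eta>" 0]
    by (simp add: op_poly_in mult.commute)
  thus ?case
    using pCons.IH[of "T \<eta>"] pCons.prems(2) p a \<xi>
    by (simp add: op_poly_pCons cinner_simps sym op_poly_in T_in Reals_cnj_iff)
qed simp

text \<open>Suppose the infimum \<mu> of the quadratic form of \<open>p(T)\<close> on the unit
  sphere of \<open>K\<close> is negative. Then \<open>p - \<mu>\<close> has no zero in the spectrum,
  so \<open>p(T) - \<mu>\<close> is bounded below; but this positive operator is small on vectors
  that almost attain the infimum.\<close>

lemma op_poly_nonneg:
  assumes c: "c \<ge> 0" and spec: "spectrum_on K T \<subseteq> complex_of_real ` {0..c}"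
    and p: "\<And>i. coeff p i \<in> \<real>" and pos: "\<And>x. x \<in> {0..c} \<Longrightarrow> 0 \<le> Re (poly p (complex_of_real x))"
    and \<xi>: "\<xi> \<in> K"
  shows "0 \<le> Re (cinner (op_poly p T \<xi>) \<xi>)"
proof (rule ccontr)
  assume neg: "\<not> ?thesis"
  define f where "f \<xi> = Re (cinner (op_poly p T \<xi>) \<xi>)" for \<xi>
  define F where "F = f ` {\<xi>\<in>K. norm \<xi> = 1}"
  define \<mu> where "\<mu> = Inf F"
  obtain C where C: "C > 0" "\<forall>\<xi>\<in>K. norm (op_poly p T \<xi>) \<le> C * norm \<xi>"
    using bounded_op.T_bound[of K "op_poly p T"] K bounded_operator_on_op_poly by (auto simp: bounded_op_def)
  have bdd: "bdd_below F"
  proof (rule bdd_belowI[of _ "- C"])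
    fix y assume "y \<in> F"
    then obtain \<eta> where \<eta>: "\<eta> \<in> K" "norm \<eta> = 1" "y = f \<eta>" by (auto simp: F_def)
    have "\<bar>y\<bar> \<le> norm (op_poly p T \<eta>) * norm \<eta>"
      unfolding \<eta>(3) f_def by (rule order.trans[OF abs_Re_le_cmod cinner_Cauchy_Schwarz])
    also have "\<dots> \<le> C" using C \<eta> by force
    finally show "- C \<le> y" by simp
  qed
  have \<xi>0: "\<xi> \<noteq> 0" using neg by auto
  have scale: "f ((1 / norm \<eta>) *\<^sub>R \<eta>) = f \<eta> / (norm \<eta>)\<^sup>2" if "\<eta> \<in> K" for \<eta>
  proof -
    have "f (complex_of_real (1 / norm \<eta>) *\<^sub>C \<eta>) = f \<eta> / (norm \<eta>)\<^sup>2"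
      using that unfolding f_def by (simp add: op_poly_vec_scaleC cinner_simps power2_eq_square
          Re_divide_of_real flip: of_real_mult)
    thus ?thesis unfolding scaleC_of_real .
  qed
  have \<mu>_le: "\<mu> * (norm \<eta>)\<^sup>2 \<le> f \<eta>" if "\<eta> \<in> K" for \<eta>
  proof (cases "\<eta> = 0")
    case False
    have "\<mu> \<le> f ((1 / norm \<eta>) *\<^sub>R \<eta>)"
      unfolding \<mu>_def using that False
      by (intro cInf_lower bdd) (auto simp: F_def csubspace_scaleR[OF K])
    thus ?thesis using False scale[OF that] by (simp add: field_simps)
  qed (simp add: f_def)
  have "\<mu> * (norm \<xi>)\<^sup>2 < 0" using \<mu>_le[OF \<xi>] neg by (simp add: f_def)
  hence \<mu>: "\<mu> < 0" by (simp add: mult_less_0_iff)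
  define r where "r = p - [:complex_of_real \<mu>:]"
  have r: "coeff r i \<in> \<real>" for i
    using p[of i] by (auto simp: r_def coeff_pCons split: nat.splits)
  have D: "op_poly r T \<eta> = op_poly p T \<eta> - \<mu> *\<^sub>R \<eta>" if "\<eta> \<in> K" for \<eta>
    using that by (simp add: r_def op_poly_diff op_poly_const scaleC_of_real)
  have Df: "Re (cinner (op_poly r T \<eta>) \<eta>) = f \<eta> - \<mu> * (norm \<eta>)\<^sup>2" if "\<eta> \<in> K" for \<eta>
    using that by (simp add: D f_def cinner_simps cinner_scaleR_left cinner_self)
  obtain B where B: "B > 0" "\<forall>\<xi>\<in>K. norm (op_poly r T \<xi>) \<le> B * norm \<xi>"
    using bounded_op.T_bound[of K "op_poly r T"] K bounded_operator_on_op_poly by (auto simp: bounded_op_def)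
  \<comment> \<open>For a positive operator \<open>D\<close> bounded by \<open>B\<close>, the form
    evaluated at \<open>\<eta> - D \<eta> / B\<close> is nonnegative; expanding it bounds the
    squared norm of \<open>D \<eta>\<close> by \<open>B\<close> times the form at \<eta>.\<close>
  have CS: "(norm (op_poly r T \<eta>))\<^sup>2 \<le> B * (f \<eta> - \<mu> * (norm \<eta>)\<^sup>2)" if \<eta>: "\<eta> \<in> K" for \<eta>
  proof -
    let ?D = "op_poly r T"
    define \<zeta> where "\<zeta> = ?D \<eta>"
    have \<zeta>: "\<zeta> \<in> K" using \<eta> by (simp add: \<zeta>_def op_poly_in)
    define s where "s = complex_of_real (1 / B)"
    have z: "\<eta> - s *\<^sub>C \<zeta> \<in> K" using \<eta> \<zeta> K by (simp add: csubspace_diff csubspace_scaleC)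
    have "0 \<le> Re (cinner (?D (\<eta> - s *\<^sub>C \<zeta>)) (\<eta> - s *\<^sub>C \<zeta>))"
      unfolding Df[OF z] using \<mu>_le[OF z] by simp
    also have "?D (\<eta> - s *\<^sub>C \<zeta>) = \<zeta> - s *\<^sub>C ?D \<zeta>"
      using op_poly_vec_add[of \<eta> "(- s) *\<^sub>C \<zeta>" r] op_poly_vec_scaleC[of \<zeta> r "-s"] \<eta> \<zeta> K
      by (simp add: csubspace_minus csubspace_scaleC \<zeta>_def)
    also have "Re (cinner (\<zeta> - s *\<^sub>C ?D \<zeta>) (\<eta> - s *\<^sub>C \<zeta>)) =
        Re (cinner \<zeta> \<eta>) - 2 / B * (norm \<zeta>)\<^sup>2 + Re (cinner (?D \<zeta>) \<zeta>) / B\<^sup>2"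
      using op_poly_symmetric[OF r \<zeta> \<eta>]
      by (simp add: cinner_simps s_def cinner_self power2_eq_square flip: \<zeta>_def of_real_mult)
        (simp add: diff_divide_distrib)
    also have "Re (cinner (?D \<zeta>) \<zeta>) \<le> B * (norm \<zeta>)\<^sup>2"
    proof -
      have "Re (cinner (?D \<zeta>) \<zeta>) \<le> cmod (cinner (?D \<zeta>) \<zeta>)" by (rule complex_Re_le_cmod)
      also have "\<dots> \<le> norm (?D \<zeta>) * norm \<zeta>" by (rule cinner_Cauchy_Schwarz)
      also have "\<dots> \<le> B * norm \<zeta> * norm \<zeta>" using B \<zeta> by (intro mult_right_mono) auto
      finally show ?thesis by (simp add: power2_eq_square mult.assoc)
    qed
    finally have "0 \<le> Re (cinner \<zeta> \<eta>) - 2 / B * (norm \<zeta>)\<^sup>2 + B * (norm \<zeta>)\<^sup>2 / B\<^sup>2"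
      using B(1) by (simp add: divide_right_mono)
    also have "\<dots> = Re (cinner \<zeta> \<eta>) - (norm \<zeta>)\<^sup>2 / B" using B(1) by (simp add: field_simps power2_eq_square)
    finally have "(norm \<zeta>)\<^sup>2 / B \<le> Re (cinner \<zeta> \<eta>)" by simp
    thus ?thesis using Df[OF \<eta>] B(1) by (simp add: \<zeta>_def field_simps)
  qed
  have root: "z \<notin> spectrum_on K T" if "poly r z = 0" for z
  proof
    assume "z \<in> spectrum_on K T"
    then obtain x where x: "x \<in> {0..c}" "z = of_real x" using spec by auto
    have "poly p z = of_real \<mu>" using that by (simp add: r_def)
    thus False using pos[OF x(1)] \<mu> by (simp add: x(2))
  qed
  \<comment> \<open>If \<open>r\<close> were zero, \<open>p\<close> would be the negative constant
    \<mu>, contradicting \<open>pos\<close> at the point 0 of the interval.\<close>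
  have "r \<noteq> 0"
  proof
    assume "r = 0"
    hence "poly p (of_real 0) = of_real \<mu>" by (simp add: r_def)
    moreover have "0 \<le> Re (poly p (of_real 0))" using pos[of 0] c by simp
    ultimately show False using \<mu> by simp
  qed
  then obtain d where d: "d > 0" "\<forall>\<xi>\<in>K. d * norm \<xi> \<le> norm (op_poly r T \<xi>)"
    using op_poly_bounded_below root by blast
  have "F \<noteq> {}" using \<xi> \<xi>0 by (auto simp: F_def csubspace_scaleR[OF K] intro!: exI[of _ "(1 / norm \<xi>) *\<^sub>R \<xi>"])
  moreover have "Inf F < \<mu> + d\<^sup>2 / B" using d B by (simp add: \<mu>_def)
  ultimately obtain y where "y \<in> F" "y < \<mu> + d\<^sup>2 / B" by (meson cInf_lessD)
  then obtain \<eta> where \<eta>: "\<eta> \<in> K" "norm \<eta> = 1" "f \<eta> < \<mu> + d\<^sup>2 / B" by (auto simp: F_def)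
  have "d \<le> norm (op_poly r T \<eta>)" using d \<eta> by force
  hence "d\<^sup>2 \<le> (norm (op_poly r T \<eta>))\<^sup>2" using d by (intro power_mono) auto
  also have "\<dots> \<le> B * (f \<eta> - \<mu>)" using CS[OF \<eta>(1)] \<eta>(2) by simp
  also have "\<dots> < B * (d\<^sup>2 / B)" using \<eta>(3) B(1) by (intro mult_strict_left_mono) auto
  finally show False using B(1) by simp
qed

end

section \<open>Uniqueness of the angle operator\<close>

text \<open>The difference of squares is \<open>- sin (x + \<theta>) * sin (x - \<theta>)\<close>.
  The first sine is at least \<open>min (sin \<theta>) (cos \<theta>)\<close>, since
  \<open>x + \<theta>\<close> stays between \<theta> and \<open>\<theta> + pi / 2\<close>; this
  minimum is positive because \<theta> is strictly inside the interval.\<close>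

lemma cos_sq_separates:
  assumes \<theta>: "0 < \<theta>" "\<theta> < pi / 2"
  shows "\<exists>M>0. \<forall>x\<in>{0..pi/2}. \<bar>x - \<theta>\<bar> \<le> M * \<bar>(cos x)\<^sup>2 - (cos \<theta>)\<^sup>2\<bar>"
proof -
  define m where "m = min (sin \<theta>) (cos \<theta>)"
  have m: "m > 0" using \<theta> by (auto simp: m_def sin_gt_zero cos_gt_zero)
  \<comment> \<open>The factor 3 comes from \<open>sin y \<ge> y - y^3 / 6\<close> together with
    \<open>y^2 \<le> 4\<close>.\<close>
  have sin_lb: "\<bar>y\<bar> / 3 \<le> \<bar>sin y\<bar>" if "\<bar>y\<bar> \<le> pi / 2" for y :: real
  proof -
    have *: "y / 3 \<le> sin y" if y: "0 \<le> y" "y \<le> pi / 2" for y :: real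
    proof -
      have "y \<le> 2" using y pi_less_4 by linarith
      hence "y\<^sup>2 \<le> 2\<^sup>2" using y by (intro power_mono)
      have "\<bar>sin y - (\<Sum>i<3. sin_coeff i * y ^ i)\<bar> \<le> inverse (fact 3) * \<bar>y\<bar> ^ 3"
        by (rule Maclaurin_sin_bound)
      moreover have "(\<Sum>i<3. sin_coeff i * y ^ i) = y"
        by (simp add: numeral_3_eq_3 sin_coeff_def)
      ultimately have "\<bar>sin y - y\<bar> \<le> y ^ 3 / 6" using y by (simp add: fact_numeral)
      hence "y - y ^ 3 / 6 \<le> sin y" unfolding abs_le_iff by linarith
      moreover have "y ^ 3 \<le> 4 * y"
        using mult_left_mono[OF \<open>y\<^sup>2 \<le> 2\<^sup>2\<close> y(1)] by (simp add: power2_eq_square power3_eq_cube)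
      ultimately show ?thesis by simp
    qed
    show ?thesis using *[of y] *[of "-y"] that by (cases "y \<ge> 0") auto
  qed
  have sin_m: "m \<le> sin y" if y: "\<theta> \<le> y" "y \<le> \<theta> + pi / 2" for y
  proof (cases "y \<le> pi / 2")
    case True
    hence "sin \<theta> \<le> sin y" using y \<theta> by (intro sin_monotone_2pi_le) auto
    thus ?thesis by (simp add: m_def)
  next
    case False
    have "cos \<theta> = sin (pi / 2 - \<theta>)" by (simp add: sin_diff)
    also have "\<dots> \<le> sin (pi - y)" using y \<theta> False by (intro sin_monotone_2pi_le) auto
    also have "\<dots> = sin y" by simp
    finally show ?thesis by (simp add: m_def)
  qed
  have "\<bar>x - \<theta>\<bar> \<le> 3 / m * \<bar>(cos x)\<^sup>2 - (cos \<theta>)\<^sup>2\<bar>" if x: "x \<in> {0..pi/2}" for x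
  proof -
    have "(cos x)\<^sup>2 - (cos \<theta>)\<^sup>2 = - (sin (x + \<theta>) * sin (x - \<theta>))"
    proof -
      have "sin (x + \<theta>) * sin (x - \<theta>) = (sin x)\<^sup>2 * (cos \<theta>)\<^sup>2 - (cos x)\<^sup>2 * (sin \<theta>)\<^sup>2"
        by (simp add: sin_add sin_diff algebra_simps power2_eq_square)
      also have "\<dots> = (1 - (cos x)\<^sup>2) * (cos \<theta>)\<^sup>2 - (cos x)\<^sup>2 * (1 - (cos \<theta>)\<^sup>2)"
        by (simp add: sin_squared_eq)
      finally show ?thesis by (simp add: algebra_simps)
    qed
    hence "\<bar>(cos x)\<^sup>2 - (cos \<theta>)\<^sup>2\<bar> = \<bar>sin (x + \<theta>)\<bar> * \<bar>sin (x - \<theta>)\<bar>" by (simp add: abs_mult)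
    also have "\<dots> \<ge> m * (\<bar>x - \<theta>\<bar> / 3)"
    proof -
      have "\<bar>x - \<theta>\<bar> \<le> pi / 2" using x \<theta> unfolding atLeastAtMost_iff abs_le_iff by linarith
      thus ?thesis using sin_m[of "x + \<theta>"] sin_lb[of "x - \<theta>"] x m by (intro mult_mono) auto
    qed
    finally show ?thesis using m by (simp add: field_simps)
  qed
  thus ?thesis using m by (intro exI[of _ "3 / m"]) auto
qed

section \<open>The cosine of an operator as a limit of polynomials\<close>

definition cos_poly :: "nat \<Rightarrow> complex poly" where
  "cos_poly n = (\<Sum>i<n. monom (complex_of_real (cos_coeff i)) i)"

lemma poly_cos_poly: "poly (cos_poly n) (complex_of_real x) = of_real (\<Sum>i<n. cos_coeff i * x ^ i)"
  by (simp add: cos_poly_def poly_sum poly_monom)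

lemma coeff_cos_poly: "coeff (cos_poly n) i \<in> \<real>"
  by (auto simp: cos_poly_def coeff_sum intro!: sum_in_Reals)

lemma cos_poly_error:
  assumes "x \<in> {0..pi/2}"
  shows "\<bar>(\<Sum>i<n. cos_coeff i * x ^ i) - cos x\<bar> \<le> 2 ^ n / fact n"
proof -
  obtain t where "cos x = (\<Sum>m<n. cos_coeff m * x ^ m) + (cos (t + 1 / 2 * real n * pi) / fact n) * x ^ n"
    using Maclaurin_cos_expansion[of x n] by blast
  hence "\<bar>(\<Sum>i<n. cos_coeff i * x ^ i) - cos x\<bar> = \<bar>cos (t + 1 / 2 * real n * pi)\<bar> * \<bar>x\<bar> ^ n / fact n"
    by (simp add: abs_mult power_abs)
  also have "\<dots> \<le> 1 * 2 ^ n / fact n"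
    using assms pi_less_4 by (intro divide_right_mono mult_mono power_mono) auto
  finally show ?thesis by simp
qed

lemma poly_real_coeffs_mult:
  "(\<And>i. coeff p i \<in> \<real>) \<Longrightarrow> (\<And>i. coeff q i \<in> \<real>) \<Longrightarrow> coeff (p * q) i \<in> (\<real>::complex set)"
  by (auto simp: coeff_mult intro!: sum_in_Reals Reals_mult)

context bounded_op
begin

lemma op_cos_partial_sums:
  "\<xi> \<in> K \<Longrightarrow> op_poly (cos_poly n) T \<xi> = (\<Sum>i<n. cos_coeff i *\<^sub>R (T ^^ i) \<xi>)"
  by (simp add: cos_poly_def op_poly_sum op_poly_monom scaleC_of_real)

lemma iterate_in: "\<xi> \<in> K \<Longrightarrow> (T ^^ n) \<xi> \<in> K"
  by (induction n) (auto intro: T_in)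

lemma cos_series_bound:
  assumes "B > 0" "\<forall>\<xi>\<in>K. norm (T \<xi>) \<le> B * norm \<xi>" "\<xi> \<in> K"
  shows "norm (cos_coeff n *\<^sub>R (T ^^ n) \<xi>) \<le> B ^ n /\<^sub>R fact n * norm \<xi>"
proof -
  have "norm ((T ^^ n) \<xi>) \<le> B ^ n * norm \<xi>"
  proof (induction n)
    case (Suc n)
    have "norm ((T ^^ Suc n) \<xi>) \<le> B * norm ((T ^^ n) \<xi>)" using assms iterate_in by simp
    also have "\<dots> \<le> B * (B ^ n * norm \<xi>)" using Suc assms by (intro mult_left_mono) auto
    finally show ?case by (simp add: mult.assoc)
  qed simp
  moreover have "\<bar>cos_coeff n\<bar> \<le> inverse (fact n)" by (auto simp: cos_coeff_def abs_mult power_abs divide_inverse)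
  ultimately have "\<bar>cos_coeff n\<bar> * norm ((T ^^ n) \<xi>) \<le> inverse (fact n) * (B ^ n * norm \<xi>)"
    by (intro mult_mono) auto
  thus ?thesis by (simp add: mult.assoc)
qed

lemma cos_series_summable:
  assumes "\<xi> \<in> K"
  shows "summable (\<lambda>n. cos_coeff n *\<^sub>R (T ^^ n) \<xi>)"
proof -
  obtain B where B: "B > 0" "\<forall>\<xi>\<in>K. norm (T \<xi>) \<le> B * norm \<xi>" using T_bound by blast
  have "summable (\<lambda>n. B ^ n /\<^sub>R fact n * norm \<xi>)"
    by (intro summable_mult2 summable_exp_generic)
  thus ?thesis by (rule summable_comparison_test'[where N = 0]) (rule cos_series_bound[OF B assms])
qed

lemma op_cos_tendsto: "\<xi> \<in> K \<Longrightarrow> (\<lambda>n. op_poly (cos_poly n) T \<xi>) \<longlonglongrightarrow> op_cos T \<xi>"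
  using summable_LIMSEQ[OF cos_series_summable[of \<xi>]] op_cos_partial_sums[of \<xi>] by (simp add: op_cos_def)

lemma op_cos_in: "closed K \<Longrightarrow> \<xi> \<in> K \<Longrightarrow> op_cos T \<xi> \<in> K"
  by (rule closed_sequentially[OF _ _ op_cos_tendsto]) (auto intro: op_poly_in)

lemma norm_cos_poly_le: "\<exists>C\<ge>0. \<forall>n. \<forall>\<xi>\<in>K. norm (op_poly (cos_poly n) T \<xi>) \<le> C * norm \<xi>"
proof -
  obtain B where B: "B > 0" "\<forall>\<xi>\<in>K. norm (T \<xi>) \<le> B * norm \<xi>" using T_bound by blast
  have "norm (op_poly (cos_poly n) T \<xi>) \<le> exp B * norm \<xi>" if \<xi>: "\<xi> \<in> K" for n \<xi>
  proof -
    have "norm (op_poly (cos_poly n) T \<xi>) \<le> (\<Sum>i<n. B ^ i /\<^sub>R fact i * norm \<xi>)"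
      unfolding op_cos_partial_sums[OF \<xi>] by (intro sum_norm_le cos_series_bound B \<xi>)
    also have "\<dots> = (\<Sum>i<n. B ^ i /\<^sub>R fact i) * norm \<xi>" by (simp only: sum_distrib_right)
    also have "\<dots> \<le> exp B * norm \<xi>"
      unfolding exp_def using B(1) by (intro mult_right_mono sum_le_suminf summable_exp_generic) auto
    finally show ?thesis .
  qed
  thus ?thesis by (intro exI[of _ "exp B"]) auto
qed

text \<open>Both factors vary with \<open>n\<close>, so pointwise convergence of each is not enough;
  the uniform bound of \<open>norm_cos_poly_le\<close> controls the error of the inner factor after
  the outer one is applied.\<close>

lemma op_cos_sq_tendsto:
  assumes "closed K" "\<xi> \<in> K"
  shows "(\<lambda>n. op_poly (cos_poly n * cos_poly n) T \<xi>) \<longlonglongrightarrow> op_cos T (op_cos T \<xi>)"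
proof -
  obtain C where C: "C \<ge> 0" "\<And>n \<xi>. \<xi> \<in> K \<Longrightarrow> norm (op_poly (cos_poly n) T \<xi>) \<le> C * norm \<xi>"
    using norm_cos_poly_le by blast
  let ?c = "\<lambda>n. op_poly (cos_poly n) T"
  have \<eta>: "op_cos T \<xi> \<in> K" using assms by (rule op_cos_in)
  have "(\<lambda>n. ?c n (?c n \<xi> - op_cos T \<xi>)) \<longlonglongrightarrow> 0"
  proof (rule Lim_null_comparison)
    show "\<forall>\<^sub>F n in sequentially. norm (?c n (?c n \<xi> - op_cos T \<xi>)) \<le> C * norm (?c n \<xi> - op_cos T \<xi>)"
      using assms \<eta> K by (intro always_eventually allI C csubspace_diff op_poly_in) auto
    have "(\<lambda>n. C * norm (?c n \<xi> - op_cos T \<xi>)) \<longlonglongrightarrow> C * norm (op_cos T \<xi> - op_cos T \<xi>)"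
      by (intro tendsto_intros op_cos_tendsto assms)
    thus "(\<lambda>n. C * norm (?c n \<xi> - op_cos T \<xi>)) \<longlonglongrightarrow> 0" by simp
  qed
  hence "(\<lambda>n. ?c n (?c n \<xi> - op_cos T \<xi>) + ?c n (op_cos T \<xi>)) \<longlonglongrightarrow> 0 + op_cos T (op_cos T \<xi>)"
    by (intro tendsto_add op_cos_tendsto \<eta>)
  moreover have "?c n (?c n \<xi> - op_cos T \<xi>) + ?c n (op_cos T \<xi>) = op_poly (cos_poly n * cos_poly n) T \<xi>" for n
    using op_poly_vec_add[of "?c n \<xi> - op_cos T \<xi>" "op_cos T \<xi>" "cos_poly n"] assms \<eta> K
    by (simp add: csubspace_diff op_poly_in op_poly_mult)
  ultimately show ?thesis by simp
qed

end

text \<open>On \<open>[0, \<pi>/2]\<close> we have \<open>|x - \<theta>| \<le> M |cos\<^sup>2 x - cos\<^sup>2 \<theta>|\<close>, and inequalities between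
  polynomials on an interval containing the spectrum carry over to the operator.\<close>

lemma (in symmetric_op) eigenvector_of_cos_sq:
  assumes K': "closed K" and spec: "spectrum_on K T \<subseteq> complex_of_real ` {0..pi / 2}"
    and \<theta>: "0 < \<theta>" "\<theta> < pi / 2" and \<xi>: "\<xi> \<in> K"
    and eig: "op_cos T (op_cos T \<xi>) = (cos \<theta>)\<^sup>2 *\<^sub>R \<xi>"
  shows "T \<xi> = \<theta> *\<^sub>R \<xi>"
proof -
  obtain M where M: "M > 0" "\<And>x. x \<in> {0..pi/2} \<Longrightarrow> \<bar>x - \<theta>\<bar> \<le> M * \<bar>(cos x)\<^sup>2 - (cos \<theta>)\<^sup>2\<bar>"
    using cos_sq_separates[OF \<theta>] by blast
  define l where "l = [:complex_of_real (- \<theta>), 1:]"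
  define g where "g n = cos_poly n * cos_poly n - [:complex_of_real ((cos \<theta>)\<^sup>2):]" for n
  have l_real: "coeff l i \<in> \<real>" for i
    by (auto simp: l_def coeff_pCons split: nat.splits)
  have g_real: "coeff (g n) i \<in> \<real>" for n i
    using poly_real_coeffs_mult[OF coeff_cos_poly coeff_cos_poly, of n n i]
    by (auto simp: g_def coeff_pCons split: nat.splits intro!: Reals_diff)
  have Tl: "op_poly l T \<xi> = T \<xi> - \<theta> *\<^sub>R \<xi>"
    using op_poly_linear_factor[OF \<xi>, of "of_real \<theta>"] by (simp add: l_def scaleC_of_real)
  have g0: "(\<lambda>n. op_poly (g n) T \<xi>) \<longlonglongrightarrow> 0"
    using tendsto_diff[OF op_cos_sq_tendsto[OF K' \<xi>] tendsto_const[of "(cos \<theta>)\<^sup>2 *\<^sub>R \<xi>"]]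
    unfolding g_def op_poly_diff[OF \<xi>] op_poly_const scaleC_of_real eig by simp
  have err: "(\<lambda>n. 2 ^ n / fact n :: real) \<longlonglongrightarrow> 0"
    using summable_LIMSEQ_zero[OF summable_exp_generic[of "2::real"]] by (simp add: divide_inverse mult.commute)
  have main: "(norm (T \<xi> - \<theta> *\<^sub>R \<xi>))\<^sup>2 \<le> e * (norm \<xi>)\<^sup>2" if e: "e > 0" for e
  proof -
    define en where "en n = (2 ^ n / fact n :: real)" for n
    have "(\<lambda>n. M\<^sup>2 * (2 * (en n * (2 + en n)))) \<longlonglongrightarrow> M\<^sup>2 * (2 * (0 * (2 + 0)))"
      using err unfolding en_def by (intro tendsto_intros)
    hence ev: "\<forall>\<^sub>F n in sequentially. M\<^sup>2 * (2 * (en n * (2 + en n))) < e"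
      using e by (intro order_tendstoD) auto
    have *: "(norm (T \<xi> - \<theta> *\<^sub>R \<xi>))\<^sup>2 \<le> M\<^sup>2 * (norm (op_poly (g n) T \<xi>))\<^sup>2 + e * (norm \<xi>)\<^sup>2"
      if n: "M\<^sup>2 * (2 * (en n * (2 + en n))) < e" for n
    proof -
      \<comment> \<open>With the exact cosine, \<open>M^2 * g^2 - l^2\<close> would be nonnegative
        on the interval. Truncating the series lowers it by at most
        \<open>M^2 * (2 * (en n * (2 + en n)))\<close>, which \<open>e\<close> covers.\<close>
      define r where "r = smult (of_real (M\<^sup>2)) (g n * g n) - l * l + [:complex_of_real e:]"
      have r_real: "coeff r i \<in> \<real>" for i
        unfolding r_def coeff_add coeff_diff coeff_smult
        by (intro Reals_add Reals_diff Reals_mult Reals_of_real poly_real_coeffs_mult g_real l_real)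
          (auto simp: coeff_pCons split: nat.splits)
      have pos: "0 \<le> Re (poly r (complex_of_real x))" if x: "x \<in> {0..pi/2}" for x
      proof -
        define c where "c = (\<Sum>i<n. cos_coeff i * x ^ i)"
        define G where "G = (cos x)\<^sup>2 - (cos \<theta>)\<^sup>2"
        have ce: "\<bar>c - cos x\<bar> \<le> en n" unfolding c_def en_def by (rule cos_poly_error[OF x])
        have "poly r (complex_of_real x) = of_real (M\<^sup>2 * (c * c - (cos \<theta>)\<^sup>2)\<^sup>2 - (x - \<theta>)\<^sup>2 + e)"
          by (simp add: r_def g_def l_def poly_cos_poly c_def power2_eq_square algebra_simps)
        hence eq: "Re (poly r (complex_of_real x)) = M\<^sup>2 * (c * c - (cos \<theta>)\<^sup>2)\<^sup>2 - (x - \<theta>)\<^sup>2 + e" by simp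
        have xM: "(x - \<theta>)\<^sup>2 \<le> M\<^sup>2 * G\<^sup>2"
          using power_mono[OF M(2)[OF x] abs_ge_zero, of 2] by (simp add: G_def power_mult_distrib)
        have d: "\<bar>c * c - (cos x)\<^sup>2\<bar> \<le> en n * (2 + en n)"
        proof -
          have "c * c - (cos x)\<^sup>2 = (c - cos x) * (c + cos x)" by (simp add: algebra_simps power2_eq_square)
          moreover have "\<bar>c + cos x\<bar> \<le> 2 + en n" using ce abs_cos_le_one[of x] by linarith
          ultimately show ?thesis using ce by (auto simp: abs_mult intro: mult_mono)
        qed
        have "\<bar>G\<bar> \<le> 1"
        proof -
          have "(cos x)\<^sup>2 \<le> 1" "(cos \<theta>)\<^sup>2 \<le> 1" by (auto simp: abs_square_le_1)
          thus ?thesis unfolding G_def by (simp add: abs_le_iff) (smt (verit) zero_le_power2)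
        qed
        define \<delta> where "\<delta> = c * c - (cos x)\<^sup>2"
        have "(c * c - (cos \<theta>)\<^sup>2)\<^sup>2 = (G + \<delta>)\<^sup>2" by (simp add: G_def \<delta>_def)
        also have "\<dots> \<ge> G\<^sup>2 + 2 * (G * \<delta>)" by (simp add: power2_sum)
        finally have "G\<^sup>2 + 2 * (G * \<delta>) \<le> (c * c - (cos \<theta>)\<^sup>2)\<^sup>2" .
        moreover have "\<bar>G * \<delta>\<bar> \<le> 1 * (en n * (2 + en n))"
          unfolding abs_mult using \<open>\<bar>G\<bar> \<le> 1\<close> d by (intro mult_mono) (auto simp: \<delta>_def)
        ultimately have "G\<^sup>2 - 2 * (en n * (2 + en n)) \<le> (c * c - (cos \<theta>)\<^sup>2)\<^sup>2" by linarith
        hence "M\<^sup>2 * (G\<^sup>2 - 2 * (en n * (2 + en n))) \<le> M\<^sup>2 * (c * c - (cos \<theta>)\<^sup>2)\<^sup>2"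
          by (intro mult_left_mono) auto
        thus ?thesis unfolding eq using xM n by (simp add: right_diff_distrib)
      qed
      have "0 \<le> Re (cinner (op_poly r T \<xi>) \<xi>)"
        using op_poly_nonneg[OF _ spec r_real pos \<xi>] by simp
      also have "op_poly r T \<xi> = of_real (M\<^sup>2) *\<^sub>C op_poly (g n) T (op_poly (g n) T \<xi>)
          - op_poly l T (op_poly l T \<xi>) + of_real e *\<^sub>C \<xi>"
        unfolding r_def by (simp only: op_poly_add[OF \<xi>] op_poly_diff[OF \<xi>] op_poly_smult[OF \<xi>]
            op_poly_mult[OF \<xi>] op_poly_const)
      also have "Re (cinner \<dots> \<xi>) = M\<^sup>2 * Re (cinner (op_poly (g n) T (op_poly (g n) T \<xi>)) \<xi>)
          - Re (cinner (op_poly l T (op_poly l T \<xi>)) \<xi>) + e * Re (cinner \<xi> \<xi>)"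
        by (simp add: cinner_simps flip: of_real_power)
      also have "\<dots> = M\<^sup>2 * (norm (op_poly (g n) T \<xi>))\<^sup>2 - (norm (T \<xi> - \<theta> *\<^sub>R \<xi>))\<^sup>2 + e * (norm \<xi>)\<^sup>2"
        using op_poly_symmetric[OF g_real op_poly_in[OF \<xi>] \<xi>, of n "g n"]
          op_poly_symmetric[OF l_real op_poly_in[OF \<xi>] \<xi>, of l] Tl
        by (simp add: norm_sq_cinner)
      finally show ?thesis by simp
    qed
    have "(\<lambda>n. M\<^sup>2 * (norm (op_poly (g n) T \<xi>))\<^sup>2 + e * (norm \<xi>)\<^sup>2) \<longlonglongrightarrow> M\<^sup>2 * (norm (0::'a))\<^sup>2 + e * (norm \<xi>)\<^sup>2"
      by (intro tendsto_intros g0)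
    hence "(\<lambda>n. M\<^sup>2 * (norm (op_poly (g n) T \<xi>))\<^sup>2 + e * (norm \<xi>)\<^sup>2) \<longlonglongrightarrow> e * (norm \<xi>)\<^sup>2" by simp
    thus ?thesis
      by (rule tendsto_lowerbound) (use ev * in \<open>auto elim: eventually_mono\<close>)
  qed
  have "(norm (T \<xi> - \<theta> *\<^sub>R \<xi>))\<^sup>2 \<le> 0 + e" if "e > 0" for e
  proof -
    have "e / (1 + (norm \<xi>)\<^sup>2) * (norm \<xi>)\<^sup>2 \<le> e" using that by (simp add: field_simps add_pos_nonneg)
    moreover have "e / (1 + (norm \<xi>)\<^sup>2) > 0" using that by (simp add: add_pos_nonneg)
    ultimately show ?thesis using main by force
  qed
  hence "(norm (T \<xi> - \<theta> *\<^sub>R \<xi>))\<^sup>2 \<le> 0" by (rule field_le_epsilon)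
  thus ?thesis by simp
qed

section \<open>Angles given by finitely many eigenvalues\<close>

lemma inj_on_cos_sq: "inj_on (\<lambda>x. (cos x)\<^sup>2) {0..pi/2}"
proof (rule inj_onI)
  fix x y :: real assume xy: "x \<in> {0..pi/2}" "y \<in> {0..pi/2}" and "(cos x)\<^sup>2 = (cos y)\<^sup>2"
  hence "cos x = cos y" using cos_ge_zero[of x] cos_ge_zero[of y] by (simp add: power2_eq_iff_nonneg)
  thus "x = y" using xy by (auto intro: cos_inj_pi)
qed

text \<open>Totality is expressed through closed subspaces because the vectors of \<open>W\<close>
  need not be independent; in the application, those for different word lengths are not. \<Theta>s
  may contain values that do not occur, and \<open>Ang_proj_eq\<close> asks for an eigenvector
  separately.\<close>

locale eigenangles =
  fixes S S' :: "'h::complex_hilbert_space set" and \<Theta>s :: "real set" and W :: "'h set"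
  assumes S: "csubspace S" "closed S" and S': "csubspace S'" "closed S'"
    and fin: "finite \<Theta>s" and \<Theta>s: "\<Theta>s \<subseteq> {0..pi/2}"
    and W: "W \<subseteq> S"
    and total: "\<And>V. csubspace V \<Longrightarrow> closed V \<Longrightarrow> W \<subseteq> V \<Longrightarrow> S \<subseteq> V"
    and eigen: "\<And>w. w \<in> W \<Longrightarrow> \<exists>\<theta>\<in>\<Theta>s. proj S (proj S' w) = (cos \<theta>)\<^sup>2 *\<^sub>R w"
begin

abbreviation p where "p \<equiv> proj S"
abbreviation q where "q \<equiv> proj S'"

text \<open>On the range of \<open>p\<close> this agrees with \<open>p q p\<close>.\<close>

definition X where "X \<xi> = p (q \<xi>)"

lemma p_id: "\<xi> \<in> S \<Longrightarrow> p \<xi> = \<xi>" by (rule proj_id[OF S(1)])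
lemma p_in: "p \<xi> \<in> S" by (rule proj_in[OF S])
lemma q_id: "\<xi> \<in> S' \<Longrightarrow> q \<xi> = \<xi>" by (rule proj_id[OF S'(1)])
lemma q_in: "q \<xi> \<in> S'" by (rule proj_in[OF S'])

lemma X_bounded_operator: "X ` K \<subseteq> K \<Longrightarrow> bounded_operator_on K X"
  unfolding bounded_operator_on_def X_def
  by (auto simp: proj_add S S' proj_scaleC intro!: exI[of _ 1] order.trans[OF norm_proj_le[OF S]] norm_proj_le[OF S'])

text \<open>Both readings of \<open>X\<close> are used: on the whole space its polynomials are
  bounded linear maps, so conditions stated with them are closed; on \<open>S\<close> they preserve
  \<open>S\<close>.\<close>

sublocale U: bounded_op UNIV X
  by standard (auto simp: csubspace_def X_bounded_operator)

sublocale XS: bounded_op S X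
  by standard (auto intro!: X_bounded_operator S simp: X_def p_in)

lemma cinner_X: "\<xi> \<in> S \<Longrightarrow> \<eta> \<in> S \<Longrightarrow> cinner (X \<xi>) \<eta> = cinner \<xi> (X \<eta>)"
  by (simp add: X_def cinner_proj[OF S] cinner_proj[OF S'] p_id flip: cinner_proj[OF S, of \<xi>])

text \<open>The Lagrange interpolation polynomial for the nodes \<open>cos^2\<close>, which are
  distinct by \<open>inj_on_cos_sq\<close>. Evaluated at \<open>X\<close> it becomes the spectral
  projection \<open>P \<theta>\<close>.\<close>

definition lagrange :: "real \<Rightarrow> complex poly" where
  "lagrange \<theta> = (\<Prod>\<theta>'\<in>\<Theta>s - {\<theta>}. smult (1 / of_real ((cos \<theta>)\<^sup>2 - (cos \<theta>')\<^sup>2)) [:- of_real ((cos \<theta>')\<^sup>2), 1:])"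

lemma poly_lagrange:
  assumes "\<theta> \<in> \<Theta>s" "\<theta>' \<in> \<Theta>s"
  shows "poly (lagrange \<theta>) (of_real ((cos \<theta>')\<^sup>2)) = (if \<theta> = \<theta>' then 1 else 0)"
proof (cases "\<theta> = \<theta>'")
  case True
  have nz: "complex_of_real ((cos \<theta>')\<^sup>2) - of_real ((cos t)\<^sup>2) \<noteq> 0" if "t \<in> \<Theta>s - {\<theta>}" for t
  proof -
    have "\<theta>' \<in> {0..pi/2}" "t \<in> {0..pi/2}" "\<theta>' \<noteq> t" using that True assms \<Theta>s by auto
    hence "(cos \<theta>')\<^sup>2 \<noteq> (cos t)\<^sup>2" using inj_onD[OF inj_on_cos_sq] by blast
    thus ?thesis by (simp only: right_minus_eq of_real_eq_iff not_False_eq_True)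
  qed
  have "poly (smult (1 / of_real ((cos \<theta>)\<^sup>2 - (cos t)\<^sup>2)) [:- of_real ((cos t)\<^sup>2), 1:])
      (complex_of_real ((cos \<theta>')\<^sup>2)) = 1" if "t \<in> \<Theta>s - {\<theta>}" for t
    using nz[OF that] by (simp add: True of_real_diff del: of_real_power flip: diff_divide_distrib)
  thus ?thesis using True unfolding lagrange_def poly_prod by (auto intro!: prod.neutral)
next
  case False
  thus ?thesis using fin assms unfolding lagrange_def poly_prod by (auto intro!: prod_zero bexI[of _ \<theta>'])
qed

definition P where "P \<theta> = op_poly (lagrange \<theta>) X"

definition E where "E \<theta> = {\<xi>\<in>S. X \<xi> = (cos \<theta>)\<^sup>2 *\<^sub>R \<xi>}"

lemma P_E: "\<theta> \<in> \<Theta>s \<Longrightarrow> \<theta>' \<in> \<Theta>s \<Longrightarrow> \<xi> \<in> E \<theta>' \<Longrightarrow> P \<theta> \<xi> = (if \<theta> = \<theta>' then \<xi> else 0)"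
  unfolding P_def using XS.op_poly_eigen[of \<xi> "of_real ((cos \<theta>')\<^sup>2)"]
  by (auto simp only: E_def mem_Collect_eq scaleC_of_real poly_lagrange scaleC_one scaleC_zero_left split: if_splits)

lemma bounded_linear_P: "bounded_linear (P \<theta>)"
proof -
  have b: "bounded_operator_on UNIV (P \<theta>)" unfolding P_def by (rule U.bounded_operator_on_op_poly)
  then obtain B where "\<forall>\<xi>. norm (P \<theta> \<xi>) \<le> B * norm \<xi>" by (auto simp: bounded_operator_on_def)
  hence "bounded_clinear (P \<theta>)"
    using b by (intro bounded_clinearI[of _ B]) (auto simp: bounded_operator_on_def)
  thus ?thesis by (simp add: bounded_clinear_def)
qed

lemma bounded_linear_X: "bounded_linear X"
  unfolding X_def by (intro bounded_linear_compose[OF bounded_linear_proj bounded_linear_proj] S S')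

lemma P_add: "P \<theta> (\<xi> + \<eta>) = P \<theta> \<xi> + P \<theta> \<eta>"
  and P_scaleC: "P \<theta> (c *\<^sub>C \<xi>) = c *\<^sub>C P \<theta> \<xi>"
  unfolding P_def by (auto simp: U.op_poly_vec_add U.op_poly_vec_scaleC)

lemma P_in: "\<xi> \<in> S \<Longrightarrow> P \<theta> \<xi> \<in> S"
  unfolding P_def by (rule XS.op_poly_in)

text \<open>The two assertions define a closed subspace, so by totality it is enough to check them
  on the eigenvectors in \<open>W\<close>.\<close>

lemma decomposition: "\<xi> \<in> S \<Longrightarrow> (\<Sum>\<theta>\<in>\<Theta>s. P \<theta> \<xi>) = \<xi> \<and> (\<forall>\<theta>\<in>\<Theta>s. P \<theta> \<xi> \<in> E \<theta>)"
proof -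
  define V where "V = {\<xi>\<in>S. (\<Sum>\<theta>\<in>\<Theta>s. P \<theta> \<xi>) = \<xi> \<and> (\<forall>\<theta>\<in>\<Theta>s. X (P \<theta> \<xi>) = (cos \<theta>)\<^sup>2 *\<^sub>R P \<theta> \<xi>)}"
  have "S \<subseteq> V"
  proof (rule total)
    show "csubspace V"
      using S(1) unfolding csubspace_def V_def
      by (auto simp: P_add P_scaleC sum.distrib U.T_add U.T_scaleC scaleR_add_right scaleC_scaleR U.T_zero
          scaleC_sum_right[symmetric] linear_simps(3)[OF bounded_linear_P])
    have "V = S \<inter> {\<xi>. (\<Sum>\<theta>\<in>\<Theta>s. P \<theta> \<xi>) = \<xi>} \<inter> (\<Inter>\<theta>\<in>\<Theta>s. {\<xi>. X (P \<theta> \<xi>) = (cos \<theta>)\<^sup>2 *\<^sub>R P \<theta> \<xi>})"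
      by (auto simp: V_def)
    also have "closed \<dots>"
      by (intro closed_Int closed_INT ballI S closed_Collect_eq continuous_intros
          bounded_linear.continuous_on[OF bounded_linear_P] bounded_linear.continuous_on[OF bounded_linear_X])
    finally show "closed V" .
    show "W \<subseteq> V"
    proof
      fix w assume w: "w \<in> W"
      then obtain \<theta> where \<theta>: "\<theta> \<in> \<Theta>s" "X w = (cos \<theta>)\<^sup>2 *\<^sub>R w" using eigen unfolding X_def by blast
      hence "w \<in> E \<theta>" using w W by (auto simp: E_def)
      hence "P \<theta>' w = (if \<theta>' = \<theta> then w else 0)" if "\<theta>' \<in> \<Theta>s" for \<theta>' using P_E[OF that \<theta>(1)] by auto
      thus "w \<in> V" using w W \<theta> fin by (auto simp: V_def U.T_zero)
    qed
  qed
  moreover assume "\<xi> \<in> S"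
  ultimately show ?thesis using P_in by (auto simp: V_def E_def)
qed

lemma E_orthogonal:
  assumes "\<xi> \<in> E \<theta>" "\<eta> \<in> E \<theta>'" "\<theta> \<in> {0..pi/2}" "\<theta>' \<in> {0..pi/2}" "\<theta> \<noteq> \<theta>'"
  shows "cinner \<xi> \<eta> = 0"
proof -
  have "of_real ((cos \<theta>)\<^sup>2) * cinner \<xi> \<eta> = of_real ((cos \<theta>')\<^sup>2) * cinner \<xi> \<eta>"
    using cinner_X[of \<xi> \<eta>] assms(1,2) by (auto simp: E_def cinner_scaleR_left cinner_scaleR_right simp del: of_real_power)
  moreover have "(cos \<theta>)\<^sup>2 \<noteq> (cos \<theta>')\<^sup>2" using inj_onD[OF inj_on_cos_sq] assms by blast
  ultimately show ?thesis by (auto simp del: of_real_power)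
qed

lemma norm_q_E: "\<xi> \<in> E \<theta> \<Longrightarrow> (norm (q \<xi>))\<^sup>2 = (cos \<theta>)\<^sup>2 * (norm \<xi>)\<^sup>2"
proof -
  assume \<xi>: "\<xi> \<in> E \<theta>"
  have "\<xi> \<in> S" using \<xi> by (simp add: E_def)
  hence "cinner (q \<xi>) (q \<xi>) = cinner (X \<xi>) \<xi>"
    by (simp add: X_def cinner_proj[OF S] cinner_proj[OF S'] p_id q_id q_in)
  also have "\<dots> = of_real ((cos \<theta>)\<^sup>2 * (norm \<xi>)\<^sup>2)" using \<xi> by (simp add: E_def cinner_scaleR_left cinner_self)
  finally show ?thesis by (simp add: norm_sq_cinner)
qed

lemma q_E_0: "\<xi> \<in> E 0 \<Longrightarrow> q \<xi> = \<xi>"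
proof -
  assume \<xi>: "\<xi> \<in> E 0"
  have "cinner (q \<xi>) (\<xi> - q \<xi>) = 0" by (rule orth_complD'[OF proj_orth[OF S'] q_in])
  hence "(norm (q \<xi> + (\<xi> - q \<xi>)))\<^sup>2 = (norm (q \<xi>))\<^sup>2 + (norm (\<xi> - q \<xi>))\<^sup>2" unfolding norm_add_sq by simp
  thus ?thesis using norm_q_E[OF \<xi>] by simp
qed

lemma q_E_pi_half: "\<xi> \<in> E (pi / 2) \<Longrightarrow> q \<xi> = 0"
  using norm_q_E[of \<xi> "pi / 2"] by simp

text \<open>\<open>q\<close> is the identity on \<open>E 0\<close> and zero on
  \<open>E (pi / 2)\<close>, so it maps \<open>S\<close> into \<open>S\<close>. Then
  \<open>q p = p q p\<close>, and the right side is selfadjoint.\<close>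

lemma commute_if_trivial:
  assumes "\<Theta>s \<subseteq> {0, pi/2}"
  shows "p \<circ> q = q \<circ> p"
proof -
  have qS: "q \<xi> \<in> S" if \<xi>: "\<xi> \<in> S" for \<xi>
  proof -
    have "q \<xi> = (\<Sum>\<theta>\<in>\<Theta>s. q (P \<theta> \<xi>))"
      using decomposition[OF \<xi>] linear_sum[OF bounded_linear.linear[OF bounded_linear_proj[OF S']], of "\<lambda>\<theta>. P \<theta> \<xi>" \<Theta>s]
      by (simp add: o_def)
    also have "\<dots> \<in> S"
    proof (rule csubspace_sum[OF S(1)])
      fix \<theta> assume \<theta>: "\<theta> \<in> \<Theta>s"
      hence "P \<theta> \<xi> \<in> E \<theta>" "P \<theta> \<xi> \<in> S" using decomposition[OF \<xi>] P_in[OF \<xi>] by auto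
      thus "q (P \<theta> \<xi>) \<in> S" using \<theta> assms q_E_0 q_E_pi_half csubspace_0[OF S(1)] by auto
    qed
    finally show ?thesis .
  qed
  have qp: "p (q (p \<zeta>)) = q (p \<zeta>)" for \<zeta> using qS[OF p_in] p_id by blast
  have "p (q \<zeta>) = q (p \<zeta>)" for \<zeta>
  proof -
    have "cinner (p (q \<zeta>) - q (p \<zeta>)) \<eta> = 0" for \<eta>
    proof -
      have "cinner (p (q \<zeta>)) \<eta> = cinner \<zeta> (q (p \<eta>))" by (simp add: cinner_proj[OF S] cinner_proj[OF S'])
      also have "\<dots> = cinner \<zeta> (p (q (p \<eta>)))" by (simp only: qp)
      also have "\<dots> = cinner (p (q (p \<zeta>))) \<eta>" by (simp add: cinner_proj[OF S] cinner_proj[OF S'])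
      also have "\<dots> = cinner (q (p \<zeta>)) \<eta>" by (simp only: qp)
      finally show ?thesis by (simp add: cinner_diff_left)
    qed
    from this[of "p (q \<zeta>) - q (p \<zeta>)"] show ?thesis by simp
  qed
  thus ?thesis by auto
qed

section \<open>The generic part and its angle operator\<close>

abbreviation \<Theta>' where "\<Theta>' \<equiv> \<Theta>s \<inter> {0<..<pi/2}"

text \<open>By \<open>p_generic_part\<close> this is the space on which the angle operator acts,
  described by the absence of components at 0 and \<open>pi / 2\<close>.\<close>

definition K where "K = {\<xi>\<in>S. \<forall>\<theta>\<in>\<Theta>s - \<Theta>'. P \<theta> \<xi> = 0}"

lemma trivial_angle_cases: "\<theta> \<in> \<Theta>s - \<Theta>' \<Longrightarrow> \<theta> = 0 \<or> \<theta> = pi / 2"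
  using \<Theta>s by force

lemma K_csubspace: "csubspace K"
  using S(1) linear_simps(3)[OF bounded_linear_P] unfolding csubspace_def K_def by (auto simp: P_add P_scaleC)

lemma K_closed: "closed K"
proof -
  have "K = S \<inter> (\<Inter>\<theta>\<in>\<Theta>s - \<Theta>'. {\<xi>. P \<theta> \<xi> = 0})" by (auto simp: K_def)
  also have "closed \<dots>"
    by (intro closed_Int closed_INT ballI S closed_Collect_eq continuous_intros
        bounded_linear.continuous_on[OF bounded_linear_P])
  finally show ?thesis .
qed

lemma K_decomposition: "\<xi> \<in> K \<Longrightarrow> (\<Sum>\<theta>\<in>\<Theta>'. P \<theta> \<xi>) = \<xi>"
proof -
  assume \<xi>: "\<xi> \<in> K"
  have "(\<Sum>\<theta>\<in>\<Theta>'. P \<theta> \<xi>) = (\<Sum>\<theta>\<in>\<Theta>s. P \<theta> \<xi>)"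
    using fin \<xi> by (intro sum.mono_neutral_left) (auto simp: K_def)
  thus ?thesis using \<xi> decomposition by (auto simp: K_def)
qed

lemma E_subset_K: "\<theta> \<in> \<Theta>' \<Longrightarrow> E \<theta> \<subseteq> K"
  using P_E by (fastforce simp: K_def E_def)

lemma P_in_E: "\<xi> \<in> K \<Longrightarrow> \<theta> \<in> \<Theta>s \<Longrightarrow> P \<theta> \<xi> \<in> E \<theta>"
  using decomposition by (auto simp: K_def)

text \<open>Vectors of the two corners inside the range of \<open>p\<close> are eigenvectors of
  \<open>X\<close> for the angles 0 and \<open>pi / 2\<close>, and conversely; the two corners
  inside the complement of that range are orthogonal to \<open>S\<close> in any case.\<close>

lemma p_generic_part: "p ` generic_part p q = K"
proof
  have range_p: "range p = S" using p_in p_id by (force intro: image_eqI[OF sym])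
  have range_q: "range q = S'" using q_in q_id by (force intro: image_eqI[OF sym])
  have zero_q: "q 0 = 0" using q_id csubspace_0[OF S'(1)] by blast
  have zero_p: "p 0 = 0" using p_id csubspace_0[OF S(1)] by blast
  have pp: "p (\<xi> - p \<xi>) = 0" and qq: "q (\<xi> - q \<xi>) = 0" for \<xi>
    using linear_diff[OF bounded_linear.linear[OF bounded_linear_proj[OF S]], of \<xi> "p \<xi>"]
      linear_diff[OF bounded_linear.linear[OF bounded_linear_proj[OF S']], of \<xi> "q \<xi>"]
    by (auto simp: p_id p_in q_id q_in)
  show "p ` generic_part p q \<subseteq> K"
  proof clarify
    fix \<xi> assume \<xi>: "\<xi> \<in> generic_part p q"
    have "P \<theta> (p \<xi>) = 0" if \<theta>: "\<theta> \<in> \<Theta>s - \<Theta>'" for \<theta>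
    proof -
      \<comment> \<open>This component of \<open>p \<xi>\<close> lies in one of the removed corners,
        hence is orthogonal to \<xi>. As the eigenspaces are orthogonal, that inner product is also
        its squared norm.\<close>
      let ?\<eta> = "P \<theta> (p \<xi>)"
      have \<eta>: "?\<eta> \<in> E \<theta>" using decomposition[OF p_in] \<theta> by blast
      hence "?\<eta> \<in> S" by (simp add: E_def)
      hence "?\<eta> \<in> range p" by (simp add: range_p)
      have "cinner \<xi> ?\<eta> = 0"
        using trivial_angle_cases[OF \<theta>]
      proof
        assume "\<theta> = 0"
        hence "?\<eta> \<in> range q" using q_E_0 \<eta> by (metis rangeI)
        hence "?\<eta> \<in> {\<alpha> + \<beta> + \<gamma> + \<delta> | \<alpha> \<beta> \<gamma> \<delta>. \<alpha> \<in> range p \<inter> range q \<and> \<beta> \<in> range p \<inter> range (\<lambda>\<xi>. \<xi> - q \<xi>) \<and>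
            \<gamma> \<in> range (\<lambda>\<xi>. \<xi> - p \<xi>) \<inter> range q \<and> \<delta> \<in> range (\<lambda>\<xi>. \<xi> - p \<xi>) \<inter> range (\<lambda>\<xi>. \<xi> - q \<xi>)}"
          using \<open>?\<eta> \<in> range p\<close> zero_p zero_q
          by (intro CollectI exI[of _ ?\<eta>] exI[of _ 0]) (auto intro: range_eqI[of _ _ 0])
        thus ?thesis using \<xi> unfolding generic_part_def Let_def by (rule orth_complD[rotated])
      next
        assume "\<theta> = pi / 2"
        hence "q ?\<eta> = 0" using q_E_pi_half \<eta> by blast
        hence "?\<eta> = ?\<eta> - q ?\<eta>" by simp
        hence "?\<eta> \<in> range (\<lambda>\<xi>. \<xi> - q \<xi>)" by (rule range_eqI)
        hence "?\<eta> \<in> {\<alpha> + \<beta> + \<gamma> + \<delta> | \<alpha> \<beta> \<gamma> \<delta>. \<alpha> \<in> range p \<inter> range q \<and> \<beta> \<in> range p \<inter> range (\<lambda>\<xi>. \<xi> - q \<xi>) \<and>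
            \<gamma> \<in> range (\<lambda>\<xi>. \<xi> - p \<xi>) \<inter> range q \<and> \<delta> \<in> range (\<lambda>\<xi>. \<xi> - p \<xi>) \<inter> range (\<lambda>\<xi>. \<xi> - q \<xi>)}"
          using \<open>?\<eta> \<in> range p\<close> zero_p zero_q
          by (intro CollectI exI[of _ 0] exI[of _ ?\<eta>] conjI) (auto intro: range_eqI[of _ _ 0])
        thus ?thesis using \<xi> unfolding generic_part_def Let_def by (rule orth_complD[rotated])
      qed
      hence "cinner (p \<xi>) ?\<eta> = 0" using cinner_proj[OF S, of \<xi> ?\<eta>] p_id[OF \<open>?\<eta> \<in> S\<close>] by simp
      also have "cinner (p \<xi>) ?\<eta> = (\<Sum>\<theta>'\<in>\<Theta>s. cinner (P \<theta>' (p \<xi>)) ?\<eta>)"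
        using decomposition[OF p_in, of \<xi>] by (simp flip: cinner_sum_left)
      also have "\<dots> = (\<Sum>\<theta>'\<in>\<Theta>s. if \<theta>' = \<theta> then cinner ?\<eta> ?\<eta> else 0)"
      proof (rule sum.cong)
        fix \<theta>' assume "\<theta>' \<in> \<Theta>s"
        thus "cinner (P \<theta>' (p \<xi>)) ?\<eta> = (if \<theta>' = \<theta> then cinner ?\<eta> ?\<eta> else 0)"
        proof (cases "\<theta>' = \<theta>")
          case False
          have "cinner (P \<theta>' (p \<xi>)) ?\<eta> = 0"
            using decomposition[OF p_in, of \<xi>] \<eta> \<theta> \<Theta>s \<open>\<theta>' \<in> \<Theta>s\<close> False
            by (intro E_orthogonal[of _ \<theta>' _ \<theta>]) blast+
          thus ?thesis using False by simp
        qed simp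
      qed simp
      also have "\<dots> = cinner ?\<eta> ?\<eta>" using \<theta> fin by simp
      finally show ?thesis by simp
    qed
    thus "p \<xi> \<in> K" using p_in by (simp add: K_def)
  qed
  show "K \<subseteq> p ` generic_part p q"
  proof
    fix \<xi> assume \<xi>: "\<xi> \<in> K"
    hence \<xi>S: "\<xi> \<in> S" by (simp add: K_def)
    have E0: "cinner \<xi> \<zeta> = 0" if "\<zeta> \<in> E \<theta>" "\<theta> \<in> {0, pi/2}" for \<zeta> \<theta>
    proof -
      have "cinner \<xi> \<zeta> = (\<Sum>\<theta>'\<in>\<Theta>'. cinner (P \<theta>' \<xi>) \<zeta>)"
        using K_decomposition[OF \<xi>] by (simp flip: cinner_sum_left)
      also have "\<dots> = 0"
        using that P_in_E[OF \<xi>] by (intro sum.neutral ballI E_orthogonal[of _ _ \<zeta> \<theta>]) auto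
      finally show ?thesis .
    qed
    have "\<xi> \<in> generic_part p q"
      unfolding generic_part_def Let_def orth_compl_def
    proof (clarify)
      fix \<alpha>0 \<alpha>1 \<beta>0 \<beta>1 \<gamma>0 \<gamma>1 \<delta>0 \<delta>1
      assume eqs: "p \<alpha>0 = q \<alpha>1" "p \<beta>0 = \<beta>1 - q \<beta>1" 
      have "X (p \<alpha>0) = p \<alpha>0" unfolding X_def using p_id p_in q_id q_in eqs(1) by metis
      hence 1: "cinner \<xi> (p \<alpha>0) = 0" by (intro E0[of _ 0]) (auto simp: E_def p_in)
      have "X (p \<beta>0) = 0" unfolding X_def eqs qq zero_p ..
      hence 2: "cinner \<xi> (p \<beta>0) = 0" by (intro E0[of _ "pi/2"]) (auto simp: E_def p_in)
      have 3: "cinner \<xi> (\<zeta> - p \<zeta>) = 0" for \<zeta> using orth_complD'[OF proj_orth[OF S] \<xi>S] .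
      show "cinner \<xi> (p \<alpha>0 + p \<beta>0 + (\<gamma>0 - p \<gamma>0) + (\<delta>0 - p \<delta>0)) = 0"
        unfolding cinner_add_right 1 2 3 by simp
    qed
    thus "\<xi> \<in> p ` generic_part p q" using p_id[OF \<xi>S] by (metis imageI)
  qed
qed

text \<open>The restriction fixes the values outside \<open>K\<close>, as the extensionality in
  \<open>is_angle_operator\<close> demands; without it the description could not be unique.\<close>

definition \<Theta>0 where "\<Theta>0 = restrict (\<lambda>\<xi>. \<Sum>\<theta>\<in>\<Theta>'. \<theta> *\<^sub>R P \<theta> \<xi>) K"

lemma P_K: "\<xi> \<in> K \<Longrightarrow> \<theta> \<in> \<Theta>' \<Longrightarrow> P \<theta> \<xi> \<in> K"
  using P_in_E E_subset_K by blast

lemma P_P: "\<xi> \<in> K \<Longrightarrow> \<theta> \<in> \<Theta>' \<Longrightarrow> \<theta>' \<in> \<Theta>s \<Longrightarrow> P \<theta>' (P \<theta> \<xi>) = (if \<theta> = \<theta>' then P \<theta> \<xi> else 0)"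
  using P_E[of \<theta>' \<theta>] P_in_E by auto

lemma P_linear_combination:
  assumes "\<xi> \<in> K" "\<theta>' \<in> \<Theta>'"
  shows "P \<theta>' (\<Sum>\<theta>\<in>\<Theta>'. f \<theta> *\<^sub>C P \<theta> \<xi>) = f \<theta>' *\<^sub>C P \<theta>' \<xi>"
proof -
  have "P \<theta>' (\<Sum>\<theta>\<in>\<Theta>'. f \<theta> *\<^sub>C P \<theta> \<xi>) = (\<Sum>\<theta>\<in>\<Theta>'. f \<theta> *\<^sub>C P \<theta>' (P \<theta> \<xi>))"
    unfolding linear_sum[OF bounded_linear.linear[OF bounded_linear_P], of \<theta>'] by (simp add: P_scaleC)
  also have "\<dots> = (\<Sum>\<theta>\<in>\<Theta>'. if \<theta> = \<theta>' then f \<theta>' *\<^sub>C P \<theta>' \<xi> else 0)"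
    using assms by (intro sum.cong) (auto simp: P_P)
  also have "\<dots> = f \<theta>' *\<^sub>C P \<theta>' \<xi>" using assms fin by simp
  finally show ?thesis .
qed

lemma linear_combination_in_K: "\<xi> \<in> K \<Longrightarrow> (\<Sum>\<theta>\<in>\<Theta>'. f \<theta> *\<^sub>C P \<theta> \<xi>) \<in> K"
  by (intro csubspace_sum[OF K_csubspace] csubspace_scaleC[OF K_csubspace] P_K)

lemma bounded_operator_on_combination:
  "bounded_operator_on K (\<lambda>\<xi>. \<Sum>\<theta>\<in>\<Theta>'. f \<theta> *\<^sub>C P \<theta> \<xi>)"
proof -
  have bl: "bounded_linear (\<lambda>\<xi>. \<Sum>\<theta>\<in>\<Theta>'. f \<theta> *\<^sub>C P \<theta> \<xi>)"
    by (intro bounded_linear_sum bounded_linear_compose[OF bounded_linear_scaleC bounded_linear_P])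
  obtain B where "\<forall>\<xi>. norm (\<Sum>\<theta>\<in>\<Theta>'. f \<theta> *\<^sub>C P \<theta> \<xi>) \<le> norm \<xi> * B"
    using bounded_linear.bounded[OF bl] by blast
  hence "\<exists>B. \<forall>\<xi>\<in>K. norm (\<Sum>\<theta>\<in>\<Theta>'. f \<theta> *\<^sub>C P \<theta> \<xi>) \<le> B * norm \<xi>" by (metis mult.commute)
  thus ?thesis unfolding bounded_operator_on_def
    by (auto simp: linear_combination_in_K P_add P_scaleC scaleC_add_right sum.distrib scaleC_sum_right
        scaleC_scaleC mult.commute)
qed

lemma \<Theta>0_eq: "\<xi> \<in> K \<Longrightarrow> \<Theta>0 \<xi> = (\<Sum>\<theta>\<in>\<Theta>'. complex_of_real \<theta> *\<^sub>C P \<theta> \<xi>)"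
  by (simp add: \<Theta>0_def scaleC_of_real)

lemma \<Theta>0_iterate: "\<xi> \<in> K \<Longrightarrow> (\<Theta>0 ^^ n) \<xi> = (\<Sum>\<theta>\<in>\<Theta>'. complex_of_real (\<theta> ^ n) *\<^sub>C P \<theta> \<xi>)"
proof (induction n)
  case 0
  thus ?case using K_decomposition by simp
next
  case (Suc n)
  have "(\<Theta>0 ^^ Suc n) \<xi> = (\<Sum>\<theta>'\<in>\<Theta>'. complex_of_real \<theta>' *\<^sub>C P \<theta>' (\<Sum>\<theta>\<in>\<Theta>'. complex_of_real (\<theta> ^ n) *\<^sub>C P \<theta> \<xi>))"
    using Suc \<Theta>0_eq[OF linear_combination_in_K[OF Suc.prems]] by simp
  also have "\<dots> = (\<Sum>\<theta>\<in>\<Theta>'. complex_of_real (\<theta> ^ Suc n) *\<^sub>C P \<theta> \<xi>)"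
    using Suc.prems by (intro sum.cong) (auto simp: P_linear_combination scaleC_scaleC)
  finally show ?case .
qed

lemma op_cos_\<Theta>0: "\<xi> \<in> K \<Longrightarrow> op_cos \<Theta>0 \<xi> = (\<Sum>\<theta>\<in>\<Theta>'. complex_of_real (cos \<theta>) *\<^sub>C P \<theta> \<xi>)"
proof -
  assume \<xi>: "\<xi> \<in> K"
  have "(\<lambda>n. \<Sum>\<theta>\<in>\<Theta>'. (cos_coeff n * \<theta> ^ n) *\<^sub>R P \<theta> \<xi>) sums (\<Sum>\<theta>\<in>\<Theta>'. cos \<theta> *\<^sub>R P \<theta> \<xi>)"
  proof (intro sums_sum sums_scaleR_left)
    fix \<theta> :: real
    show "(\<lambda>n. cos_coeff n * \<theta> ^ n) sums cos \<theta>" using cos_converges[of \<theta>] by simp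
  qed
  moreover have "cos_coeff n *\<^sub>R (\<Theta>0 ^^ n) \<xi> = (\<Sum>\<theta>\<in>\<Theta>'. (cos_coeff n * \<theta> ^ n) *\<^sub>R P \<theta> \<xi>)" for n
    unfolding \<Theta>0_iterate[OF \<xi>] scaleC_of_real scaleR_sum_right scaleR_scaleR ..
  ultimately show ?thesis unfolding op_cos_def scaleC_of_real by (simp add: sums_iff)
qed

lemma X_K: "\<xi> \<in> K \<Longrightarrow> X \<xi> = (\<Sum>\<theta>\<in>\<Theta>'. complex_of_real ((cos \<theta>)\<^sup>2) *\<^sub>C P \<theta> \<xi>)"
proof -
  assume \<xi>: "\<xi> \<in> K"
  have "X \<xi> = (\<Sum>\<theta>\<in>\<Theta>'. X (P \<theta> \<xi>))"
    by (subst K_decomposition[OF \<xi>, symmetric]) (simp add: U.T_sum)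
  also have "\<dots> = (\<Sum>\<theta>\<in>\<Theta>'. complex_of_real ((cos \<theta>)\<^sup>2) *\<^sub>C P \<theta> \<xi>)"
    using P_in_E[OF \<xi>] unfolding scaleC_of_real by (intro sum.cong) (auto simp: E_def)
  finally show ?thesis .
qed

lemma op_cos_sq_\<Theta>0: "\<xi> \<in> K \<Longrightarrow> op_cos \<Theta>0 (op_cos \<Theta>0 \<xi>) = p (q (p \<xi>))"
proof -
  assume \<xi>: "\<xi> \<in> K"
  have "op_cos \<Theta>0 (op_cos \<Theta>0 \<xi>) = (\<Sum>\<theta>\<in>\<Theta>'. complex_of_real ((cos \<theta>)\<^sup>2) *\<^sub>C P \<theta> \<xi>)"
    unfolding op_cos_\<Theta>0[OF \<xi>] op_cos_\<Theta>0[OF linear_combination_in_K[OF \<xi>]]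
    by (intro sum.cong) (auto simp: P_linear_combination \<xi> scaleC_scaleC power2_eq_square)
  also have "\<dots> = X \<xi>" by (rule X_K[OF \<xi>, symmetric])
  also have "\<dots> = p (q (p \<xi>))" using \<xi> by (simp add: X_def p_id K_def)
  finally show ?thesis .
qed

text \<open>Away from the angles the resolvent is the combination of the same spectral projections
  with coefficients \<open>1 / (\<theta> - z)\<close>.\<close>

lemma spectrum_\<Theta>0: "spectrum_on K \<Theta>0 \<subseteq> complex_of_real ` \<Theta>'"
proof
  fix z assume z: "z \<in> spectrum_on K \<Theta>0"
  show "z \<in> complex_of_real ` \<Theta>'"
  proof (rule ccontr)
    assume nz: "z \<notin> complex_of_real ` \<Theta>'"
    define R where "R = (\<lambda>\<xi>. \<Sum>\<theta>\<in>\<Theta>'. (1 / (of_real \<theta> - z)) *\<^sub>C P \<theta> \<xi>)"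
    have sub: "\<Theta>0 \<xi> - z *\<^sub>C \<xi> = (\<Sum>\<theta>\<in>\<Theta>'. (of_real \<theta> - z) *\<^sub>C P \<theta> \<xi>)" if "\<xi> \<in> K" for \<xi>
    proof -
      have "z *\<^sub>C \<xi> = (\<Sum>\<theta>\<in>\<Theta>'. z *\<^sub>C P \<theta> \<xi>)"
        using K_decomposition[OF that] by (simp flip: scaleC_sum_right)
      thus ?thesis by (simp add: \<Theta>0_eq that scaleC_diff_left sum_subtractf)
    qed
    have "R (\<Theta>0 \<xi> - z *\<^sub>C \<xi>) = \<xi>" if \<xi>: "\<xi> \<in> K" for \<xi>
    proof -
      have "R (\<Theta>0 \<xi> - z *\<^sub>C \<xi>) = (\<Sum>\<theta>\<in>\<Theta>'. P \<theta> \<xi>)"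
        unfolding sub[OF \<xi>] R_def using nz by (intro sum.cong) (auto simp: P_linear_combination \<xi> scaleC_scaleC)
      thus ?thesis using K_decomposition[OF \<xi>] by simp
    qed
    moreover have "\<Theta>0 (R \<xi>) - z *\<^sub>C R \<xi> = \<xi>" if \<xi>: "\<xi> \<in> K" for \<xi>
    proof -
      have R: "R \<xi> \<in> K" unfolding R_def by (rule linear_combination_in_K[OF \<xi>])
      have "\<Theta>0 (R \<xi>) - z *\<^sub>C R \<xi> = (\<Sum>\<theta>\<in>\<Theta>'. P \<theta> \<xi>)"
        unfolding sub[OF R] unfolding R_def
        using nz by (intro sum.cong) (auto simp: P_linear_combination \<xi> scaleC_scaleC)
      thus ?thesis using K_decomposition[OF \<xi>] by simp
    qed
    moreover have "bounded_operator_on K R" unfolding R_def by (rule bounded_operator_on_combination)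
    ultimately show False using z unfolding spectrum_on_def by blast
  qed
qed

lemma cinner_\<Theta>0: "\<xi> \<in> K \<Longrightarrow> cinner (\<Theta>0 \<xi>) \<xi> \<in> \<real>\<^sub>\<ge>\<^sub>0"
proof -
  assume \<xi>: "\<xi> \<in> K"
  have PP: "cinner (P \<theta> \<xi>) \<xi> = of_real ((norm (P \<theta> \<xi>))\<^sup>2)" if \<theta>: "\<theta> \<in> \<Theta>'" for \<theta>
  proof -
    have "cinner (P \<theta> \<xi>) \<xi> = (\<Sum>\<theta>'\<in>\<Theta>'. cinner (P \<theta> \<xi>) (P \<theta>' \<xi>))"
      using K_decomposition[OF \<xi>] by (simp flip: cinner_sum_right)
    also have "\<dots> = (\<Sum>\<theta>'\<in>\<Theta>'. if \<theta>' = \<theta> then cinner (P \<theta> \<xi>) (P \<theta> \<xi>) else 0)"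
      using \<theta> P_in_E[OF \<xi>] by (intro sum.cong) (auto intro!: E_orthogonal[of _ \<theta>])
    also have "\<dots> = of_real ((norm (P \<theta> \<xi>))\<^sup>2)" using \<theta> fin by (simp add: cinner_self)
    finally show ?thesis .
  qed
  have "cinner (\<Theta>0 \<xi>) \<xi> = (\<Sum>\<theta>\<in>\<Theta>'. complex_of_real \<theta> * cinner (P \<theta> \<xi>) \<xi>)"
    unfolding \<Theta>0_eq[OF \<xi>] by (simp add: cinner_sum_left cinner_scaleC_left)
  also have "\<dots> = of_real (\<Sum>\<theta>\<in>\<Theta>'. \<theta> * (norm (P \<theta> \<xi>))\<^sup>2)" by (simp add: PP)
  also have "\<dots> \<in> \<real>\<^sub>\<ge>\<^sub>0" by (simp only: nonneg_Reals_of_real_iff) (auto intro: sum_nonneg)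
  finally show ?thesis .
qed

lemma is_angle_operator_\<Theta>0: "is_angle_operator p q \<Theta>0"
  unfolding is_angle_operator_def Let_def p_generic_part
proof (intro conjI ballI)
  have "bounded_operator_on K (\<lambda>\<xi>. \<Sum>\<theta>\<in>\<Theta>'. complex_of_real \<theta> *\<^sub>C P \<theta> \<xi>)"
    by (rule bounded_operator_on_combination)
  thus "bounded_operator_on K \<Theta>0"
    unfolding bounded_operator_on_def
    by (auto simp: \<Theta>0_eq csubspace_add[OF K_csubspace] csubspace_scaleC[OF K_csubspace])
  show "spectrum_on K \<Theta>0 \<subseteq> complex_of_real ` {0..pi / 2}" using spectrum_\<Theta>0 by force
qed (auto intro: cinner_\<Theta>0 op_cos_sq_\<Theta>0 simp: \<Theta>0_def[THEN arg_cong[of _ _ "\<lambda>f. f \<in> extensional K"]])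

text \<open>Positivity makes the competing operator symmetric; \<open>eigenvector_of_cos_sq\<close>
  then fixes its value on every spectral component, and on \<open>K\<close> these components sum to
  the vector.\<close>

lemma angle_operator_unique:
  assumes "is_angle_operator p q \<Theta>"
  shows "\<Theta> = \<Theta>0"
proof (rule extensionalityI[of _ K])
  have \<Theta>: "\<Theta> \<in> extensional K" "bounded_operator_on K \<Theta>" "\<And>\<xi>. \<xi> \<in> K \<Longrightarrow> cinner (\<Theta> \<xi>) \<xi> \<in> \<real>\<^sub>\<ge>\<^sub>0"
      "spectrum_on K \<Theta> \<subseteq> complex_of_real ` {0..pi / 2}"
      "\<And>\<xi>. \<xi> \<in> K \<Longrightarrow> op_cos \<Theta> (op_cos \<Theta> \<xi>) = p (q (p \<xi>))"
    using assms unfolding is_angle_operator_def Let_def p_generic_part by auto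
  show "\<Theta> \<in> extensional K" by (rule \<Theta>(1))
  show "\<Theta>0 \<in> extensional K" by (simp add: \<Theta>0_def)
  interpret B: bounded_op K \<Theta> by standard (rule K_csubspace, rule \<Theta>(2))
  interpret B: symmetric_op K \<Theta>
    by standard (rule B.real_form_imp_symmetric, use \<Theta>(3) in \<open>auto intro: nonneg_Reals_subset_Reals[THEN subsetD]\<close>)
  fix \<xi> assume \<xi>: "\<xi> \<in> K"
  have *: "\<Theta> (P \<theta> \<xi>) = \<theta> *\<^sub>R P \<theta> \<xi>" if \<theta>: "\<theta> \<in> \<Theta>'" for \<theta>
  proof (rule B.eigenvector_of_cos_sq[OF K_closed \<Theta>(4)])
    show "P \<theta> \<xi> \<in> K" by (rule P_K[OF \<xi> \<theta>])
    hence "op_cos \<Theta> (op_cos \<Theta> (P \<theta> \<xi>)) = X (P \<theta> \<xi>)" by (simp add: \<Theta>(5) X_def p_id K_def)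
    also have "\<dots> = (cos \<theta>)\<^sup>2 *\<^sub>R P \<theta> \<xi>" using P_in_E[OF \<xi>, of \<theta>] \<theta> by (simp add: E_def)
    finally show "op_cos \<Theta> (op_cos \<Theta> (P \<theta> \<xi>)) = (cos \<theta>)\<^sup>2 *\<^sub>R P \<theta> \<xi>" .
  qed (use \<theta> in auto)
  have "\<Theta> \<xi> = \<Theta> (\<Sum>\<theta>\<in>\<Theta>'. P \<theta> \<xi>)" using K_decomposition[OF \<xi>] by simp
  also have "\<dots> = (\<Sum>\<theta>\<in>\<Theta>'. \<Theta> (P \<theta> \<xi>))" by (rule B.T_sum) (rule P_K[OF \<xi>])
  also have "\<dots> = \<Theta>0 \<xi>" using * by (simp add: \<Theta>0_eq[OF \<xi>] scaleC_of_real)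
  finally show "\<Theta> \<xi> = \<Theta>0 \<xi>" .
qed

lemma angle_operator_eq: "angle_operator p q = \<Theta>0"
  unfolding angle_operator_def using is_angle_operator_\<Theta>0 angle_operator_unique by (rule the_equality)

text \<open>If they commuted, \<open>w\<close> would be an eigenvector of the idempotent
  \<open>q\<close> with eigenvalue \<open>cos^2 \<theta>\<close>, which is neither 0 nor 1.\<close>

lemma not_commute:
  assumes "\<theta> \<in> \<Theta>'" "w \<in> E \<theta>" "w \<noteq> 0"
  shows "p \<circ> q \<noteq> q \<circ> p"
proof
  assume "p \<circ> q = q \<circ> p"
  hence "p (q w) = q (p w)" by (rule comp_eq_dest)
  hence qw: "q w = (cos \<theta>)\<^sup>2 *\<^sub>R w" using assms(2) p_id[of w] by (auto simp: E_def X_def)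
  have "w \<noteq> 0" "(cos \<theta>)\<^sup>2 \<noteq> 0" "(cos \<theta>)\<^sup>2 \<noteq> 1"
    using assms inj_onD[OF inj_on_cos_sq, of \<theta> 0] inj_onD[OF inj_on_cos_sq, of \<theta> "pi/2"] by auto
  moreover have "q (q w) = q w" using q_id q_in by blast
  hence "(cos \<theta>)\<^sup>2 *\<^sub>R (cos \<theta>)\<^sup>2 *\<^sub>R w = (cos \<theta>)\<^sup>2 *\<^sub>R w"
    using qw linear_scale[OF bounded_linear.linear[OF bounded_linear_proj[OF S']]] by metis
  hence "((cos \<theta>)\<^sup>2 * ((cos \<theta>)\<^sup>2 - 1)) *\<^sub>R w = 0" by (simp add: algebra_simps)
  ultimately show False by simp
qed

theorem Ang_proj_trivial: "\<Theta>s \<subseteq> {0, pi/2} \<Longrightarrow> Ang_proj p q = {pi / 2}"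
  using commute_if_trivial by (simp add: Ang_proj_def)

theorem Ang_proj_eq:
  assumes "\<Theta>' \<noteq> {}" and eig: "\<And>\<theta>. \<theta> \<in> \<Theta>' \<Longrightarrow> \<exists>w\<in>S. w \<noteq> 0 \<and> p (q w) = (cos \<theta>)\<^sup>2 *\<^sub>R w"
  shows "Ang_proj p q = \<Theta>'"
proof -
  have nz: "\<exists>w\<in>E \<theta>. w \<noteq> 0" if "\<theta> \<in> \<Theta>'" for \<theta> using eig[OF that] by (auto simp: E_def X_def)
  hence "p \<circ> q \<noteq> q \<circ> p" using assms(1) not_commute by blast
  moreover have "complex_of_real \<theta> \<in> spectrum_on K \<Theta>0" if \<theta>: "\<theta> \<in> \<Theta>'" for \<theta>
  proof -
    obtain w where w: "w \<in> E \<theta>" "w \<noteq> 0" using nz[OF \<theta>] by blast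
    hence wK: "w \<in> K" using E_subset_K[OF \<theta>] by blast
    have "\<Theta>0 w = (\<Sum>\<theta>'\<in>\<Theta>'. if \<theta>' = \<theta> then complex_of_real \<theta> *\<^sub>C w else 0)"
      unfolding \<Theta>0_eq[OF wK] using w \<theta> by (intro sum.cong) (auto simp: P_E)
    hence T: "\<Theta>0 w - complex_of_real \<theta> *\<^sub>C w = 0" using \<theta> fin by simp
    \<comment> \<open>An inverse of \<open>\<Theta>0 - \<theta>\<close> would have to send 0, the
      image of \<open>w\<close>, back to \<open>w\<close>.\<close>
    have "R 0 \<noteq> w" if "bounded_operator_on K R" for R
      using bounded_op.T_zero[of K R] that w(2) K_csubspace by (auto simp: bounded_op_def)
    thus ?thesis using T wK unfolding spectrum_on_def by force
  qed
  ultimately show ?thesis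
    using spectrum_\<Theta>0 by (auto simp: Ang_proj_def p_generic_part angle_operator_eq)
qed

end

section \<open>Matrix units of the tower\<close>

definition words :: "nat \<Rightarrow> 'a list set" where
  "words N = {v. length v = N}"

lemma finite_words [simp]: "finite (words N :: 'a::finite list set)"
  using finite_lists_length_eq[of "UNIV :: 'a set" N] by (simp add: words_def)

lemma words_0 [simp]: "words 0 = {[]}"
  by (auto simp: words_def)

lemma in_words [simp]: "v \<in> words N \<longleftrightarrow> length v = N"
  by (simp add: words_def)

lemma words_Suc: "words (Suc N) = (\<lambda>(c, v). c # v) ` (UNIV \<times> words N)"
  by (auto simp: words_def length_Suc_conv)

lemma sum_words_Suc:
  fixes f :: "'a::finite list \<Rightarrow> 'b::comm_monoid_add"
  shows "(\<Sum>v\<in>words (Suc N). f v) = (\<Sum>c\<in>UNIV. \<Sum>v\<in>words N. f (c # v))"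
  unfolding words_Suc by (subst sum.reindex) (auto simp: inj_on_def sum.cartesian_product case_prod_unfold)

lemma length_word [simp]: "length (word N r) = N"
  by (simp add: word_def)

lemma word_Suc: "word (Suc N) r = r N # word N r"
  by (simp add: word_def)

lemma bij_betw_word: "bij_betw (word N) {s. \<forall>i\<ge>N. r i = s i} (words N)"
\<comment> \<open>\<open>word\<close> lists the positions from \<open>N - 1\<close> down to 0, hence
  the reversed index; beyond \<open>N\<close> the sequence must keep the tail of
  \<open>r\<close>.\<close>
proof (rule bij_betwI[where g = "\<lambda>v i. if i < N then v ! (N - 1 - i) else r i"])
  show "word N \<in> {s. \<forall>i\<ge>N. r i = s i} \<rightarrow> words N" by (simp add: words_def)
  show "(\<lambda>v i. if i < N then v ! (N - 1 - i) else r i) \<in> words N \<rightarrow> {s. \<forall>i\<ge>N. r i = s i}" by auto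
next
  fix s assume s: "s \<in> {s. \<forall>i\<ge>N. r i = s i}"
  show "(\<lambda>i. if i < N then word N s ! (N - 1 - i) else r i) = s"
    using s by (auto simp: word_def rev_nth fun_eq_iff)
next
  fix v :: "4 list" assume v: "v \<in> words N"
  show "word N (\<lambda>i. if i < N then v ! (N - 1 - i) else r i) = v"
    using v by (intro nth_equalityI) (auto simp: word_def rev_nth)
qed

lemma amplify_cong:
  assumes "\<And>v w. length v = N \<Longrightarrow> length w = N \<Longrightarrow> x v w = y v w"
  shows "amplify N x = amplify N y"
  using assms by (auto simp: amplify_def fun_eq_iff)

lemma amplify_Suc:
  "amplify N x = amplify (Suc N) (\<lambda>v w. if hd v = hd w then x (tl v) (tl w) else 0)"
proof -
  have "(\<forall>i\<ge>N. r i = s i) \<longleftrightarrow> r N = s N \<and> (\<forall>i\<ge>Suc N. r i = s i)" for r s :: "nat \<Rightarrow> 4"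
    by (metis Suc_leD Suc_leI le_neq_implies_less order_refl)
  thus ?thesis unfolding amplify_def by (auto simp: fun_eq_iff word_Suc)
qed

lemma amplify_raise: "N \<le> M \<Longrightarrow> \<exists>y. amplify N x = amplify M y"
proof (induction rule: dec_induct)
  case (step M)
  then obtain y where "amplify N x = amplify M y" by blast
  also note amplify_Suc[of M y]
  finally show ?case by blast
qed auto

lemma amplify_in_tower_union: "amplify N x \<in> tower_union"
proof -
  obtain y where "amplify N x = amplify (N + 1) y" using amplify_raise[of N "N + 1" x] by auto
  also have "\<dots> \<in> tower (2 * N)" by (auto simp: tower_def)
  finally show ?thesis unfolding tower_union_def by blast
qed

lemma tower_union_cases: "x \<in> tower_union \<Longrightarrow> \<exists>N y. x = amplify N y"
  unfolding tower_union_def tower_def by (auto split: if_splits)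

lemma tower_union_cases2:
  assumes "x \<in> tower_union" "y \<in> tower_union"
  obtains N x' y' where "x = amplify N x'" "y = amplify N y'"
proof -
  obtain N M x' y' where "x = amplify N x'" "y = amplify M y'" using assms tower_union_cases by metis
  moreover obtain x'' y'' where "amplify N x' = amplify (max N M) x''" "amplify M y' = amplify (max N M) y''"
    using amplify_raise[of N "max N M" x'] amplify_raise[of M "max N M" y'] by auto
  ultimately show ?thesis using that by simp
qed

lemma im_add_amplify: "im_add (amplify N x) (amplify N y) = amplify N (\<lambda>v w. x v w + y v w)"
  by (auto simp: im_add_def amplify_def fun_eq_iff)

lemma im_scale_amplify: "im_scale c (amplify N x) = amplify N (\<lambda>v w. c * x v w)"
  by (auto simp: im_scale_def amplify_def fun_eq_iff)

lemma im_adj_amplify: "im_adj (amplify N x) = amplify N (\<lambda>v w. cnj (x w v))"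
  by (auto simp: im_adj_def amplify_def fun_eq_iff)

lemma im_one_amplify: "im_one = amplify 0 (\<lambda>v w. 1)"
  by (auto simp: im_one_def amplify_def fun_eq_iff)

lemma im_mult_amplify:
  "im_mult (amplify N x) (amplify N y) = amplify N (\<lambda>v w. \<Sum>u\<in>words N. x v u * y u w)"
proof (intro ext)
  fix r t :: "nat \<Rightarrow> 4"
  let ?A = "{s. \<forall>i\<ge>N. r i = s i}"
  \<comment> \<open>A row \<open>r\<close> can be nonzero only at sequences with the tail of
    \<open>r\<close>, one for each word; this makes the sum in \<open>im_mult\<close> a sum over
    words.\<close>
  have A: "finite ?A" using bij_betw_finite[OF bij_betw_word[of N r]] by simp
  have "im_mult (amplify N x) (amplify N y) r t = (\<Sum>s\<in>?A. amplify N x r s * amplify N y s t)"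
    unfolding im_mult_def by (intro sum.mono_neutral_left A) (auto simp: amplify_def split: if_splits)
  also have "\<dots> = (\<Sum>s\<in>?A. if \<forall>i\<ge>N. r i = t i then x (word N r) (word N s) * y (word N s) (word N t) else 0)"
    by (intro sum.cong) (auto simp: amplify_def)
  also have "\<dots> = (\<Sum>u\<in>words N. if \<forall>i\<ge>N. r i = t i then x (word N r) u * y u (word N t) else 0)"
    by (rule sum.reindex_bij_betw[OF bij_betw_word])
  also have "\<dots> = amplify N (\<lambda>v w. \<Sum>u\<in>words N. x v u * y u w) r t"
    by (auto simp: amplify_def intro!: sum.neutral)
  finally show "im_mult (amplify N x) (amplify N y) r t = \<dots>" .
qed

text \<open>A basis of \<open>\<complex>\<^sup>4\<close> indexed by pairs of bits. Write the index \<open>1 + x + 2 y\<close> as a pair of bits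
  \<open>(x, y)\<close>; the basis keeps \<open>x\<close> and replaces \<open>y\<close> by the dual bit \<open>n\<close>. In this basis the matrices
  relevant below are monomial.\<close>

type_synonym site = "bool \<times> bool"

definition bit_x :: "4 \<Rightarrow> bool" where "bit_x i \<longleftrightarrow> i = 2 \<or> i = 4"
definition bit_y :: "4 \<Rightarrow> bool" where "bit_y i \<longleftrightarrow> i = 3 \<or> i = 4"

definition h :: "site \<Rightarrow> 4 \<Rightarrow> complex" where
  "h c i = (if bit_x i = fst c then (if snd c \<and> bit_y i then -1 else 1) / sqrt 2 else 0)"

lemma bits [simp]: "\<not> bit_x 1" "bit_x 2" "\<not> bit_x 3" "bit_x 4" "\<not> bit_y 1" "\<not> bit_y 2" "bit_y 3" "bit_y 4"
  by (simp_all add: bit_x_def bit_y_def del: one_neq_zero)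

lemma cnj_h [simp]: "cnj (h c i) = h c i"
  by (simp add: h_def)

lemma sqrt_2_mult [simp]: "complex_of_real (sqrt 2) * complex_of_real (sqrt 2) = 2"
  by (simp flip: of_real_mult)

lemma UNIV_site: "(UNIV :: site set) = {(False, False), (False, True), (True, False), (True, True)}"
  by (auto simp: UNIV_bool)

lemma h_orthonormal: "(\<Sum>i\<in>UNIV. h c i * h d i) = (if c = d then 1 else 0)"
  by (cases c; cases d; cases "fst c"; cases "snd c"; cases "fst d"; cases "snd d") (auto simp: sum_4 h_def)

lemma h_complete: "(\<Sum>c\<in>UNIV. h c i * h c j) = (if i = j then 1 else 0)"
  using exhaust_4[of i] exhaust_4[of j] by (auto simp: UNIV_site h_def)

definition h_word :: "site list \<Rightarrow> 4 list \<Rightarrow> complex" where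
  "h_word v r = prod_list (map2 h v r)"

lemma h_word_simps [simp]: "h_word [] r = 1" "h_word (c # v) (i # r) = h c i * h_word v r"
  by (simp_all add: h_word_def)

lemma cnj_h_word [simp]: "length v = length r \<Longrightarrow> cnj (h_word v r) = h_word v r"
  by (induction v r rule: list_induct2) auto

lemma h_word_orthonormal:
  "length v = N \<Longrightarrow> length w = N \<Longrightarrow> (\<Sum>r\<in>words N. h_word v r * h_word w r) = (if v = w then 1 else 0)"
proof (induction N arbitrary: v w)
  case (Suc N)
  then obtain c v' d w' where vw: "v = c # v'" "w = d # w'" "length v' = N" "length w' = N"
    by (metis length_Suc_conv)
  have "(\<Sum>r\<in>words (Suc N). h_word v r * h_word w r)
      = (\<Sum>i\<in>UNIV. h c i * h d i) * (\<Sum>r\<in>words N. h_word v' r * h_word w' r)"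
    unfolding sum_words_Suc vw by (simp add: sum_product mult_ac)
  thus ?case using Suc.IH vw by (simp add: h_orthonormal)
qed auto

lemma h_word_complete:
  "length r = N \<Longrightarrow> length s = N \<Longrightarrow> (\<Sum>v\<in>words N. h_word v r * h_word v s) = (if r = s then 1 else 0)"
proof (induction N arbitrary: r s)
  case (Suc N)
  then obtain i r' j s' where rs: "r = i # r'" "s = j # s'" "length r' = N" "length s' = N"
    by (metis length_Suc_conv)
  have "(\<Sum>v\<in>words (Suc N). h_word v r * h_word v s)
      = (\<Sum>c\<in>UNIV. h c i * h c j) * (\<Sum>v\<in>words N. h_word v r' * h_word v s')"
    unfolding sum_words_Suc rs by (simp add: sum_product mult_ac)
  thus ?case using Suc.IH rs by (simp add: h_complete)
qed auto

section \<open>Change of basis and matrix units in the GNS representation\<close>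

definition coeff_h :: "nat \<Rightarrow> (4 list \<Rightarrow> 4 list \<Rightarrow> complex) \<Rightarrow> site list \<Rightarrow> site list \<Rightarrow> complex" where
  "coeff_h N x v w = (\<Sum>r\<in>words N. \<Sum>s\<in>words N. h_word v r * x r s * h_word w s)"

lemma coeff_h_expansion:
  assumes "length r = N" "length s = N"
  shows "x r s = (\<Sum>v\<in>words N. \<Sum>w\<in>words N. coeff_h N x v w * (h_word v r * h_word w s))"
proof -
  have "(\<Sum>v\<in>words N. \<Sum>w\<in>words N. coeff_h N x v w * (h_word v r * h_word w s))
      = (\<Sum>v\<in>words N. \<Sum>w\<in>words N. \<Sum>r'\<in>words N. \<Sum>s'\<in>words N.
          x r' s' * (h_word v r' * h_word v r) * (h_word w s' * h_word w s))"
    unfolding coeff_h_def sum_distrib_right by (intro sum.cong refl) (simp add: mult_ac)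
  also have "\<dots> = (\<Sum>v\<in>words N. \<Sum>r'\<in>words N. \<Sum>s'\<in>words N. \<Sum>w\<in>words N.
          x r' s' * (h_word v r' * h_word v r) * (h_word w s' * h_word w s))"
    by (intro sum.cong refl, rule trans[OF sum.swap], intro sum.cong refl, rule sum.swap)
  also have "\<dots> = (\<Sum>r'\<in>words N. \<Sum>s'\<in>words N. \<Sum>v\<in>words N. \<Sum>w\<in>words N.
          x r' s' * (h_word v r' * h_word v r) * (h_word w s' * h_word w s))"
    by (rule trans[OF sum.swap], intro sum.cong refl, rule sum.swap)
  also have "\<dots> = (\<Sum>r'\<in>words N. \<Sum>s'\<in>words N. x r' s' *
      (\<Sum>v\<in>words N. h_word v r' * h_word v r) * (\<Sum>w\<in>words N. h_word w s' * h_word w s))"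
    by (simp add: sum_distrib_left sum_distrib_right mult_ac)
  also have "\<dots> = (\<Sum>r'\<in>words N. \<Sum>s'\<in>words N. if r' = r then if s' = s then x r s else 0 else 0)"
    using assms by (intro sum.cong refl) (auto simp: h_word_complete)
  also have "\<dots> = (\<Sum>r'\<in>words N. if r' = r then x r s else 0)"
    using assms by (intro sum.cong refl) auto
  also have "\<dots> = x r s" using assms by simp
  finally show ?thesis ..
qed

locale gns =
  fixes \<pi> :: "inf_mat \<Rightarrow> 'h::complex_hilbert_space \<Rightarrow> 'h" and \<Omega> :: 'h
  assumes gns: "is_gns \<pi> \<Omega>"
begin

definition A where "A N x = \<pi> (amplify N x)"

lemma A_clinear: "bounded_clinear (A N x)"
  using gns amplify_in_tower_union by (auto simp: is_gns_def A_def)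

lemma A_add: "A N (\<lambda>v w. x v w + y v w) \<xi> = A N x \<xi> + A N y \<xi>"
proof -
  have "\<pi> (im_add (amplify N x) (amplify N y)) = (\<lambda>\<xi>. \<pi> (amplify N x) \<xi> + \<pi> (amplify N y) \<xi>)"
    using gns amplify_in_tower_union unfolding is_gns_def by blast
  thus ?thesis by (simp add: A_def im_add_amplify)
qed

lemma A_scale: "A N (\<lambda>v w. c * x v w) \<xi> = c *\<^sub>C A N x \<xi>"
proof -
  have "\<pi> (im_scale c (amplify N x)) = (\<lambda>\<xi>. c *\<^sub>C \<pi> (amplify N x) \<xi>)"
    using gns amplify_in_tower_union unfolding is_gns_def by blast
  thus ?thesis by (simp add: A_def im_scale_amplify)
qed

lemma A_zero: "A N (\<lambda>v w. 0) \<xi> = 0"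
  using A_scale[of N 0 "\<lambda>v w. 0" \<xi>] by simp

lemma A_sum: "A N (\<lambda>v w. \<Sum>i\<in>I. f i v w) \<xi> = (\<Sum>i\<in>I. A N (f i) \<xi>)"
  by (induction I rule: infinite_finite_induct) (auto simp: A_zero A_add)

lemma A_mult: "A N x (A N y \<xi>) = A N (\<lambda>v w. \<Sum>u\<in>words N. x v u * y u w) \<xi>"
proof -
  have "\<pi> (im_mult (amplify N x) (amplify N y)) = \<pi> (amplify N x) \<circ> \<pi> (amplify N y)"
    using gns amplify_in_tower_union unfolding is_gns_def by blast
  thus ?thesis by (simp add: A_def im_mult_amplify)
qed

lemma A_adjoint: "is_adjoint (A N x) (A N (\<lambda>v w. cnj (x w v)))"
proof -
  have "is_adjoint (\<pi> (amplify N x)) (\<pi> (im_adj (amplify N x)))"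
    using gns amplify_in_tower_union unfolding is_gns_def by blast
  thus ?thesis by (simp add: A_def im_adj_amplify)
qed

lemma A_one: "A 0 (\<lambda>v w. 1) = id"
  using gns unfolding is_gns_def A_def im_one_amplify by blast

lemma A_trace: "cinner (A N x \<Omega>) \<Omega> = (\<Sum>w\<in>words N. x w w) / 4 ^ N"
  using gns unfolding is_gns_def A_def words_def by blast

lemma A_cong: "(\<And>v w. length v = N \<Longrightarrow> length w = N \<Longrightarrow> x v w = y v w) \<Longrightarrow> A N x = A N y"
  unfolding A_def by (metis amplify_cong)

text \<open>Represents the matrix unit of the basis vectors \<open>v\<close> and \<open>w\<close>.
  The basis is real, so no conjugate appears.\<close>

definition mu :: "site list \<Rightarrow> site list \<Rightarrow> 'h \<Rightarrow> 'h" where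
  "mu v w = A (length v) (\<lambda>r s. h_word v r * h_word w s)"

lemma mu_clinear: "bounded_clinear (mu v w)"
  by (simp add: mu_def A_clinear)

lemma mu_Nil: "mu [] [] = id"
  by (simp add: mu_def A_one)

text \<open>The identity on the factor added on the left is resolved by the completeness of
  \<open>h\<close>.\<close>

lemma mu_raise:
  assumes "length w = length v"
  shows "mu v w \<xi> = (\<Sum>c\<in>UNIV. mu (c # v) (c # w) \<xi>)"
proof -
  let ?N = "length v"
  have "mu v w = A (Suc ?N) (\<lambda>r s. if hd r = hd s then h_word v (tl r) * h_word w (tl s) else 0)"
    unfolding mu_def A_def amplify_Suc[of ?N] ..
  also have "\<dots> = A (Suc ?N) (\<lambda>r s. \<Sum>c\<in>UNIV. h_word (c # v) r * h_word (c # w) s)"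
  proof (rule A_cong)
    fix r s :: "4 list" assume "length r = Suc ?N" "length s = Suc ?N"
    then obtain i r' j s' where rs: "r = i # r'" "s = j # s'" by (metis length_Suc_conv)
    have "(\<Sum>c\<in>UNIV. h_word (c # v) r * h_word (c # w) s) = (\<Sum>c\<in>UNIV. h c i * h c j) * (h_word v r' * h_word w s')"
      unfolding rs sum_distrib_right by (simp add: mult_ac)
    thus "(if hd r = hd s then h_word v (tl r) * h_word w (tl s) else 0)
        = (\<Sum>c\<in>UNIV. h_word (c # v) r * h_word (c # w) s)"
      by (simp add: rs h_complete)
  qed
  finally show ?thesis by (simp add: A_sum mu_def)
qed

lemma mu_mult:
  assumes "length v = N" "length w = N" "length v' = N" "length w' = N"
  shows "mu v w (mu v' w' \<xi>) = (if w = v' then mu v w' \<xi> else 0)"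
proof -
  have "mu v w (mu v' w' \<xi>)
      = A N (\<lambda>r s. \<Sum>u\<in>words N. h_word v r * h_word w u * (h_word v' u * h_word w' s)) \<xi>"
    using assms by (simp add: mu_def A_mult)
  also have "(\<lambda>r s. \<Sum>u\<in>words N. h_word v r * h_word w u * (h_word v' u * h_word w' s))
      = (\<lambda>r s. (\<Sum>u\<in>words N. h_word w u * h_word v' u) * (h_word v r * h_word w' s))"
    unfolding sum_distrib_right by (simp add: mult_ac)
  also have "\<dots> = (\<lambda>r s. (if w = v' then 1 else 0) * (h_word v r * h_word w' s))"
    using assms by (simp add: h_word_orthonormal)
  finally show ?thesis using assms by (auto simp: A_scale A_zero mu_def)
qed

lemma mu_adjoint:
  assumes "length v = length w"
  shows "is_adjoint (mu v w) (mu w v)"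
proof -
  have "A (length v) (\<lambda>r s. cnj (h_word v s * h_word w r)) = mu w v"
    unfolding mu_def assms using assms by (intro A_cong) (auto simp: mult.commute)
  thus ?thesis using A_adjoint[of "length v" "\<lambda>r s. h_word v r * h_word w s"] by (simp add: mu_def)
qed

lemma cinner_mu:
  assumes "length v = N" "length w = N" "length v' = N" "length w' = N"
  shows "cinner (mu v w \<Omega>) (mu v' w' \<Omega>) = (if v = v' \<and> w = w' then 1 / 4 ^ N else 0)"
proof -
  have "cinner (mu v w \<Omega>) (mu v' w' \<Omega>) = cinner (mu w' v' (mu v w \<Omega>)) \<Omega>"
    using mu_adjoint[of w' v'] assms by (simp add: is_adjoint_def)
  also have "\<dots> = (if v = v' then cinner (mu w' w \<Omega>) \<Omega> else 0)"
    using assms by (auto simp: mu_mult)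
  also have "cinner (mu w' w \<Omega>) \<Omega> = (if w = w' then 1 / 4 ^ N else 0)"
    using assms by (simp add: mu_def A_trace h_word_orthonormal mult.commute)
  finally show ?thesis by auto
qed

lemma A_expand: "A N x \<xi> = (\<Sum>v\<in>words N. \<Sum>w\<in>words N. coeff_h N x v w *\<^sub>C mu v w \<xi>)"
proof -
  have "A N x = A N (\<lambda>r s. \<Sum>v\<in>words N. \<Sum>w\<in>words N. coeff_h N x v w * (h_word v r * h_word w s))"
    by (intro A_cong coeff_h_expansion)
  hence "A N x \<xi> = A N (\<lambda>r s. \<Sum>v\<in>words N. \<Sum>w\<in>words N. coeff_h N x v w * (h_word v r * h_word w s)) \<xi>"
    by simp
  also have "\<dots> = (\<Sum>v\<in>words N. \<Sum>w\<in>words N. coeff_h N x v w *\<^sub>C mu v w \<xi>)"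
    unfolding A_sum A_scale by (intro sum.cong) (auto simp: mu_def)
  finally show ?thesis .
qed

lemma \<pi>_image_star_algebra: "star_algebra (\<pi> ` tower_union)"
  unfolding star_algebra_def
proof (intro conjI ballI allI)
  show "id \<in> \<pi> ` tower_union" using A_one amplify_in_tower_union unfolding A_def by (metis imageI)
next
  fix S T assume "S \<in> \<pi> ` tower_union" "T \<in> \<pi> ` tower_union"
  then obtain N x y where ST: "S = A N x" "T = A N y" by (auto simp: A_def elim: tower_union_cases2)
  have "(\<lambda>\<xi>. S \<xi> + T \<xi>) = A N (\<lambda>v w. x v w + y v w)"
    "S \<circ> T = A N (\<lambda>v w. \<Sum>u\<in>words N. x v u * y u w)"
    by (auto simp: ST A_add A_mult)
  thus "(\<lambda>\<xi>. S \<xi> + T \<xi>) \<in> \<pi> ` tower_union" "S \<circ> T \<in> \<pi> ` tower_union"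
    by (auto simp: A_def amplify_in_tower_union)
next
  fix T assume "T \<in> \<pi> ` tower_union"
  then obtain N x where T: "T = A N x" by (auto simp: A_def dest: tower_union_cases)
  show "bounded_clinear T" unfolding T by (rule A_clinear)
  show "\<exists>S\<in>\<pi> ` tower_union. is_adjoint T S"
    using A_adjoint[of N x] amplify_in_tower_union unfolding T A_def by blast
  show "(\<lambda>\<xi>. c *\<^sub>C T \<xi>) \<in> \<pi> ` tower_union" for c
  proof -
    have "(\<lambda>\<xi>. c *\<^sub>C T \<xi>) = A N (\<lambda>v w. c * x v w)" by (simp add: T A_scale fun_eq_iff)
    thus ?thesis by (auto simp: A_def amplify_in_tower_union)
  qed
qed

end

subsection \<open>Tensor products of matrices\<close>

text \<open>A matrix entry after the change to the basis \<open>h\<close>.\<close>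

definition bracket :: "mat4 \<Rightarrow> site \<Rightarrow> site \<Rightarrow> complex" where
  "bracket x c d = (\<Sum>i\<in>UNIV. \<Sum>j\<in>UNIV. h c i * x $ i $ j * h d j)"

definition tensor_entry :: "mat4 list \<Rightarrow> 4 list \<Rightarrow> 4 list \<Rightarrow> complex" where
  "tensor_entry xs v w = (\<Prod>i<length xs. xs ! i $ (v ! i) $ (w ! i))"

lemma tensor_eq: "tensor xs = amplify (length xs) (tensor_entry xs)"
  by (simp add: tensor_def tensor_entry_def[abs_def])

lemma tensor_entry_Nil [simp]: "tensor_entry [] v w = 1"
  by (simp add: tensor_entry_def)

lemma tensor_entry_Cons [simp]:
  "tensor_entry (x # xs) (i # v) (j # w) = x $ i $ j * tensor_entry xs v w"
  unfolding tensor_entry_def by (simp add: prod.lessThan_Suc_shift del: prod.lessThan_Suc)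

lemma coeff_h_tensor_Nil: "coeff_h 0 (tensor_entry []) [] [] = 1"
  by (simp add: coeff_h_def)

lemma coeff_h_tensor_Cons:
  "coeff_h (Suc N) (tensor_entry (x # xs)) (c # v) (d # w) = bracket x c d * coeff_h N (tensor_entry xs) v w"
proof -
  have "coeff_h (Suc N) (tensor_entry (x # xs)) (c # v) (d # w)
      = (\<Sum>i\<in>UNIV. \<Sum>r\<in>words N. \<Sum>j\<in>UNIV. \<Sum>s\<in>words N.
          (h c i * x $ i $ j * h d j) * (h_word v r * tensor_entry xs r s * h_word w s))"
    unfolding coeff_h_def sum_words_Suc by (simp add: mult_ac)
  also have "\<dots> = (\<Sum>i\<in>UNIV. \<Sum>j\<in>UNIV. \<Sum>r\<in>words N. \<Sum>s\<in>words N.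
          (h c i * x $ i $ j * h d j) * (h_word v r * tensor_entry xs r s * h_word w s))"
    by (intro sum.cong refl) (rule sum.swap)
  also have "\<dots> = bracket x c d * coeff_h N (tensor_entry xs) v w"
    unfolding bracket_def coeff_h_def sum_distrib_right
    unfolding sum_distrib_left by (simp add: mult_ac)
  finally show ?thesis .
qed

lemma bracket_one: "bracket (mat 1) c d = (if c = d then 1 else 0)"
proof -
  have "bracket (mat 1) c d = (\<Sum>i\<in>UNIV. h c i * h d i)"
    unfolding bracket_def mat_def by (simp add: if_distrib[of "\<lambda>x. _ * x"] if_distrib[of "\<lambda>x. x * _"] cong: if_cong)
  thus ?thesis by (simp add: h_orthonormal)
qed

lemma coeff_h_ones:
  "length v = k \<Longrightarrow> length w = k \<Longrightarrow>
    coeff_h k (tensor_entry (replicate k (mat 1))) v w = (if v = w then 1 else 0)"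
proof (induction k arbitrary: v w)
  case (Suc k)
  thus ?case by (cases v; cases w) (auto simp: coeff_h_tensor_Cons bracket_one)
qed (simp add: coeff_h_tensor_Nil)

lemma J_nth: "J $ i $ j = 1 / 4"
proof -
  have "(\<Sum>a\<in>UNIV. \<Sum>b\<in>UNIV. E a b) $ i $ j = (\<Sum>a\<in>UNIV. \<Sum>b\<in>UNIV. if i = a \<and> j = b then 1 else 0)"
    by (simp add: E_def)
  also have "\<dots> = (\<Sum>a\<in>UNIV. if i = a then 1 else 0)" by (intro sum.cong refl) auto
  also have "\<dots> = 1" by simp
  finally show ?thesis by (simp only: J_def vector_scaleR_component) (simp add: scaleR_conv_of_real)
qed

lemma bracket_J: "bracket J c d = (if snd c \<or> snd d then 0 else 1 / 2)"
proof -
  have "bracket J c d = (\<Sum>i\<in>UNIV. h c i) * (\<Sum>j\<in>UNIV. h d j) / 4"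
    unfolding bracket_def sum_product J_nth by (simp add: sum_divide_distrib)
  moreover have "(\<Sum>i\<in>UNIV. h c i) = (if snd c then 0 else sqrt 2)" for c
  proof -
    have "2 / complex_of_real (sqrt 2) = sqrt 2" by (simp add: divide_eq_eq)
    thus ?thesis by (cases c; cases "fst c"; cases "snd c") (auto simp: sum_4 h_def)
  qed
  ultimately show ?thesis by (cases "snd c"; cases "snd d") auto
qed

lemma bracket_E: "bracket (E i i) c d = h c i * h d i"
  using exhaust_4[of i] by (auto simp: bracket_def E_def sum_4)

context gns
begin

lemma \<pi>_one_site: "\<pi> (tensor [x]) \<xi> = (\<Sum>c\<in>UNIV. \<Sum>d\<in>UNIV. bracket x c d *\<^sub>C mu [c] [d] \<xi>)"
proof -
  have "\<pi> (tensor [x]) = A (Suc 0) (tensor_entry [x])" by (simp add: tensor_eq A_def)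
  thus ?thesis
    by (simp only: A_expand sum_words_Suc coeff_h_tensor_Cons) (simp add: coeff_h_tensor_Nil)
qed

lemma \<pi>_jones_even:
  "\<pi> (jones (2 * k)) \<xi> = (\<Sum>c\<in>UNIV. \<Sum>d\<in>UNIV. \<Sum>\<gamma>\<in>words k. bracket J c d *\<^sub>C mu (c # \<gamma>) (d # \<gamma>) \<xi>)"
proof -
  have "\<pi> (jones (2 * k)) = A (Suc k) (tensor_entry (J # replicate k (mat 1)))"
    by (simp add: jones_def Let_def tensor_eq A_def)
  hence "\<pi> (jones (2 * k)) \<xi> = A (Suc k) (tensor_entry (J # replicate k (mat 1))) \<xi>" by simp
  also have "\<dots> = (\<Sum>c\<in>UNIV. \<Sum>v\<in>words k. \<Sum>d\<in>UNIV. \<Sum>w\<in>words k.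
      (if v = w then bracket J c d *\<^sub>C mu (c # v) (d # v) \<xi> else 0))"
    unfolding A_expand sum_words_Suc coeff_h_tensor_Cons
    by (intro sum.cong refl) (auto simp: coeff_h_ones)
  also have "\<dots> = (\<Sum>c\<in>UNIV. \<Sum>v\<in>words k. \<Sum>d\<in>UNIV. bracket J c d *\<^sub>C mu (c # v) (d # v) \<xi>)"
    by (intro sum.cong refl) simp
  also have "\<dots> = (\<Sum>c\<in>UNIV. \<Sum>d\<in>UNIV. \<Sum>\<gamma>\<in>words k. bracket J c d *\<^sub>C mu (c # \<gamma>) (d # \<gamma>) \<xi>)"
    by (intro sum.cong refl) (rule sum.swap)
  finally show ?thesis .
qed

lemma \<pi>_jones_odd:
  assumes "j = 2 * k + 1"
  shows "\<pi> (jones j) \<xi> = (\<Sum>c\<in>UNIV. \<Sum>c'\<in>UNIV. \<Sum>d\<in>UNIV. \<Sum>d'\<in>UNIV. \<Sum>\<gamma>\<in>words k.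
    (\<Sum>i\<in>UNIV. h c i * h d i * (h c' i * h d' i)) *\<^sub>C mu (c # c' # \<gamma>) (d # d' # \<gamma>) \<xi>)"
proof -
  have "jones j = amplify (Suc (Suc k)) (\<lambda>v w. \<Sum>i\<in>UNIV. tensor_entry (E i i # E i i # replicate k (mat 1)) v w)"
    using assms by (auto simp: jones_def Let_def tensor_eq amplify_def fun_eq_iff intro!: sum.neutral)
  hence "\<pi> (jones j) \<xi> = (\<Sum>i\<in>UNIV. A (Suc (Suc k)) (tensor_entry (E i i # E i i # replicate k (mat 1))) \<xi>)"
    by (simp add: A_sum flip: A_def)
  also have "\<dots> = (\<Sum>i\<in>UNIV. \<Sum>c\<in>UNIV. \<Sum>c'\<in>UNIV. \<Sum>v\<in>words k. \<Sum>d\<in>UNIV. \<Sum>d'\<in>UNIV. \<Sum>w\<in>words k.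
      (if v = w then (h c i * h d i * (h c' i * h d' i)) *\<^sub>C mu (c # c' # v) (d # d' # v) \<xi> else 0))"
    unfolding A_expand sum_words_Suc coeff_h_tensor_Cons
    by (intro sum.cong refl) (auto simp: coeff_h_ones bracket_E)
  also have "\<dots> = (\<Sum>i\<in>UNIV. \<Sum>c\<in>UNIV. \<Sum>c'\<in>UNIV. \<Sum>v\<in>words k. \<Sum>d\<in>UNIV. \<Sum>d'\<in>UNIV.
      (h c i * h d i * (h c' i * h d' i)) *\<^sub>C mu (c # c' # v) (d # d' # v) \<xi>)"
    by (intro sum.cong refl) simp
  also have "\<dots> = (\<Sum>i\<in>UNIV. \<Sum>c\<in>UNIV. \<Sum>c'\<in>UNIV. \<Sum>d\<in>UNIV. \<Sum>d'\<in>UNIV. \<Sum>v\<in>words k.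
      (h c i * h d i * (h c' i * h d' i)) *\<^sub>C mu (c # c' # v) (d # d' # v) \<xi>)"
    by (intro sum.cong refl, rule trans[OF sum.swap], intro sum.cong refl, rule sum.swap)
  also have "\<dots> = (\<Sum>c\<in>UNIV. \<Sum>c'\<in>UNIV. \<Sum>d\<in>UNIV. \<Sum>d'\<in>UNIV. \<Sum>v\<in>words k. \<Sum>i\<in>UNIV.
      (h c i * h d i * (h c' i * h d' i)) *\<^sub>C mu (c # c' # v) (d # d' # v) \<xi>)"
    by (rule trans[OF sum.swap], intro sum.cong refl, rule trans[OF sum.swap], intro sum.cong refl,
        rule trans[OF sum.swap], intro sum.cong refl, rule trans[OF sum.swap], intro sum.cong refl, rule sum.swap)
  finally show ?thesis unfolding scaleC_sum_left .
qed

end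

section \<open>Matrix units of the spin model subfactors\<close>

text \<open>In \<open>shift\<close> this supplies the dual bit of the factor to the right before the
  permutation; the value for the empty word leaves the rightmost dual bit unchanged.\<close>

fun head_n :: "site list \<Rightarrow> bool" where
  "head_n [] = False"
| "head_n (c # v) = snd c"

text \<open>The unitary conjugating \<open>1 \<otimes> M\<^sub>4\<^bsup>\<otimes>N\<^esup>\<close> onto the \<open>N\<close>-th algebra of the tower of the spin model
  subfactor is a product of operators each acting on two adjacent tensor factors. In the basis \<open>h\<close> it is
  monomial: it permutes the words by \<open>shift False\<close>, with phases \<open>phase z False\<close>, and only
  the phases depend on \<open>z\<close>. The Boolean argument is the bit \<open>x\<close> of the tensor factor to the left,
  after the permutation.\<close>

fun shift :: "bool \<Rightarrow> site list \<Rightarrow> site list" where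
  "shift s [] = []"
| "shift s (c # v) = (fst c \<noteq> s, snd c \<noteq> head_n v) # shift (fst c \<noteq> s) v"

fun phase :: "complex \<Rightarrow> bool \<Rightarrow> site list \<Rightarrow> complex" where
  "phase z s [] = 1"
| "phase z s (c # v) = (if fst c \<and> s \<and> snd c then - (cnj z)\<^sup>2 else 1) * phase z (fst c \<noteq> s) v"

lemma length_shift [simp]: "length (shift s v) = length v"
  by (induction v arbitrary: s) auto

text \<open>The bits \<open>x\<close> are recovered from the left, each one determining the carried
  bit for the next; after that the dual bits are recovered from the right.\<close>

lemma inj_shift: "shift s v = shift s w \<Longrightarrow> v = w"
proof (induction v arbitrary: s w)
  case Nil
  thus ?case by (cases w) auto
next
  case (Cons c v)
  then obtain d w' where w: "w = d # w'" by (cases w) auto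
  hence "fst c = fst d" using Cons.prems by auto
  hence "v = w'" using Cons.prems Cons.IH w by auto
  thus ?case using Cons.prems w \<open>fst c = fst d\<close> by (auto simp: prod_eq_iff)
qed

lemma shift_eq_iff [simp]: "shift s v = shift s w \<longleftrightarrow> v = w"
  using inj_shift by blast

lemma bij_betw_shift: "bij_betw (shift s) (words N) (words N)"
  unfolding bij_betw_def
proof
  show inj: "inj_on (shift s) (words N)" by (simp add: inj_on_def)
  show "shift s ` words N = words N" by (rule endo_inj_surj[OF finite_words _ inj]) auto
qed

lemma sum_shift: "(\<Sum>v\<in>words N. f (shift s v)) = (\<Sum>v\<in>words N. f v)"
  by (rule sum.reindex_bij_betw[OF bij_betw_shift])

lemma norm_phase: "cmod z = 1 \<Longrightarrow> cmod (phase z s v) = 1"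
  by (induction v arbitrary: s) (auto simp: norm_mult norm_power)

lemma unit_cnj_mult: "cmod z = 1 \<Longrightarrow> z * cnj z = 1"
  using complex_norm_square[of z] by simp

lemma phase_cnj: "cmod z = 1 \<Longrightarrow> phase z s v * cnj (phase z s v) = 1"
  by (simp add: unit_cnj_mult norm_phase)

lemma sum_site: "(\<Sum>c\<in>(UNIV::site set). f c) = (\<Sum>x\<in>UNIV. \<Sum>n\<in>UNIV. f (x, n))"
  unfolding UNIV_Times_UNIV[symmetric] by (simp add: sum.cartesian_product)

lemma sum_bool: "(\<Sum>x\<in>(UNIV::bool set). f x) = f False + f True"
  by (simp add: UNIV_bool)

text \<open>The normalized inner product of \<open>W z \<alpha> \<beta> \<Omega>\<close> and
  \<open>W w \<alpha> \<beta> \<Omega>\<close>, see \<open>cinner_W_same_length\<close>;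
  \<open>s\<close> is the bit \<open>x\<close> of the additional factor over which the trace
  averages.\<close>

definition corr :: "complex \<Rightarrow> complex \<Rightarrow> site list \<Rightarrow> site list \<Rightarrow> complex" where
  "corr z w \<alpha> \<beta> = (1 / 2) * (\<Sum>s\<in>UNIV. phase z s \<alpha> * cnj (phase z s \<beta>) * cnj (phase w s \<alpha> * cnj (phase w s \<beta>)))"

text \<open>The common letter contributes unit factors that cancel against their conjugates, and it
  replaces \<open>s\<close> by \<open>fst c \<noteq> s\<close>, which at most exchanges the two
  summands.\<close>

lemma corr_Cons:
  assumes "cmod z = 1" "cmod w = 1"
  shows "corr z w (c # \<alpha>) (c # \<beta>) = corr z w \<alpha> \<beta>"
proof -
  define t where "t z s = (if fst c \<and> s \<and> snd c then - (cnj z)\<^sup>2 else (1::complex))" for z s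
  have t: "t z s * cnj (t z s) = 1" if "cmod z = 1" for z s
    using that by (intro unit_cnj_mult) (auto simp: t_def norm_power)
  have eq: "phase z s (c # \<alpha>) * cnj (phase z s (c # \<beta>)) * cnj (phase w s (c # \<alpha>) * cnj (phase w s (c # \<beta>)))
      = (t z s * cnj (t z s)) * (t w s * cnj (t w s)) *
        (phase z (fst c \<noteq> s) \<alpha> * cnj (phase z (fst c \<noteq> s) \<beta>) * cnj (phase w (fst c \<noteq> s) \<alpha> * cnj (phase w (fst c \<noteq> s) \<beta>)))" for s
    by (simp only: phase.simps t_def[symmetric] complex_cnj_mult complex_cnj_cnj mult_ac)
  show ?thesis unfolding corr_def sum_bool eq t[OF assms(1)] t[OF assms(2)]
    by (cases "fst c") (simp_all add: add.commute)
qed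

lemma corr_self: "cmod z = 1 \<Longrightarrow> corr z z \<alpha> \<beta> = 1"
proof -
  assume z: "cmod z = 1"
  have "cmod (phase z s \<alpha> * cnj (phase z s \<beta>)) = 1" for s using norm_phase[OF z] by (simp add: norm_mult)
  thus ?thesis unfolding corr_def sum_bool by (simp only: unit_cnj_mult) simp
qed

lemma corr_swap: "corr w z \<alpha> \<beta> = cnj (corr z w \<alpha> \<beta>)"
  by (simp add: corr_def sum_bool mult_ac)

context gns
begin

text \<open>The matrix unit conjugated by the monomial unitary with permutation
  \<open>shift False\<close> and phases \<open>phase z False\<close>.\<close>

definition rot :: "complex \<Rightarrow> site list \<Rightarrow> site list \<Rightarrow> 'h \<Rightarrow> 'h" where
  "rot z v w \<xi> = (phase z False v * cnj (phase z False w)) *\<^sub>C mu (shift False v) (shift False w) \<xi>"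

lemma mu_zero [simp]: "mu v w 0 = 0"
  by (rule bounded_clinear_zero[OF mu_clinear])

lemma mu_scaleC: "mu v w (c *\<^sub>C \<xi>) = c *\<^sub>C mu v w \<xi>"
  by (rule bounded_clinear_scaleC[OF mu_clinear])

lemma rot_mult:
  assumes "cmod z = 1" "length v = N" "length w = N" "length v' = N" "length w' = N"
  shows "rot z v w (rot z v' w' \<xi>) = (if w = v' then rot z v w' \<xi> else 0)"
proof (cases "w = v'")
  case True
  have "phase z False v * cnj (phase z False v') * (phase z False v' * cnj (phase z False w'))
      = phase z False v * cnj (phase z False w') * (phase z False v' * cnj (phase z False v'))"
    by (simp only: mult_ac)
  also have "\<dots> = phase z False v * cnj (phase z False w')" using phase_cnj[OF assms(1)] by simp
  finally have ph: "phase z False v * cnj (phase z False v') * (phase z False v' * cnj (phase z False w'))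
      = phase z False v * cnj (phase z False w')" .
  show ?thesis using True assms by (simp only: rot_def mu_scaleC mu_mult[of _ N] scaleC_scaleC length_shift ph simp_thms if_True)
qed (use assms in \<open>simp add: rot_def mu_scaleC mu_mult[of _ N]\<close>)

lemma rot_clinear: "bounded_clinear (rot z v w)"
  using bounded_clinear_mult[OF mu_clinear] by (simp add: rot_def[abs_def])

text \<open>The summed letter is the identity on one more factor on the left. It is needed because
  the unitary acts on that factor too, so units for words of length \<open>N\<close> live in the
  tensor power \<open>N + 1\<close>.\<close>

definition W :: "complex \<Rightarrow> site list \<Rightarrow> site list \<Rightarrow> 'h \<Rightarrow> 'h" where
  "W z \<alpha> \<beta> \<xi> = (\<Sum>c\<in>UNIV. rot z (c # \<alpha>) (c # \<beta>) \<xi>)"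

lemma W_clinear: "bounded_clinear (W z \<alpha> \<beta>)"
proof -
  have "bounded_clinear (\<lambda>\<xi>. \<Sum>c\<in>C. rot z (c # \<alpha>) (c # \<beta>) \<xi>)" for C
    by (induction C rule: infinite_finite_induct)
      (auto intro: bounded_clinear_plus rot_clinear bounded_clinearI[where K = 0])
  thus ?thesis by (simp add: W_def[abs_def])
qed

lemmas W_add = bounded_clinear_add[OF W_clinear]
  and W_scaleC = bounded_clinear_scaleC[OF W_clinear]
  and W_zero [simp] = bounded_clinear_zero[OF W_clinear]
  and W_sum = bounded_clinear_sum[OF W_clinear]

lemma W_mult:
  assumes "cmod z = 1" "length \<alpha> = N" "length \<beta> = N" "length \<alpha>' = N" "length \<beta>' = N"
  shows "W z \<alpha> \<beta> (W z \<alpha>' \<beta>' \<xi>) = (if \<beta> = \<alpha>' then W z \<alpha> \<beta>' \<xi> else 0)"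
proof -
  have "W z \<alpha> \<beta> (W z \<alpha>' \<beta>' \<xi>) = (\<Sum>c\<in>UNIV. \<Sum>d\<in>UNIV. rot z (c # \<alpha>) (c # \<beta>) (rot z (d # \<alpha>') (d # \<beta>') \<xi>))"
    unfolding W_def by (simp add: bounded_clinear_sum[OF rot_clinear])
  also have "\<dots> = (\<Sum>c\<in>UNIV. \<Sum>d\<in>UNIV. if c = d then if \<beta> = \<alpha>' then rot z (c # \<alpha>) (c # \<beta>') \<xi> else 0 else 0)"
    using assms by (intro sum.cong refl) (auto simp: rot_mult[of z _ "Suc N"])
  also have "\<dots> = (if \<beta> = \<alpha>' then W z \<alpha> \<beta>' \<xi> else 0)" by (simp add: W_def)
  finally show ?thesis .
qed

text \<open>The longer unitary is the shorter one preceded by a unitary on the two leftmost factors,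
  which commutes with the unit being conjugated. In coordinates, the phases of the common letter
  cancel and \<open>fst c \<noteq> fst d\<close> takes the place of \<open>fst c\<close>.\<close>

lemma W_raise:
  assumes z: "cmod z = 1" and "length \<alpha> = length \<beta>"
  shows "W z \<alpha> \<beta> \<xi> = (\<Sum>c\<in>UNIV. W z (c # \<alpha>) (c # \<beta>) \<xi>)"
proof -
  define p where "p x = phase z x \<alpha> * cnj (phase z x \<beta>)" for x
  have ph: "phase z False (d # c # \<alpha>) * cnj (phase z False (d # c # \<beta>)) = p (fst c \<noteq> fst d)" for c d
    using z phase_cnj[OF z, of "fst d" "[c]"] by (auto simp: p_def mult_ac)
  have rot2: "rot z (d # c # \<alpha>) (d # c # \<beta>) \<xi> = p (fst c \<noteq> fst d) *\<^sub>C
      mu ((fst d, snd d \<noteq> snd c) # (fst c \<noteq> fst d, snd c \<noteq> head_n \<alpha>) # shift (fst c \<noteq> fst d) \<alpha>)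
         ((fst d, snd d \<noteq> snd c) # (fst c \<noteq> fst d, snd c \<noteq> head_n \<beta>) # shift (fst c \<noteq> fst d) \<beta>) \<xi>" for c d
    unfolding rot_def ph by simp
  have rot1: "rot z (c # \<alpha>) (c # \<beta>) \<xi> = (\<Sum>d\<in>UNIV. p (fst c) *\<^sub>C
      mu (d # (fst c, snd c \<noteq> head_n \<alpha>) # shift (fst c) \<alpha>) (d # (fst c, snd c \<noteq> head_n \<beta>) # shift (fst c) \<beta>) \<xi>)" for c
    unfolding rot_def using assms(2) by (simp add: p_def scaleC_sum_right) (subst mu_raise, auto simp: scaleC_sum_right)
  show ?thesis unfolding W_def rot1 rot2 sum_site sum_bool by (simp add: add_ac)
qed

lemma cinner_W_same_length:
  assumes "length \<alpha> = N" "length \<beta> = N" "length \<gamma> = N" "length \<delta> = N"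
  shows "cinner (W z \<alpha> \<beta> \<Omega>) (W w \<gamma> \<delta> \<Omega>) = (if \<alpha> = \<gamma> \<and> \<beta> = \<delta> then corr z w \<alpha> \<beta> / 4 ^ N else 0)"
proof -
  have "cinner (W z \<alpha> \<beta> \<Omega>) (W w \<gamma> \<delta> \<Omega>) = (\<Sum>c\<in>UNIV. \<Sum>d\<in>UNIV. cinner (rot z (c # \<alpha>) (c # \<beta>) \<Omega>) (rot w (d # \<gamma>) (d # \<delta>) \<Omega>))"
    unfolding W_def cinner_sum_left by (simp add: cinner_sum_right)
  also have "\<dots> = (\<Sum>c\<in>(UNIV::site set). \<Sum>d\<in>UNIV. if c = d then if \<alpha> = \<gamma> \<and> \<beta> = \<delta> then
      phase z (fst c) \<alpha> * cnj (phase z (fst c) \<beta>) * cnj (phase w (fst c) \<alpha> * cnj (phase w (fst c) \<beta>)) / 4 ^ Suc N else 0 else 0)"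
  proof (intro sum.cong refl)
    fix c d :: site
    have "shift False (c # \<alpha>) = shift False (d # \<gamma>) \<and> shift False (c # \<beta>) = shift False (d # \<delta>)
        \<longleftrightarrow> c = d \<and> \<alpha> = \<gamma> \<and> \<beta> = \<delta>" unfolding shift_eq_iff by auto
    thus "cinner (rot z (c # \<alpha>) (c # \<beta>) \<Omega>) (rot w (d # \<gamma>) (d # \<delta>) \<Omega>) = (if c = d then if \<alpha> = \<gamma> \<and> \<beta> = \<delta> then
      phase z (fst c) \<alpha> * cnj (phase z (fst c) \<beta>) * cnj (phase w (fst c) \<alpha> * cnj (phase w (fst c) \<beta>)) / 4 ^ Suc N else 0 else 0)"
      using assms unfolding rot_def cinner_scaleC_left cinner_scaleC_right
      by (subst cinner_mu[of _ "Suc N"]) (auto simp del: shift.simps)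
  qed
  also have "\<dots> = (if \<alpha> = \<gamma> \<and> \<beta> = \<delta> then corr z w \<alpha> \<beta> / 4 ^ N else 0)"
    by (simp add: sum_site sum_bool corr_def field_simps)
  finally show ?thesis .
qed

text \<open>Raising the shorter words adds a common prefix, which by \<open>corr_Cons\<close> does
  not change the coefficient; so it can be taken out of the sum.\<close>

lemma cinner_W_le:
  assumes z: "cmod z = 1" and w: "cmod w = 1"
    and "length \<beta> = length \<alpha>" "length \<gamma> = j + length \<alpha>" "length \<delta> = j + length \<alpha>"
  shows "cinner (W z \<alpha> \<beta> \<Omega>) (W w \<gamma> \<delta> \<Omega>) = corr z w \<alpha> \<beta> * cinner (W w \<alpha> \<beta> \<Omega>) (W w \<gamma> \<delta> \<Omega>)"
  using assms(3-)
proof (induction j arbitrary: \<alpha> \<beta>)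
  case 0
  hence "length \<gamma> = length \<alpha>" "length \<delta> = length \<alpha>" by simp_all
  note same = cinner_W_same_length[OF refl 0(1) this]
  show ?case unfolding same corr_self[OF w] by simp
next
  case (Suc j)
  have "cinner (W z \<alpha> \<beta> \<Omega>) (W w \<gamma> \<delta> \<Omega>) = (\<Sum>c\<in>UNIV. cinner (W z (c # \<alpha>) (c # \<beta>) \<Omega>) (W w \<gamma> \<delta> \<Omega>))"
    using Suc.prems by (simp add: W_raise[OF z, of \<alpha> \<beta>] cinner_sum_left)
  also have "\<dots> = (\<Sum>c\<in>UNIV. corr z w \<alpha> \<beta> * cinner (W w (c # \<alpha>) (c # \<beta>) \<Omega>) (W w \<gamma> \<delta> \<Omega>))"
    using Suc.prems z w by (intro sum.cong refl) (simp add: Suc.IH corr_Cons)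
  also have "\<dots> = corr z w \<alpha> \<beta> * cinner (W w \<alpha> \<beta> \<Omega>) (W w \<gamma> \<delta> \<Omega>)"
    using Suc.prems by (simp add: W_raise[OF w, of \<alpha> \<beta>] cinner_sum_left sum_distrib_left)
  finally show ?case .
qed

text \<open>Here the words \<gamma> and \<delta> are raised, while the coefficient depends only on
  \<alpha> and \<beta>.\<close>

lemma cinner_W_ge:
  assumes z: "cmod z = 1" and w: "cmod w = 1"
    and "length \<beta> = length \<alpha>" "j + length \<gamma> = length \<alpha>" "length \<delta> = length \<gamma>"
  shows "cinner (W z \<alpha> \<beta> \<Omega>) (W w \<gamma> \<delta> \<Omega>) = corr z w \<alpha> \<beta> * cinner (W w \<alpha> \<beta> \<Omega>) (W w \<gamma> \<delta> \<Omega>)"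
  using assms(3-)
proof (induction j arbitrary: \<gamma> \<delta>)
  case 0
  thus ?case using cinner_W_le[OF z w, of \<beta> \<alpha> \<gamma> 0 \<delta>] by simp
next
  case (Suc j)
  have "cinner (W z \<alpha> \<beta> \<Omega>) (W w \<gamma> \<delta> \<Omega>) = (\<Sum>c\<in>UNIV. cinner (W z \<alpha> \<beta> \<Omega>) (W w (c # \<gamma>) (c # \<delta>) \<Omega>))"
    using Suc.prems by (simp add: W_raise[OF w, of \<gamma> \<delta>] cinner_sum_right)
  also have "\<dots> = (\<Sum>c\<in>UNIV. corr z w \<alpha> \<beta> * cinner (W w \<alpha> \<beta> \<Omega>) (W w (c # \<gamma>) (c # \<delta>) \<Omega>))"
    using Suc.prems by (intro sum.cong refl) (simp add: Suc.IH)
  also have "\<dots> = corr z w \<alpha> \<beta> * cinner (W w \<alpha> \<beta> \<Omega>) (W w \<gamma> \<delta> \<Omega>)"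
    using Suc.prems by (simp add: W_raise[OF w, of \<gamma> \<delta>] cinner_sum_right sum_distrib_left)
  finally show ?case .
qed

section \<open>The closed span of the matrix unit vectors\<close>

definition Wvecs :: "complex \<Rightarrow> 'h set" where
  "Wvecs z = {W z \<alpha> \<beta> \<Omega> | \<alpha> \<beta>. length \<alpha> = length \<beta>}"

definition Wspan :: "complex \<Rightarrow> 'h set" where
  "Wspan z = \<Inter>{V. csubspace V \<and> Wvecs z \<subseteq> V}"

lemma csubspace_Wspan: "csubspace (Wspan z)"
  unfolding Wspan_def csubspace_def by blast

lemma Wvecs_subset: "Wvecs z \<subseteq> Wspan z"
  unfolding Wspan_def by blast

lemma Wspan_minimal: "csubspace V \<Longrightarrow> Wvecs z \<subseteq> V \<Longrightarrow> Wspan z \<subseteq> V"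
  unfolding Wspan_def by blast

definition L2 :: "complex \<Rightarrow> 'h set" where
  "L2 z = closure (Wspan z)"

lemma csubspace_L2: "csubspace (L2 z)" and closed_L2: "closed (L2 z)"
  by (auto simp: L2_def csubspace_closure csubspace_Wspan)

lemma L2_minimal: "csubspace V \<Longrightarrow> closed V \<Longrightarrow> Wvecs z \<subseteq> V \<Longrightarrow> L2 z \<subseteq> V"
  unfolding L2_def by (intro closure_minimal Wspan_minimal)

lemma Wvecs_L2: "Wvecs z \<subseteq> L2 z"
  unfolding L2_def using Wvecs_subset closure_subset by blast

text \<open>The coefficient relating the inner products of
  \<open>W z \<alpha> \<beta> \<Omega>\<close> and \<open>W w \<alpha> \<beta> \<Omega>\<close> with
  \<open>W w \<gamma> \<delta> \<Omega>\<close> does not depend on \<gamma> and \<delta>, whatever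
  their length, so the difference is orthogonal to all of \<open>Wvecs w\<close>.\<close>

lemma proj_L2_W:
  assumes z: "cmod z = 1" and w: "cmod w = 1" and len: "length \<alpha> = length \<beta>"
  shows "proj (L2 w) (W z \<alpha> \<beta> \<Omega>) = corr z w \<alpha> \<beta> *\<^sub>C W w \<alpha> \<beta> \<Omega>"
proof (rule proj_eqI[OF csubspace_L2])
  show "corr z w \<alpha> \<beta> *\<^sub>C W w \<alpha> \<beta> \<Omega> \<in> L2 w"
    using Wvecs_L2 len by (intro csubspace_scaleC[OF csubspace_L2]) (auto simp: Wvecs_def)
  let ?\<zeta> = "W z \<alpha> \<beta> \<Omega> - corr z w \<alpha> \<beta> *\<^sub>C W w \<alpha> \<beta> \<Omega>"
  have "L2 w \<subseteq> {\<eta>. cinner ?\<zeta> \<eta> = 0}"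
  proof (rule L2_minimal)
    show "csubspace {\<eta>. cinner ?\<zeta> \<eta> = 0}" by (auto simp: csubspace_def cinner_add_right cinner_scaleC_right)
    show "closed {\<eta>. cinner ?\<zeta> \<eta> = 0}"
      by (intro closed_Collect_eq continuous_intros bounded_linear.continuous_on[OF bounded_linear_cinner_right])
    show "Wvecs w \<subseteq> {\<eta>. cinner ?\<zeta> \<eta> = 0}"
    proof
      fix \<eta> assume "\<eta> \<in> Wvecs w"
      then obtain \<gamma> \<delta> where \<eta>: "\<eta> = W w \<gamma> \<delta> \<Omega>" "length \<gamma> = length \<delta>" by (auto simp: Wvecs_def)
      have "cinner (W z \<alpha> \<beta> \<Omega>) \<eta> = corr z w \<alpha> \<beta> * cinner (W w \<alpha> \<beta> \<Omega>) \<eta>"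
      proof (cases "length \<alpha> \<le> length \<gamma>")
        case True
        thus ?thesis unfolding \<eta> using len \<eta>(2)
          by (intro cinner_W_le[OF z w, where j = "length \<gamma> - length \<alpha>"]) auto
      next
        case False
        thus ?thesis unfolding \<eta> using len \<eta>(2)
          by (intro cinner_W_ge[OF z w, where j = "length \<alpha> - length \<gamma>"]) auto
      qed
      thus "\<eta> \<in> {\<eta>. cinner ?\<zeta> \<eta> = 0}" by (simp add: cinner_diff_left cinner_scaleC_left)
    qed
  qed
  thus "?\<zeta> \<in> orth_compl (L2 w)" by (auto simp: orth_compl_def)
qed

lemma proj_proj_L2_W:
  assumes "cmod z = 1" "cmod w = 1" "length \<alpha> = length \<beta>"
  shows "proj (L2 z) (proj (L2 w) (W z \<alpha> \<beta> \<Omega>)) = (cmod (corr z w \<alpha> \<beta>))\<^sup>2 *\<^sub>R W z \<alpha> \<beta> \<Omega>"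
proof -
  have "proj (L2 z) (proj (L2 w) (W z \<alpha> \<beta> \<Omega>)) = (corr z w \<alpha> \<beta> * cnj (corr z w \<alpha> \<beta>)) *\<^sub>C W z \<alpha> \<beta> \<Omega>"
    using assms by (simp add: proj_L2_W proj_scaleC[OF csubspace_L2 closed_L2] scaleC_scaleC corr_swap[of w z])
  thus ?thesis by (simp only: complex_norm_square[symmetric] scaleC_of_real)
qed

lemma W_nonzero:
  assumes "cmod z = 1" "length \<alpha> = length \<beta>"
  shows "W z \<alpha> \<beta> \<Omega> \<noteq> 0"
proof -
  note same = cinner_W_same_length[OF refl assms(2)[symmetric] refl assms(2)[symmetric], of z z]
  have "cinner (W z \<alpha> \<beta> \<Omega>) (W z \<alpha> \<beta> \<Omega>) = 1 / 4 ^ length \<alpha>"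
    unfolding same corr_self[OF assms(1)] by simp
  hence "cinner (W z \<alpha> \<beta> \<Omega>) (W z \<alpha> \<beta> \<Omega>) \<noteq> 0" by (simp del: cinner_eq_0_iff)
  thus ?thesis by auto
qed

text \<open>If the lengths differ, the shorter unit is raised until both have the same
  length.\<close>

lemma W_Wspan:
  assumes z: "cmod z = 1" and "length \<gamma> = length \<delta>" "length \<alpha> = length \<beta>"
  shows "W z \<gamma> \<delta> (W z \<alpha> \<beta> \<Omega>) \<in> Wspan z"
proof -
  have vec: "W z \<alpha> \<beta> \<Omega> \<in> Wspan z" if "length \<alpha> = length \<beta>" for \<alpha> \<beta>
    using Wvecs_subset that by (auto simp: Wvecs_def)
  have le: "W z \<gamma> \<delta> (W z \<alpha> \<beta> \<Omega>) \<in> Wspan z"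
    if "length \<gamma> = length \<delta>" "length \<alpha> = length \<beta>" "length \<alpha> = j + length \<gamma>" for j \<gamma> \<delta> \<alpha> \<beta>
    using that
  proof (induction j arbitrary: \<gamma> \<delta>)
    case 0
    hence len: "length \<delta> = length \<gamma>" "length \<alpha> = length \<gamma>" "length \<beta> = length \<gamma>" by simp_all
    show ?case unfolding W_mult[OF z refl len] using vec len csubspace_0[OF csubspace_Wspan] by simp
  next
    case (Suc j)
    thus ?case unfolding W_raise[OF z Suc.prems(1)] by (intro csubspace_sum[OF csubspace_Wspan] Suc.IH) auto
  qed
  have ge: "W z \<gamma> \<delta> (W z \<alpha> \<beta> \<Omega>) \<in> Wspan z"
    if "length \<gamma> = length \<delta>" "length \<alpha> = length \<beta>" "length \<gamma> = j + length \<alpha>" for j \<gamma> \<delta> \<alpha> \<beta>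
    using that
  proof (induction j arbitrary: \<alpha> \<beta>)
    case 0
    thus ?case using le[of \<gamma> \<delta> \<alpha> \<beta> 0] by simp
  next
    case (Suc j)
    thus ?case unfolding W_raise[OF z Suc.prems(2)] W_sum
      by (intro csubspace_sum[OF csubspace_Wspan] Suc.IH) auto
  qed
  show ?thesis
  proof (cases "length \<gamma> \<le> length \<alpha>")
    case True
    thus ?thesis using assms le[of \<gamma> \<delta> \<alpha> \<beta> "length \<alpha> - length \<gamma>"] by simp
  next
    case False
    thus ?thesis using assms ge[of \<gamma> \<delta> \<alpha> \<beta> "length \<gamma> - length \<alpha>"] by simp
  qed
qed

end

subsection \<open>The generators\<close>

text \<open>The off-diagonal entries, in the basis \<open>h\<close>, of the conjugates by
  \<open>u(z)\<close> of the diagonal matrices with diagonals 1, 0, -1, 0 and 0, 1, 0, -1. For unit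
  \<open>z\<close> the values at the two bits \<open>x\<close> are inverse to each other.\<close>

definition flip_coeff :: "complex \<Rightarrow> bool \<Rightarrow> bool \<Rightarrow> complex" where
  "flip_coeff z n x = (if n then if x then - \<i> * cnj z else \<i> * z else 1)"

lemma vector_4:
  "(vector [x, y, z, w] :: 'a::zero^4) $ 1 = x" "(vector [x, y, z, w] :: 'a^4) $ 2 = y"
  "(vector [x, y, z, w] :: 'a^4) $ 3 = z" "(vector [x, y, z, w] :: 'a^4) $ 4 = w"
  unfolding vector_def by simp_all

lemma hadamard_u_nth:
  "hadamard_u z $ 1 $ 1 = 1 / 2" "hadamard_u z $ 1 $ 2 = 1 / 2"
  "hadamard_u z $ 1 $ 3 = 1 / 2" "hadamard_u z $ 1 $ 4 = 1 / 2"
  "hadamard_u z $ 2 $ 1 = 1 / 2" "hadamard_u z $ 2 $ 2 = \<i> * z / 2"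
  "hadamard_u z $ 2 $ 3 = -1 / 2" "hadamard_u z $ 2 $ 4 = - (\<i> * z) / 2"
  "hadamard_u z $ 3 $ 1 = 1 / 2" "hadamard_u z $ 3 $ 2 = -1 / 2"
  "hadamard_u z $ 3 $ 3 = 1 / 2" "hadamard_u z $ 3 $ 4 = -1 / 2"
  "hadamard_u z $ 4 $ 1 = 1 / 2" "hadamard_u z $ 4 $ 2 = - (\<i> * z) / 2"
  "hadamard_u z $ 4 $ 3 = -1 / 2" "hadamard_u z $ 4 $ 4 = \<i> * z / 2"
  unfolding hadamard_u_def vector_scaleR_component vector_4 by (simp_all add: scaleR_conv_of_real)

text \<open>Columns 1 and 3 of \<open>u(z)\<close> have only components with dual bit False, columns
  2 and 4 only with dual bit True. So the conjugated diagonal matrix splits into two blocks, and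
  only the second block involves \<open>z\<close>.\<close>

lemma bracket_hadamard:
  assumes z: "cmod z = 1" and d: "d \<in> diag_mats"
  shows "bracket (hadamard_u z ** d ** adj (hadamard_u z)) (x, n) (x', n') =
    (if n \<noteq> n' then 0 else
     if n then (if x = x' then d $ 2 $ 2 + d $ 4 $ 4 else flip_coeff z n x' * (d $ 2 $ 2 - d $ 4 $ 4)) / 2
     else (if x = x' then d $ 1 $ 1 + d $ 3 $ 3 else d $ 1 $ 1 - d $ 3 $ 3) / 2)"
proof -
  define u where "u = hadamard_u z"
  define \<phi> where "\<phi> j c = (\<Sum>i\<in>UNIV. h c i * u $ i $ j)" for j c
  have d0: "d $ i $ j = 0" if "i \<noteq> j" for i j using d that by (auto simp: diag_mats_def)
  have udu: "(u ** d ** adj u) $ i $ j = (\<Sum>k\<in>UNIV. u $ i $ k * d $ k $ k * cnj (u $ j $ k))" for i j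
  proof -
    have ud: "(u ** d) $ i $ k = u $ i $ k * d $ k $ k" for k
    proof -
      have "(u ** d) $ i $ k = (\<Sum>l\<in>UNIV. if l = k then u $ i $ k * d $ k $ k else 0)"
        unfolding matrix_matrix_mult_def vec_lambda_beta by (intro sum.cong refl) (simp add: d0)
      thus ?thesis by simp
    qed
    show ?thesis unfolding matrix_matrix_mult_def[of "u ** d"] vec_lambda_beta adj_def ud ..
  qed
  have br: "bracket (u ** d ** adj u) c e = (\<Sum>k\<in>UNIV. \<phi> k c * d $ k $ k * cnj (\<phi> k e))" for c e
  proof -
    have "bracket (u ** d ** adj u) c e
        = (\<Sum>i\<in>UNIV. \<Sum>j\<in>UNIV. \<Sum>k\<in>UNIV. h c i * u $ i $ k * d $ k $ k * cnj (h e j * u $ j $ k))"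
      unfolding bracket_def udu sum_distrib_left sum_distrib_right by (simp add: mult_ac)
    also have "\<dots> = (\<Sum>k\<in>UNIV. \<Sum>i\<in>UNIV. \<Sum>j\<in>UNIV. h c i * u $ i $ k * d $ k $ k * cnj (h e j * u $ j $ k))"
      by (rule trans[OF sum.cong[OF refl sum.swap] sum.swap])
    also have "\<dots> = (\<Sum>k\<in>UNIV. \<phi> k c * d $ k $ k * cnj (\<phi> k e))"
      unfolding \<phi>_def sum_distrib_right unfolding cnj_sum sum_distrib_left ..
    finally show ?thesis .
  qed
  have \<phi>1: "\<phi> 1 (x, n) = (if n then 0 else 1 / sqrt 2)" for x n
    by (cases x; cases n) (auto simp: \<phi>_def u_def sum_4 h_def hadamard_u_nth)
  have \<phi>3: "\<phi> 3 (x, n) = (if n then 0 else (if x then -1 else 1) / sqrt 2)" for x n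
    by (cases x; cases n) (auto simp: \<phi>_def u_def sum_4 h_def hadamard_u_nth)
  have \<phi>2: "\<phi> 2 (x, n) = (if n then (if x then \<i> * z else 1) / sqrt 2 else 0)" for x n
    by (cases x; cases n) (auto simp: \<phi>_def u_def sum_4 h_def hadamard_u_nth)
  have \<phi>4: "\<phi> 4 (x, n) = (if n then (if x then - \<i> * z else 1) / sqrt 2 else 0)" for x n
    by (cases x; cases n) (auto simp: \<phi>_def u_def sum_4 h_def hadamard_u_nth)
  have zz: "z * (cnj z * y) = y" for y using unit_cnj_mult[OF z] by (simp flip: mult.assoc)
  show ?thesis unfolding u_def[symmetric] br sum_4 \<phi>1 \<phi>2 \<phi>3 \<phi>4
    by (cases x; cases x'; cases n; cases n') (auto simp: flip_coeff_def field_simps zz)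
qed

text \<open>The nested equalities say that an even number of the four dual bits is set.\<close>

lemma h_product_sum:
  "(\<Sum>i\<in>UNIV. h (x, n) i * h (y, m) i * (h (x', n') i * h (y', m') i)) =
    (if x = y \<and> x = x' \<and> x = y' \<and> (((n = m) = n') = m') then 1 / 2 else 0)"
  by (cases x; cases y; cases x'; cases y'; cases n; cases m; cases n'; cases m')
    (simp_all add: sum_4 h_def)

context gns
begin

lemma W_Nil: "W z [] [] = id"
proof
  fix \<xi>
  have "W z [] [] \<xi> = (\<Sum>c\<in>UNIV. mu [c] [c] \<xi>)" by (simp add: W_def rot_def)
  also have "\<dots> = mu [] [] \<xi>" by (rule mu_raise[symmetric]) simp
  finally show "W z [] [] \<xi> = id \<xi>" by (simp add: mu_Nil)
qed

text \<open>For empty words, \<open>Q\<close> and \<open>F\<close> with both values of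
  \<open>n\<close> span the conjugated diagonal algebra, by \<open>\<pi>_diagonal\<close>. For
  longer words they are the intermediate stage between units of length \<open>N\<close> and
  \<open>N + 1\<close> in \<open>W_in_alg\<close>.\<close>

definition Q :: "complex \<Rightarrow> bool \<Rightarrow> site list \<Rightarrow> site list \<Rightarrow> 'h \<Rightarrow> 'h" where
  "Q z n \<alpha> \<beta> \<xi> = (\<Sum>x\<in>UNIV. W z ((x, n) # \<alpha>) ((x, n) # \<beta>) \<xi>)"

definition F :: "complex \<Rightarrow> bool \<Rightarrow> site list \<Rightarrow> site list \<Rightarrow> 'h \<Rightarrow> 'h" where
  "F z n \<alpha> \<beta> \<xi> = (\<Sum>x\<in>UNIV. flip_coeff z n x *\<^sub>C W z ((\<not> x, n) # \<alpha>) ((x, n) # \<beta>) \<xi>)"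

lemma Q_Nil: "Q z n [] [] \<xi> = (\<Sum>x\<in>UNIV. mu [(x, n)] [(x, n)] \<xi>)" if z: "cmod z = 1"
proof -
  have raise: "mu [(x, n)] [(x, n)] \<xi> = (\<Sum>c\<in>UNIV. mu [c, (x, n)] [c, (x, n)] \<xi>)" for x
    by (rule mu_raise) simp
  have rot: "rot z [d, (x, n)] [d, (x, n)] \<xi> = mu [(fst d, snd d \<noteq> n), (x \<noteq> fst d, n)] [(fst d, snd d \<noteq> n), (x \<noteq> fst d, n)] \<xi>" for d x
    unfolding rot_def phase_cnj[OF z] by simp
  show ?thesis unfolding Q_def W_def raise rot sum_site sum_bool by (cases n) (simp_all add: add_ac)
qed

text \<open>This is where the constant in \<open>phase\<close> comes from:
  \<open>- (cnj z)^2\<close> is the quotient of the two flip coefficients for dual bit True, so the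
  phases turn the coefficient at \<open>x\<close> into the one at \<open>x \<noteq> fst d\<close>.
  Summing over \<open>d\<close> then recombines units of a single factor.\<close>

lemma F_Nil: "F z n [] [] \<xi> = (\<Sum>x\<in>UNIV. flip_coeff z n x *\<^sub>C mu [(\<not> x, n)] [(x, n)] \<xi>)" if z: "cmod z = 1"
proof -
  have zz: "z * (cnj z * y) = y" for y using unit_cnj_mult[OF z] by (simp flip: mult.assoc)
  have raise: "mu [(\<not> x, n)] [(x, n)] \<xi> = (\<Sum>c\<in>UNIV. mu [c, (\<not> x, n)] [c, (x, n)] \<xi>)" for x
    by (rule mu_raise) simp
  have coeff: "flip_coeff z n x * (phase z False [d, (\<not> x, n)] * cnj (phase z False [d, (x, n)])) = flip_coeff z n (x \<noteq> fst d)" for d x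
    by (cases n; cases x; cases "fst d") (auto simp: flip_coeff_def power2_eq_square zz unit_cnj_mult[OF z] mult_ac)
  have rot: "flip_coeff z n x *\<^sub>C rot z [d, (\<not> x, n)] [d, (x, n)] \<xi> = flip_coeff z n (x \<noteq> fst d) *\<^sub>C
      mu [(fst d, snd d \<noteq> n), (\<not> (x \<noteq> fst d), n)] [(fst d, snd d \<noteq> n), (x \<noteq> fst d, n)] \<xi>" for d x
    unfolding rot_def scaleC_scaleC coeff by simp
  show ?thesis unfolding F_def W_def raise scaleC_sum_right rot unfolding sum_site sum_bool
    by (cases n) (simp_all add: add_ac)
qed

lemma \<pi>_diagonal:
  assumes z: "cmod z = 1" and d: "d \<in> diag_mats"
  shows "\<pi> (tensor [hadamard_u z ** d ** adj (hadamard_u z)]) \<xi> =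
    ((d $ 1 $ 1 + d $ 3 $ 3) / 2) *\<^sub>C Q z False [] [] \<xi> + ((d $ 1 $ 1 - d $ 3 $ 3) / 2) *\<^sub>C F z False [] [] \<xi> +
    ((d $ 2 $ 2 + d $ 4 $ 4) / 2) *\<^sub>C Q z True [] [] \<xi> + ((d $ 2 $ 2 - d $ 4 $ 4) / 2) *\<^sub>C F z True [] [] \<xi>"
  unfolding \<pi>_one_site Q_Nil[OF z] F_Nil[OF z] sum_site sum_bool bracket_hadamard[OF z d]
  by (simp add: scaleC_add_right scaleC_diff_right scaleC_scaleC add_ac mult_ac flip_coeff_def)

text \<open>The added letter repeats the dual bit of \<open>hd v\<close>, so \<open>shift\<close>
  makes its dual bit False, where \<open>J\<close> is supported. All phases cancel, and what remains
  depends on \<open>v\<close> only through a permutation of words.\<close>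

lemma \<pi>_jones_even_W:
  assumes z: "cmod z = 1"
  shows "\<pi> (jones (2 * Suc k)) \<xi> = (\<Sum>v\<in>words (Suc k). \<Sum>x\<in>UNIV. (1 / 2) *\<^sub>C
    (W z ((x, snd (hd v)) # v) ((x, snd (hd v)) # v) \<xi> +
     (flip_coeff z (snd (hd v)) x * flip_coeff z (snd (hd v)) (fst (hd v))) *\<^sub>C
       W z ((\<not> x, snd (hd v)) # (\<not> fst (hd v), snd (hd v)) # tl v) ((x, snd (hd v)) # v) \<xi>))"
    (is "_ = (\<Sum>v\<in>_. \<Sum>x\<in>_. ?R v x)")
proof -
  have zz: "z * (cnj z * y) = y" for y using unit_cnj_mult[OF z] by (simp flip: mult.assoc)
  define G where "G a X v = (1 / 2) *\<^sub>C (mu (a # (X, False) # v) (a # (X, False) # v) \<xi>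
      + mu (a # (\<not> X, False) # v) (a # (X, False) # v) \<xi>)" for a X v
  \<comment> \<open>Flipping both bits \<open>x\<close> and \<open>y\<close> leaves the bit carried
    into \<gamma> unchanged; the change of phase at these two letters is undone by the flip
    coefficients.\<close>
  have coeff: "flip_coeff z n x * flip_coeff z n y *
      (phase z False (d # (\<not> x, n) # (\<not> y, n) # \<gamma>) * cnj (phase z False (d # (x, n) # (y, n) # \<gamma>))) = 1" for n x y d \<gamma>
  proof -
    define p where "p s = phase z s \<gamma>" for s
    have p: "p s * (cnj (p s) * r) = r" for s r using phase_cnj[OF z, of s \<gamma>] by (simp add: p_def flip: mult.assoc)
    have p1: "p s * cnj (p s) = 1" for s using phase_cnj[OF z] by (simp add: p_def)
    show ?thesis
      by (cases n; cases x; cases y; cases "fst d")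
        (auto simp: flip_coeff_def power2_eq_square zz p p1 unit_cnj_mult[OF z] mult_ac simp flip: p_def)
  qed
  have R: "?R ((y, n) # \<gamma>) x = (\<Sum>d\<in>UNIV. G (fst d, snd d \<noteq> n) (x \<noteq> fst d) (shift (x \<noteq> fst d) ((y, n) # \<gamma>)))" for x y n \<gamma>
  proof -
    have 1: "rot z (d # (x, n) # (y, n) # \<gamma>) (d # (x, n) # (y, n) # \<gamma>) \<xi> =
        mu ((fst d, snd d \<noteq> n) # (x \<noteq> fst d, False) # shift (x \<noteq> fst d) ((y, n) # \<gamma>))
           ((fst d, snd d \<noteq> n) # (x \<noteq> fst d, False) # shift (x \<noteq> fst d) ((y, n) # \<gamma>)) \<xi>" for d
      unfolding rot_def phase_cnj[OF z] by simp
    have 2: "(flip_coeff z n x * flip_coeff z n y) *\<^sub>C rot z (d # (\<not> x, n) # (\<not> y, n) # \<gamma>) (d # (x, n) # (y, n) # \<gamma>) \<xi> =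
        mu ((fst d, snd d \<noteq> n) # (\<not> (x \<noteq> fst d), False) # shift (x \<noteq> fst d) ((y, n) # \<gamma>))
           ((fst d, snd d \<noteq> n) # (x \<noteq> fst d, False) # shift (x \<noteq> fst d) ((y, n) # \<gamma>)) \<xi>" for d
      unfolding rot_def scaleC_scaleC coeff by (cases y; cases x; cases "fst d") simp_all
    show ?thesis unfolding list.sel fst_conv snd_conv W_def scaleC_sum_right 2 G_def
      by (simp only: 1 sum.distrib scaleC_add_right scaleC_sum_right)
  qed
  have "(\<Sum>x\<in>UNIV. ?R v x) = (\<Sum>d\<in>UNIV. \<Sum>X\<in>UNIV. G d X (shift X v))" if v0: "v \<in> words (Suc k)" for v
  proof -
    obtain y n \<gamma> where v: "v = (y, n) # \<gamma>" using v0 by (cases v) auto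
    show ?thesis unfolding v R sum_site sum_bool by (cases n) (simp_all add: add_ac)
  qed
  hence "(\<Sum>v\<in>words (Suc k). \<Sum>x\<in>UNIV. ?R v x) = (\<Sum>v\<in>words (Suc k). \<Sum>d\<in>UNIV. \<Sum>X\<in>UNIV. G d X (shift X v))"
    by (rule sum.cong[OF refl])
  also have "\<dots> = (\<Sum>d\<in>UNIV. \<Sum>X\<in>UNIV. \<Sum>v\<in>words (Suc k). G d X (shift X v))"
    by (rule trans[OF sum.swap], intro sum.cong refl, rule sum.swap)
  also have "\<dots> = (\<Sum>d\<in>UNIV. \<Sum>X\<in>UNIV. \<Sum>v\<in>words (Suc k). G d X v)"
    by (simp only: sum_shift)
  also have "\<dots> = (\<Sum>X\<in>UNIV. \<Sum>v\<in>words (Suc k). \<Sum>d\<in>UNIV. G d X v)"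
    by (rule trans[OF sum.swap], intro sum.cong refl, rule sum.swap)
  also have "\<dots> = (\<Sum>X\<in>UNIV. \<Sum>v\<in>words (Suc k). (1 / 2) *\<^sub>C (mu ((X, False) # v) ((X, False) # v) \<xi>
      + mu ((\<not> X, False) # v) ((X, False) # v) \<xi>))"
  proof (intro sum.cong refl)
    fix X and v :: "site list"
    have r: "mu ((Y, False) # v) ((X, False) # v) \<xi> = (\<Sum>d\<in>UNIV. mu (d # (Y, False) # v) (d # (X, False) # v) \<xi>)" for Y
      by (rule mu_raise) simp
    show "(\<Sum>d\<in>UNIV. G d X v) = (1 / 2) *\<^sub>C (mu ((X, False) # v) ((X, False) # v) \<xi>
      + mu ((\<not> X, False) # v) ((X, False) # v) \<xi>)"
      unfolding G_def r by (simp add: sum.distrib scaleC_add_right scaleC_sum_right)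
  qed
  also have "\<dots> = \<pi> (jones (2 * Suc k)) \<xi>"
    unfolding \<pi>_jones_even[of "Suc k"] sum_site sum_bool
    by (simp add: bracket_J sum.distrib scaleC_add_right add_ac)
  finally show ?thesis ..
qed

text \<open>A leading bit \<open>x\<close> equal to False makes the two leftmost bits
  \<open>x\<close> agree after \<open>shift\<close>, and summing over \<open>n\<close> and
  \<open>n'\<close> produces exactly the parity condition of \<open>h_product_sum\<close>.\<close>

lemma \<pi>_jones_odd_W:
  assumes z: "cmod z = 1"
  shows "\<pi> (jones (2 * k + 1)) \<xi> = (\<Sum>\<gamma>\<in>words k. \<Sum>n\<in>UNIV. \<Sum>n'\<in>UNIV. (1 / 2) *\<^sub>C
    W z ((False, n) # \<gamma>) ((False, n') # \<gamma>) \<xi>)"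
proof -
  define G where "G x v = (\<Sum>n\<in>UNIV. \<Sum>n'\<in>UNIV. \<Sum>m\<in>UNIV. \<Sum>m'\<in>UNIV. if ((n = m) = n') = m'
      then (1 / 2) *\<^sub>C mu ((x, n) # (x, n') # v) ((x, m) # (x, m') # v) \<xi> else 0)" for x v
  have "(\<Sum>n\<in>UNIV. \<Sum>n'\<in>UNIV. (1 / 2) *\<^sub>C W z ((False, n) # \<gamma>) ((False, n') # \<gamma>) \<xi>) = (\<Sum>x\<in>UNIV. G x (shift x \<gamma>))" for \<gamma>
  proof -
    have "phase z False (d # (False, n) # \<gamma>) * cnj (phase z False (d # (False, n') # \<gamma>)) = 1" for d n n'
      using phase_cnj[OF z, of "fst d" \<gamma>] by (cases "fst d") simp_all
    hence rot: "rot z (d # (False, n) # \<gamma>) (d # (False, n') # \<gamma>) \<xi> =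
        mu ((fst d, snd d \<noteq> n) # (fst d, n \<noteq> head_n \<gamma>) # shift (fst d) \<gamma>)
           ((fst d, snd d \<noteq> n') # (fst d, n' \<noteq> head_n \<gamma>) # shift (fst d) \<gamma>) \<xi>" for d n n'
      unfolding rot_def by simp
    show ?thesis unfolding W_def rot G_def sum_site sum_bool
      by (cases "head_n \<gamma>") (simp_all add: scaleC_add_right add_ac)
  qed
  hence "(\<Sum>\<gamma>\<in>words k. \<Sum>n\<in>UNIV. \<Sum>n'\<in>UNIV. (1 / 2) *\<^sub>C W z ((False, n) # \<gamma>) ((False, n') # \<gamma>) \<xi>)
      = (\<Sum>x\<in>UNIV. \<Sum>\<gamma>\<in>words k. G x (shift x \<gamma>))"
    by (simp only:) (rule sum.swap)
  also have "\<dots> = (\<Sum>x\<in>UNIV. \<Sum>\<gamma>\<in>words k. G x \<gamma>)" by (simp only: sum_shift)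
  also have "\<dots> = \<pi> (jones (2 * k + 1)) \<xi>"
    unfolding \<pi>_jones_odd[OF refl] G_def sum_site sum_bool h_product_sum
    by (simp add: sum.distrib add_ac)
  finally show ?thesis ..
qed

section \<open>Products of the generators with matrix units\<close>

lemma W_mult_raise:
  assumes z: "cmod z = 1" and "length \<alpha> = Suc N" "length \<nu> = N" "length \<mu> = N" "length \<beta> = N"
  shows "W z \<alpha> (c # \<nu>) (W z \<mu> \<beta> \<xi>) = (if \<nu> = \<mu> then W z \<alpha> (c # \<beta>) \<xi> else 0)"
proof -
  have "W z \<alpha> (c # \<nu>) (W z \<mu> \<beta> \<xi>) = (\<Sum>d\<in>UNIV. W z \<alpha> (c # \<nu>) (W z (d # \<mu>) (d # \<beta>) \<xi>))"
    using W_raise[OF z, of \<mu> \<beta> \<xi>] assms by (simp add: W_sum)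
  also have "\<dots> = (\<Sum>d\<in>UNIV. if d = c then if \<nu> = \<mu> then W z \<alpha> (c # \<beta>) \<xi> else 0 else 0)"
  proof (rule sum.cong[OF refl])
    fix d
    have len: "length (c # \<nu>) = Suc N" "length (d # \<mu>) = Suc N" "length (d # \<beta>) = Suc N" using assms by auto
    show "W z \<alpha> (c # \<nu>) (W z (d # \<mu>) (d # \<beta>) \<xi>) = (if d = c then if \<nu> = \<mu> then W z \<alpha> (c # \<beta>) \<xi> else 0 else 0)"
      unfolding W_mult[OF z assms(2) len] by auto
  qed
  also have "\<dots> = (if \<nu> = \<mu> then W z \<alpha> (c # \<beta>) \<xi> else 0)" by simp
  finally show ?thesis .
qed

lemma W_mult_lower:
  assumes z: "cmod z = 1" and "length \<alpha> = N" "length \<nu> = N" "length \<mu> = N" "length \<beta> = Suc N"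
  shows "W z \<alpha> \<nu> (W z (c # \<mu>) \<beta> \<xi>) = (if \<nu> = \<mu> then W z (c # \<alpha>) \<beta> \<xi> else 0)"
proof -
  have "W z \<alpha> \<nu> (W z (c # \<mu>) \<beta> \<xi>) = (\<Sum>d\<in>UNIV. W z (d # \<alpha>) (d # \<nu>) (W z (c # \<mu>) \<beta> \<xi>))"
    using assms by (intro W_raise[OF z]) simp
  also have "\<dots> = (\<Sum>d\<in>UNIV. if d = c then if \<nu> = \<mu> then W z (c # \<alpha>) \<beta> \<xi> else 0 else 0)"
  proof (rule sum.cong[OF refl])
    fix d
    have len: "length (d # \<alpha>) = Suc N" "length (d # \<nu>) = Suc N" "length (c # \<mu>) = Suc N" using assms by auto
    show "W z (d # \<alpha>) (d # \<nu>) (W z (c # \<mu>) \<beta> \<xi>) = (if d = c then if \<nu> = \<mu> then W z (c # \<alpha>) \<beta> \<xi> else 0 else 0)"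
      unfolding W_mult[OF z len assms(5)] by auto
  qed
  also have "\<dots> = (if \<nu> = \<mu> then W z (c # \<alpha>) \<beta> \<xi> else 0)" by simp
  finally show ?thesis .
qed

lemma jones_even_W:
  assumes z: "cmod z = 1" and "length \<alpha> = k" "length \<beta> = Suc k"
  shows "\<pi> (jones (2 * Suc k)) (W z ((y, n) # \<alpha>) \<beta> \<xi>) = (1 / 2) *\<^sub>C (Q z n ((y, n) # \<alpha>) \<beta> \<xi> +
    flip_coeff z n y *\<^sub>C F z n ((\<not> y, n) # \<alpha>) \<beta> \<xi>)"
proof -
  let ?\<mu> = "(y, n) # \<alpha>"
  have "\<pi> (jones (2 * Suc k)) (W z ?\<mu> \<beta> \<xi>) = (\<Sum>v\<in>words (Suc k). if v = ?\<mu> then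
      (\<Sum>x\<in>UNIV. (1 / 2) *\<^sub>C (W z ((x, n) # ?\<mu>) ((x, n) # \<beta>) \<xi> + (flip_coeff z n x * flip_coeff z n y) *\<^sub>C
       W z ((\<not> x, n) # (\<not> y, n) # \<alpha>) ((x, n) # \<beta>) \<xi>)) else 0)"
    unfolding \<pi>_jones_even_W[OF z]
  proof (rule sum.cong[OF refl])
    fix v :: "site list" assume v: "v \<in> words (Suc k)"
    have m: "W z \<kappa> (c # v) (W z ?\<mu> \<beta> \<xi>) = (if v = ?\<mu> then W z \<kappa> (c # \<beta>) \<xi> else 0)" if "length \<kappa> = Suc (Suc k)" for \<kappa> c
      using that v assms by (intro W_mult_raise[OF z]) auto
    have len: "length (c # v) = Suc (Suc k)" "length (c # c' # tl v) = Suc (Suc k)" for c c' using v by auto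
    show "(\<Sum>x\<in>UNIV. (1 / 2) *\<^sub>C (W z ((x, snd (hd v)) # v) ((x, snd (hd v)) # v) (W z ?\<mu> \<beta> \<xi>) +
     (flip_coeff z (snd (hd v)) x * flip_coeff z (snd (hd v)) (fst (hd v))) *\<^sub>C
       W z ((\<not> x, snd (hd v)) # (\<not> fst (hd v), snd (hd v)) # tl v) ((x, snd (hd v)) # v) (W z ?\<mu> \<beta> \<xi>)))
      = (if v = ?\<mu> then
      (\<Sum>x\<in>UNIV. (1 / 2) *\<^sub>C (W z ((x, n) # ?\<mu>) ((x, n) # \<beta>) \<xi> + (flip_coeff z n x * flip_coeff z n y) *\<^sub>C
       W z ((\<not> x, n) # (\<not> y, n) # \<alpha>) ((x, n) # \<beta>) \<xi>)) else 0)"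
      unfolding m[OF len(1)] m[OF len(2)] by simp
  qed
  also have "\<dots> = (\<Sum>x\<in>UNIV. (1 / 2) *\<^sub>C (W z ((x, n) # ?\<mu>) ((x, n) # \<beta>) \<xi> + (flip_coeff z n x * flip_coeff z n y) *\<^sub>C
       W z ((\<not> x, n) # (\<not> y, n) # \<alpha>) ((x, n) # \<beta>) \<xi>))" using assms by simp
  also have "\<dots> = (1 / 2) *\<^sub>C (Q z n ?\<mu> \<beta> \<xi> + flip_coeff z n y *\<^sub>C F z n ((\<not> y, n) # \<alpha>) \<beta> \<xi>)"
    unfolding Q_def F_def by (simp add: scaleC_sum_right scaleC_add_right sum.distrib scaleC_scaleC mult_ac)
  finally show ?thesis .
qed

lemma jones_odd_W:
  assumes z: "cmod z = 1" and "length \<alpha> = k" "length \<beta> = Suc k"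
  shows "\<pi> (jones (2 * k + 1)) (W z ((x, m) # \<alpha>) \<beta> \<xi>) =
    (if x then 0 else (1 / 2) *\<^sub>C (\<Sum>n\<in>UNIV. W z ((False, n) # \<alpha>) \<beta> \<xi>))"
proof -
  have "\<pi> (jones (2 * k + 1)) (W z ((x, m) # \<alpha>) \<beta> \<xi>) = (\<Sum>\<gamma>\<in>words k. if \<gamma> = \<alpha> then
      (\<Sum>n\<in>UNIV. \<Sum>n'\<in>UNIV. if n' = m then if x then 0 else (1 / 2) *\<^sub>C W z ((False, n) # \<alpha>) \<beta> \<xi> else 0) else 0)"
    unfolding \<pi>_jones_odd_W[OF z]
  proof (rule sum.cong[OF refl])
    fix \<gamma> :: "site list" assume \<gamma>: "\<gamma> \<in> words k"
    have "W z ((False, n) # \<gamma>) ((False, n') # \<gamma>) (W z ((x, m) # \<alpha>) \<beta> \<xi>) =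
        (if (False, n') # \<gamma> = (x, m) # \<alpha> then W z ((False, n) # \<gamma>) \<beta> \<xi> else 0)" for n n'
      using \<gamma> assms by (intro W_mult[OF z, of _ "Suc k"]) auto
    thus "(\<Sum>n\<in>UNIV. \<Sum>n'\<in>UNIV. (1 / 2) *\<^sub>C W z ((False, n) # \<gamma>) ((False, n') # \<gamma>) (W z ((x, m) # \<alpha>) \<beta> \<xi>)) =
      (if \<gamma> = \<alpha> then (\<Sum>n\<in>UNIV. \<Sum>n'\<in>UNIV. if n' = m then if x then 0 else (1 / 2) *\<^sub>C W z ((False, n) # \<alpha>) \<beta> \<xi> else 0) else 0)"
      by (simp add: sum_bool)
  qed
  also have "\<dots> = (if x then 0 else (1 / 2) *\<^sub>C (\<Sum>n\<in>UNIV. W z ((False, n) # \<alpha>) \<beta> \<xi>))"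
    using assms by (simp add: scaleC_sum_right)
  finally show ?thesis .
qed

lemma Q_W:
  assumes z: "cmod z = 1" and "length \<alpha> = N" "length \<beta> = N" "length \<delta> = Suc N" "length \<gamma> = N"
  shows "Q z n \<alpha> \<beta> (W z ((x, m) # \<gamma>) \<delta> \<xi>) = (if m = n \<and> \<beta> = \<gamma> then W z ((x, n) # \<alpha>) \<delta> \<xi> else 0)"
proof -
  have "W z ((y, n) # \<alpha>) ((y, n) # \<beta>) (W z ((x, m) # \<gamma>) \<delta> \<xi>) =
      (if (y, n) # \<beta> = (x, m) # \<gamma> then W z ((y, n) # \<alpha>) \<delta> \<xi> else 0)" for y
    using assms by (intro W_mult[OF z, of _ "Suc N"]) auto
  thus ?thesis by (simp add: Q_def sum_bool)
qed

lemma F_W: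
  assumes z: "cmod z = 1" and "length \<alpha> = N" "length \<beta> = N" "length \<delta> = Suc N" "length \<gamma> = N"
  shows "F z n \<alpha> \<beta> (W z ((x, m) # \<gamma>) \<delta> \<xi>) =
    (if m = n \<and> \<beta> = \<gamma> then flip_coeff z n x *\<^sub>C W z ((\<not> x, n) # \<alpha>) \<delta> \<xi> else 0)"
proof -
  have "W z ((\<not> y, n) # \<alpha>) ((y, n) # \<beta>) (W z ((x, m) # \<gamma>) \<delta> \<xi>) =
      (if (y, n) # \<beta> = (x, m) # \<gamma> then W z ((\<not> y, n) # \<alpha>) \<delta> \<xi> else 0)" for y
    using assms by (intro W_mult[OF z, of _ "Suc N"]) auto
  thus ?thesis by (simp add: F_def sum_bool)
qed

lemma W_F:
  assumes z: "cmod z = 1" and "length \<beta> = N" "length \<delta> = Suc N" 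
  shows "W z \<delta> ((x, n) # \<beta>) (F z n \<beta> \<beta> \<xi>) = flip_coeff z n (\<not> x) *\<^sub>C W z \<delta> ((\<not> x, n) # \<beta>) \<xi>"
proof -
  have eq: "W z \<delta> ((x, n) # \<beta>) (W z ((\<not> y, n) # \<beta>) ((y, n) # \<beta>) \<xi>) =
      (if (x, n) # \<beta> = (\<not> y, n) # \<beta> then W z \<delta> ((y, n) # \<beta>) \<xi> else 0)" for y
    using assms by (intro W_mult[OF z, of _ "Suc N"]) auto
  show ?thesis using eq[of True] eq[of False] by (cases x) (simp_all add: F_def sum_bool W_add W_scaleC)
qed

end

lemma flip_coeff_nonzero: "cmod z = 1 \<Longrightarrow> flip_coeff z n x \<noteq> 0"
  by (auto simp: flip_coeff_def)

lemma op_algebra_compose: "S \<in> op_algebra G \<Longrightarrow> T \<in> op_algebra G \<Longrightarrow> (\<lambda>\<xi>. S (T \<xi>)) \<in> op_algebra G"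
  using op_algebra_comp[of S G T] by (simp add: o_def)

section \<open>The generated algebra and its action on the cyclic vector\<close>

definition generators :: "complex \<Rightarrow> inf_mat set" where
  "generators z = {tensor [hadamard_u z ** d ** adj (hadamard_u z)] | d. d \<in> diag_mats} \<union> {jones j | j. j \<ge> 1}"

lemma adj_mult: "adj (x ** y) = adj y ** adj x"
  by (simp add: adj_def matrix_matrix_mult_def vec_eq_iff mult.commute)

lemma adj_adj [simp]: "adj (adj x) = x"
  by (simp add: adj_def vec_eq_iff)

lemma tensor_entry_adj: "cnj (tensor_entry xs w v) = tensor_entry (map adj xs) v w"
  by (simp add: tensor_entry_def adj_def)

lemma im_adj_tensor: "im_adj (tensor xs) = tensor (map adj xs)"
  by (simp add: tensor_eq im_adj_amplify tensor_entry_adj)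

lemma adj_E [simp]: "adj (E i i) = E i i"
  by (auto simp: adj_def E_def vec_eq_iff)

lemma adj_one [simp]: "adj (mat 1) = mat 1"
  by (auto simp: adj_def mat_def vec_eq_iff)

lemma adj_J [simp]: "adj J = J"
  by (simp add: adj_def vec_eq_iff J_nth)

lemma im_adj_jones: "im_adj (jones j) = jones j"
proof -
  have "cnj (tensor (E i i # E i i # replicate k (mat 1)) s r) = tensor (E i i # E i i # replicate k (mat 1)) r s" for i k r s
    using im_adj_tensor[of "E i i # E i i # replicate k (mat 1)"] by (auto simp: im_adj_def dest: fun_cong)
  moreover have "cnj (tensor (J # replicate k (mat 1)) s r) = tensor (J # replicate k (mat 1)) r s" for k r s
    using im_adj_tensor[of "J # replicate k (mat 1)"] by (auto simp: im_adj_def dest: fun_cong)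
  ultimately show ?thesis by (simp add: im_adj_def jones_def Let_def fun_eq_iff)
qed

lemma im_adj_generators: "x \<in> generators z \<Longrightarrow> im_adj x \<in> generators z"
proof -
  have "im_adj (tensor [hadamard_u z ** d ** adj (hadamard_u z)]) = tensor [hadamard_u z ** adj d ** adj (hadamard_u z)]" for d
    by (simp add: im_adj_tensor adj_mult matrix_mul_assoc)
  moreover have "adj d \<in> diag_mats" if "d \<in> diag_mats" for d using that by (auto simp: diag_mats_def adj_def)
  moreover assume "x \<in> generators z"
  ultimately show ?thesis unfolding generators_def by (auto simp: im_adj_jones)
qed

lemma generators_in_tower: "generators z \<subseteq> tower_union"
proof -
  have "jones j \<in> tower_union" for j
  proof (cases "odd j")
    case True
    have "jones j = amplify (Suc (Suc (j div 2))) (\<lambda>v w. \<Sum>i\<in>UNIV. tensor_entry (E i i # E i i # replicate (j div 2) (mat 1)) v w)"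
      using True by (auto simp: jones_def Let_def tensor_eq amplify_def fun_eq_iff intro!: sum.neutral)
    thus ?thesis by (simp add: amplify_in_tower_union)
  next
    case False
    thus ?thesis by (simp add: jones_def Let_def tensor_eq amplify_in_tower_union)
  qed
  thus ?thesis by (auto simp: generators_def tensor_eq amplify_in_tower_union)
qed

context gns
begin

abbreviation "alg z \<equiv> op_algebra (\<pi> ` generators z)"

lemma alg_jones: "j \<ge> 1 \<Longrightarrow> \<pi> (jones j) \<in> alg z"
  by (intro op_algebra_gen) (auto simp: generators_def)

lemma Q_F_Nil_in_alg:
  assumes z: "cmod z = 1"
  shows "Q z n [] [] \<in> alg z" "F z n [] [] \<in> alg z"
proof -
  define dg :: "complex \<Rightarrow> complex \<Rightarrow> complex \<Rightarrow> complex \<Rightarrow> mat4" where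
    "dg a b c d = (\<chi> i j. if i = j then if i = 1 then a else if i = 2 then b else if i = 3 then c else d else 0)" for a b c d
  have dg: "dg a b c d \<in> diag_mats" "dg a b c d $ 1 $ 1 = a" "dg a b c d $ 2 $ 2 = b"
    "dg a b c d $ 3 $ 3 = c" "dg a b c d $ 4 $ 4 = d" for a b c d
    by (auto simp: dg_def diag_mats_def)
  have gen: "\<pi> (tensor [hadamard_u z ** dg a b c d ** adj (hadamard_u z)]) \<in> alg z" for a b c d
    using dg(1) unfolding generators_def by (intro op_algebra_gen imageI) blast
  have "\<pi> (tensor [hadamard_u z ** dg 1 0 1 0 ** adj (hadamard_u z)]) = Q z False [] []"
    "\<pi> (tensor [hadamard_u z ** dg 1 0 (-1) 0 ** adj (hadamard_u z)]) = F z False [] []"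
    "\<pi> (tensor [hadamard_u z ** dg 0 1 0 1 ** adj (hadamard_u z)]) = Q z True [] []"
    "\<pi> (tensor [hadamard_u z ** dg 0 1 0 (-1) ** adj (hadamard_u z)]) = F z True [] []"
    using \<pi>_diagonal[OF z dg(1)] by (auto simp: dg)
  thus "Q z n [] [] \<in> alg z" "F z n [] [] \<in> alg z" using gen[of 1 0 1 0] gen[of 1 0 "-1" 0] gen[of 0 1 0 1] gen[of 0 1 0 "-1"]
    by (cases n; simp)+
qed

text \<open>One induction step corresponds to two basic constructions: the even Jones projection
  between shorter units yields \<open>Q\<close> and \<open>F\<close>, the odd one between two
  \<open>Q\<close> yields units with leading bits \<open>x\<close> False, and \<open>F\<close> on
  either side sets these bits freely.\<close>

lemma W_in_alg:
  assumes z: "cmod z = 1"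
  shows "length \<alpha> = N \<Longrightarrow> length \<beta> = N \<Longrightarrow> W z \<alpha> \<beta> \<in> alg z"
proof (induction N arbitrary: \<alpha> \<beta>)
  case 0
  hence nil: "\<alpha> = []" "\<beta> = []" by auto
  show ?case unfolding nil W_Nil by (rule op_algebra_id)
next
  case (Suc N)
  have QF: "Q z n \<alpha> \<beta> \<in> alg z \<and> F z n \<alpha> \<beta> \<in> alg z" if len: "length \<alpha> = N" "length \<beta> = N" for n \<alpha> \<beta>
  proof (cases N)
    case 0
    thus ?thesis using len Q_F_Nil_in_alg[OF z] by simp
  next
    case (Suc k)
    \<comment> \<open>Any word of length \<open>k\<close> serves as the intermediate index; it
      disappears from the product.\<close>
    define \<alpha>' :: "site list" where "\<alpha>' = replicate k (False, False)"
    have len': "length \<alpha>' = k" "length \<beta> = Suc k" using len Suc by (simp_all add: \<alpha>'_def)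
    let ?e = "\<pi> (jones (2 * Suc k))"
    have e: "?e \<in> alg z" by (rule alg_jones) simp
    have lower: "W z \<alpha> ((y, n) # \<alpha>') (W z (c # (y', n) # \<alpha>') (d # \<beta>) \<xi>) = (if y = y' then W z (c # \<alpha>) (d # \<beta>) \<xi> else 0)" for c d y y' \<xi>
    proof -
      have l: "length \<alpha> = N" "length ((y, n) # \<alpha>') = N" "length ((y', n) # \<alpha>') = N" "length (d # \<beta>) = Suc N"
        using len len' Suc by simp_all
      show ?thesis unfolding W_mult_lower[OF z l] by simp
    qed
    \<comment> \<open>By \<open>jones_even_W\<close> the inner product of operators is half the sum
      of a \<open>Q\<close> part and an \<open>F\<close> part, with leading bits False and True; the
      bit in the outer unit selects one of them, and the factor 2 removes the half.\<close>
    have Q: "Q z n \<alpha> \<beta> = (\<lambda>\<xi>. 2 *\<^sub>C W z \<alpha> ((False, n) # \<alpha>') (?e (W z ((False, n) # \<alpha>') \<beta> \<xi>)))"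
      unfolding jones_even_W[OF z len'] W_scaleC W_add unfolding Q_def F_def W_sum W_scaleC lower
      by (simp add: fun_eq_iff scaleC_scaleC)
    have F: "F z n \<alpha> \<beta> = (\<lambda>\<xi>. (2 / flip_coeff z n False) *\<^sub>C W z \<alpha> ((True, n) # \<alpha>') (?e (W z ((False, n) # \<alpha>') \<beta> \<xi>)))"
      unfolding jones_even_W[OF z len'] W_scaleC W_add unfolding Q_def F_def W_sum W_scaleC lower
      using flip_coeff_nonzero[OF z] by (simp add: fun_eq_iff scaleC_scaleC)
    have mem: "(\<lambda>\<xi>. c *\<^sub>C W z \<alpha> ((y, n) # \<alpha>') (?e (W z ((False, n) # \<alpha>') \<beta> \<xi>))) \<in> alg z" for c y
    proof -
      have W1: "W z ((False, n) # \<alpha>') \<beta> \<in> alg z" and W2: "W z \<alpha> ((y, n) # \<alpha>') \<in> alg z"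
        using len len' Suc by (auto intro!: Suc.IH)
      show ?thesis by (rule op_algebra_scale[OF op_algebra_compose[OF W2 op_algebra_compose[OF e W1]]])
    qed
    show ?thesis unfolding Q F by (intro conjI mem)
  qed
  obtain x n \<alpha>' y m \<beta>' where \<alpha>: "\<alpha> = (x, n) # \<alpha>'" and \<beta>: "\<beta> = (y, m) # \<beta>'" and len: "length \<alpha>' = N" "length \<beta>' = N"
    using Suc.prems by (cases \<alpha>; cases \<beta>) auto
  let ?f = "\<pi> (jones (2 * N + 1))"
  have f: "?f \<in> alg z" by (rule alg_jones) simp
  have FF: "W z ((False, n) # \<alpha>') ((False, m) # \<beta>') \<in> alg z"
  proof -
    have l: "length (c # \<beta>') = Suc N" for c using len by simp
    have bl: "?f (\<xi> + \<eta>) = ?f \<xi> + ?f \<eta>" for \<xi> \<eta>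
    proof -
      have "jones (2 * N + 1) \<in> tower_union" using generators_in_tower[of z] unfolding generators_def by auto
      hence "bounded_clinear ?f" using gns unfolding is_gns_def by blast
      thus ?thesis by (rule bounded_clinear_add)
    qed
    have Qadd: "Q z n \<alpha>' \<alpha>' (\<xi> + \<eta>) = Q z n \<alpha>' \<alpha>' \<xi> + Q z n \<alpha>' \<alpha>' \<eta>" "Q z n \<alpha>' \<alpha>' (c *\<^sub>C \<xi>) = c *\<^sub>C Q z n \<alpha>' \<alpha>' \<xi>" "Q z n \<alpha>' \<alpha>' 0 = 0" for \<xi> \<eta> c
      by (simp_all add: Q_def W_add W_scaleC sum_bool scaleC_add_right)
    \<comment> \<open>The right \<open>Q\<close> offers both bits \<open>x\<close>, of which the odd
      projection keeps only False; it averages over the dual bit, from which the left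
      \<open>Q\<close> selects \<open>n\<close>.\<close>
    have "Q z n \<alpha>' \<alpha>' (?f (Q z m \<alpha>' \<beta>' \<xi>)) = (1 / 2) *\<^sub>C W z ((False, n) # \<alpha>') ((False, m) # \<beta>') \<xi>" for \<xi>
      unfolding Q_def[of z m] sum_bool bl jones_odd_W[OF z len(1) l] if_True if_False Qadd
      unfolding Q_W[OF z len(1) len(1) l len(1)] by (cases n) simp_all
    hence "W z ((False, n) # \<alpha>') ((False, m) # \<beta>') = (\<lambda>\<xi>. 2 *\<^sub>C Q z n \<alpha>' \<alpha>' (?f (Q z m \<alpha>' \<beta>' \<xi>)))"
      by (simp add: fun_eq_iff scaleC_scaleC)
    moreover have "(\<lambda>\<xi>. 2 *\<^sub>C Q z n \<alpha>' \<alpha>' (?f (Q z m \<alpha>' \<beta>' \<xi>))) \<in> alg z"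
      using QF[OF len(1) len(1)] QF[OF len]
      by (intro op_algebra_scale[OF op_algebra_compose[OF _ op_algebra_compose[OF f]]]) blast+
    ultimately show ?thesis by simp
  qed
  have xF: "W z ((x, n) # \<alpha>') ((False, m) # \<beta>') \<in> alg z"
  proof (cases x)
    case True
    have "length ((False, m) # \<beta>') = Suc N" using len by simp
    hence "W z ((x, n) # \<alpha>') ((False, m) # \<beta>') = (\<lambda>\<xi>. (1 / flip_coeff z n False) *\<^sub>C F z n \<alpha>' \<alpha>' (W z ((False, n) # \<alpha>') ((False, m) # \<beta>') \<xi>))"
      using F_W[OF z len(1) len(1) _ len(1)] True flip_coeff_nonzero[OF z] by (simp add: fun_eq_iff scaleC_scaleC)
    moreover have "(\<lambda>\<xi>. (1 / flip_coeff z n False) *\<^sub>C F z n \<alpha>' \<alpha>' (W z ((False, n) # \<alpha>') ((False, m) # \<beta>') \<xi>)) \<in> alg z"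
      using QF[OF len(1) len(1)] by (intro op_algebra_scale[OF op_algebra_compose[OF _ FF]]) blast
    ultimately show ?thesis by simp
  qed (use FF in simp)
  show ?case
  proof (cases y)
    case True
    have "length ((x, n) # \<alpha>') = Suc N" using len by simp
    hence "W z \<alpha> \<beta> = (\<lambda>\<xi>. (1 / flip_coeff z m True) *\<^sub>C W z ((x, n) # \<alpha>') ((False, m) # \<beta>') (F z m \<beta>' \<beta>' \<xi>))"
      using W_F[OF z len(2)] True flip_coeff_nonzero[OF z] by (simp add: fun_eq_iff scaleC_scaleC \<alpha> \<beta>)
    moreover have "(\<lambda>\<xi>. (1 / flip_coeff z m True) *\<^sub>C W z ((x, n) # \<alpha>') ((False, m) # \<beta>') (F z m \<beta>' \<beta>' \<xi>)) \<in> alg z"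
      using QF[OF len(2) len(2)] by (intro op_algebra_scale[OF op_algebra_compose[OF xF]]) blast
    ultimately show ?thesis by simp
  qed (use xF in \<open>simp add: \<alpha> \<beta>\<close>)
qed

lemma Wspan_invariant:
  assumes z: "cmod z = 1" and T: "bounded_clinear T"
    and vec: "\<And>\<alpha> \<beta>. length \<alpha> = length \<beta> \<Longrightarrow> T (W z \<alpha> \<beta> \<Omega>) \<in> Wspan z"
    and \<xi>: "\<xi> \<in> Wspan z"
  shows "T \<xi> \<in> Wspan z"
proof -
  have "Wspan z \<subseteq> {\<xi>. T \<xi> \<in> Wspan z}"
  proof (rule Wspan_minimal)
    show "csubspace {\<xi>. T \<xi> \<in> Wspan z}"
      using csubspace_Wspan[of z] T
      by (auto simp: csubspace_def bounded_clinear_zero bounded_clinear_add bounded_clinear_scaleC)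
  qed (auto simp: Wvecs_def vec)
  thus ?thesis using \<xi> by blast
qed

lemma generators_Wspan:
  assumes z: "cmod z = 1" and x: "x \<in> generators z" and len: "length \<alpha> = length \<beta>"
  shows "\<pi> x (W z \<alpha> \<beta> \<Omega>) \<in> Wspan z"
proof -
  note intros = csubspace_add[OF csubspace_Wspan] csubspace_scaleC[OF csubspace_Wspan] csubspace_sum[OF csubspace_Wspan]
  have W: "W z \<gamma> \<delta> (W z \<alpha> \<beta> \<Omega>) \<in> Wspan z" if "length \<gamma> = length \<delta>" for \<gamma> \<delta>
    using that len by (intro W_Wspan z)
  consider d where "d \<in> diag_mats" "x = tensor [hadamard_u z ** d ** adj (hadamard_u z)]"
    | k where "x = jones (2 * Suc k)" | k where "x = jones (2 * k + 1)"
  proof -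
    have "(\<exists>k. j = 2 * Suc k) \<or> (\<exists>k. j = 2 * k + 1)" if "j \<ge> 1" for j :: nat
      using that by presburger
    thus ?thesis using x that unfolding generators_def by blast
  qed
  thus ?thesis
  proof cases
    case 1
    show ?thesis unfolding 1(2) \<pi>_diagonal[OF z 1(1)] Q_def F_def by (intro intros W) auto
  next
    case 2
    show ?thesis unfolding 2 \<pi>_jones_even_W[OF z]
      by (intro intros W) auto
  next
    case 3
    show ?thesis unfolding 3 \<pi>_jones_odd_W[OF z] by (intro intros W) auto
  qed
qed

text \<open>The span contains \<Omega> and is invariant under the generators, which gives one
  inclusion; the other holds because every \<open>W\<close> lies in the algebra.\<close>

lemma alg_image: 
  assumes z: "cmod z = 1"
  shows "(\<lambda>T. T \<Omega>) ` alg z = Wspan z"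
proof
  have gen: "bounded_clinear (\<pi> x)" if "x \<in> generators z" for x
    using that gns generators_in_tower by (auto simp: is_gns_def)
  have "\<forall>\<xi>\<in>Wspan z. T \<xi> \<in> Wspan z" if "T \<in> alg z" for T
    using that
  proof induction
    case (op_algebra_gen T)
    then obtain x where x: "x \<in> generators z" "T = \<pi> x" by blast
    show ?case unfolding x(2) using Wspan_invariant[OF z gen[OF x(1)] generators_Wspan[OF z x(1)]] by blast
  qed (auto intro: csubspace_add[OF csubspace_Wspan] csubspace_scaleC[OF csubspace_Wspan])
  moreover have "\<Omega> \<in> Wspan z"
  proof -
    have "W z [] [] \<Omega> \<in> Wvecs z" unfolding Wvecs_def by blast
    thus ?thesis using Wvecs_subset[of z] by (auto simp: W_Nil)
  qed
  ultimately show "(\<lambda>T. T \<Omega>) ` alg z \<subseteq> Wspan z" by blast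
  show "Wspan z \<subseteq> (\<lambda>T. T \<Omega>) ` alg z"
  proof (rule Wspan_minimal)
    show "csubspace ((\<lambda>T. T \<Omega>) ` alg z)"
      unfolding csubspace_def
    proof (intro conjI ballI allI)
      show "0 \<in> (\<lambda>T. T \<Omega>) ` alg z"
        by (rule image_eqI[OF _ op_algebra_scale[OF op_algebra_id, of 0]]) simp
    next
      fix u v assume "u \<in> (\<lambda>T. T \<Omega>) ` alg z" "v \<in> (\<lambda>T. T \<Omega>) ` alg z"
      then obtain S T where "S \<in> alg z" "T \<in> alg z" "u = S \<Omega>" "v = T \<Omega>" by blast
      thus "u + v \<in> (\<lambda>T. T \<Omega>) ` alg z"
        by (intro image_eqI[of _ _ "\<lambda>\<xi>. S \<xi> + T \<xi>"] op_algebra_add) auto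
    next
      fix c u assume "u \<in> (\<lambda>T. T \<Omega>) ` alg z"
      then obtain T where "T \<in> alg z" "u = T \<Omega>" by blast
      thus "c *\<^sub>C u \<in> (\<lambda>T. T \<Omega>) ` alg z"
        by (intro image_eqI[of _ _ "\<lambda>\<xi>. c *\<^sub>C T \<xi>"] op_algebra_scale) auto
    qed
    show "Wvecs z \<subseteq> (\<lambda>T. T \<Omega>) ` alg z"
    proof
      fix w assume "w \<in> Wvecs z"
      then obtain \<alpha> \<beta> where w: "w = W z \<alpha> \<beta> \<Omega>" "length \<alpha> = length \<beta>" by (auto simp: Wvecs_def)
      have "W z \<alpha> \<beta> \<in> alg z" by (rule W_in_alg[OF z w(2) refl])
      thus "w \<in> (\<lambda>T. T \<Omega>) ` alg z" unfolding w(1) by (rule imageI)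
    qed
  qed
qed

lemma L2_space_spin_subfactor:
  assumes z: "cmod z = 1"
  shows "L2_space \<Omega> (spin_subfactor \<pi> (hadamard_u z)) = L2 z"
proof -
  have vN: "von_neumann_algebra (hyperfinite_R \<pi>)"
    unfolding hyperfinite_R_def by (rule von_neumann_algebra_sot_closure[OF \<pi>_image_star_algebra])
  have sub: "\<pi> ` generators z \<subseteq> hyperfinite_R \<pi>"
    unfolding hyperfinite_R_def using subset_sot_closure[OF \<pi>_image_star_algebra] generators_in_tower by blast
  have adj: "\<exists>S\<in>\<pi> ` generators z. is_adjoint T S" if "T \<in> \<pi> ` generators z" for T
    using that gns generators_in_tower im_adj_generators unfolding is_gns_def by blast
  have "bounded_clinear T" if "T \<in> \<pi> ` generators z" for T
    using that gns generators_in_tower unfolding is_gns_def by blast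
  hence star: "star_algebra (alg z)" using adj by (rule star_algebra_op_algebra)
  have "spin_subfactor \<pi> (hadamard_u z) = sot_closure (alg z)"
    unfolding spin_subfactor_def generators_def[symmetric]
    using generated_vN_subalgebra_eq[OF vN sub adj] .
  thus ?thesis by (simp add: L2_space_sot_closure[OF star] alg_image[OF z] L2_def)
qed

end

section \<open>The angles\<close>

lemma cmod_half_sum_sq:
  assumes "cmod z = 1" "cmod w = 1"
  shows "(cmod ((1 / 2) * (z + w)))\<^sup>2 = (1 + Re (z * cnj w)) / 2"
proof -
  have "(Re z)\<^sup>2 + (Im z)\<^sup>2 = 1" "(Re w)\<^sup>2 + (Im w)\<^sup>2 = 1" using assms by (simp_all flip: cmod_power2)
  moreover have "(cmod ((1 / 2) * (z + w)))\<^sup>2 = (cmod (z + w))\<^sup>2 / 4"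
    by (simp add: norm_divide power_divide)
  moreover have "(cmod (z + w))\<^sup>2 = ((Re z)\<^sup>2 + (Im z)\<^sup>2) + ((Re w)\<^sup>2 + (Im w)\<^sup>2) + 2 * Re (z * cnj w)"
    unfolding cmod_power2 by (simp add: power2_eq_square algebra_simps)
  ultimately show ?thesis by simp
qed

lemma half_one_plus_cos: "(1 + cos (2 * x)) / 2 = (cos x)\<^sup>2" for x :: real
  by (simp add: cos_double_cos)

text \<open>Each letter contributes 1 or \<open>(cnj a * b)^2\<close> to the ratio, as the minus
  signs in \<open>phase\<close> cancel.\<close>

lemma phase_ratio_power:
  assumes "(cnj a * b) ^ (2 * \<mu>) = 1"
  shows "(phase a s \<alpha> * cnj (phase b s \<alpha>)) ^ \<mu> = 1"
proof (induction \<alpha> arbitrary: s)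
  case (Cons c \<alpha>)
  have r: "((cnj a)\<^sup>2 * b\<^sup>2) ^ \<mu> = 1" using assms by (simp add: power_mult power_mult_distrib)
  have "phase a s (c # \<alpha>) * cnj (phase b s (c # \<alpha>)) = (if fst c \<and> s \<and> snd c then (cnj a)\<^sup>2 * b\<^sup>2 else 1) *
      (phase a (fst c \<noteq> s) \<alpha> * cnj (phase b (fst c \<noteq> s) \<alpha>))" by simp
  thus ?case using Cons r by (simp only: power_mult_distrib split: if_split) simp
qed simp

text \<open>\<open>corr\<close> is the mean of two roots of unity of order dividing \<mu>, so its
  squared modulus is the squared cosine of half the angle between them.\<close>

lemma corr_angle:
  assumes a: "cmod a = 1" and b: "cmod b = 1" and \<mu>: "\<mu> > 0" and ab: "(cnj a * b) ^ (2 * \<mu>) = 1"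
  shows "\<exists>k. 2 * k \<le> \<mu> \<and> (cmod (corr a b \<alpha> \<beta>))\<^sup>2 = (cos (pi * real k / real \<mu>))\<^sup>2"
proof -
  define r where "r s = (phase a s \<alpha> * cnj (phase b s \<alpha>)) * cnj (phase a s \<beta> * cnj (phase b s \<beta>))" for s
  have "corr a b \<alpha> \<beta> = (1 / 2) * (r False + r True)"
    unfolding corr_def sum_bool r_def by (simp add: mult_ac)
  moreover have r1: "cmod (r s) = 1" for s using norm_phase[OF a] norm_phase[OF b] by (simp add: r_def norm_mult)
  ultimately have c: "(cmod (corr a b \<alpha> \<beta>))\<^sup>2 = (1 + Re (r False * cnj (r True))) / 2"
    by (simp only: cmod_half_sum_sq)
  have "r s ^ \<mu> = 1" for s
    unfolding r_def power_mult_distrib[of "phase a s \<alpha> * _"] complex_cnj_power[symmetric] phase_ratio_power[OF ab] by simp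
  hence "(r False * cnj (r True)) ^ \<mu> = 1" by (simp add: power_mult_distrib flip: complex_cnj_power)
  then obtain j where j: "j < \<mu>" "r False * cnj (r True) = cis (2 * pi * real j / real \<mu>)"
    using Complex.bij_betw_roots_unity[OF \<mu>] unfolding bij_betw_def by force
  have cj: "(cmod (corr a b \<alpha> \<beta>))\<^sup>2 = (cos (pi * real j / real \<mu>))\<^sup>2"
    unfolding c j(2) using half_one_plus_cos[of "pi * real j / real \<mu>"] by (simp add: mult.assoc)
  show ?thesis
  proof (cases "2 * j \<le> \<mu>")
    \<comment> \<open>Indices beyond half of \<mu> are reflected, since \<open>cos^2\<close> has the
      same value at \<open>pi - x\<close>.\<close>
    case False
    have "pi * real (\<mu> - j) / real \<mu> = pi - pi * real j / real \<mu>"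
      using j(1) by (simp add: of_nat_diff field_simps)
    hence "(cos (pi * real (\<mu> - j) / real \<mu>))\<^sup>2 = (cos (pi * real j / real \<mu>))\<^sup>2" by simp
    thus ?thesis using cj False by (intro exI[of _ "\<mu> - j"]) auto
  qed (use cj in blast)
qed

text \<open>Each pair of letters returns the carried bit to its initial value. Starting from True,
  the pair contributes the phase factor once; starting from False, the carried bit is True only at
  the letter with dual bit False, so there is no factor.\<close>

fun witness :: "nat \<Rightarrow> site list" where
  "witness 0 = []"
| "witness (Suc d) = (True, True) # (True, False) # witness d"

lemma phase_witness: "phase z s (witness d) = (if s then (- (cnj z)\<^sup>2) ^ d else 1)"
  by (induction d arbitrary: s) auto

lemma phase_trivial: "phase z s (replicate d (False, False)) = 1"
  by (induction d arbitrary: s) auto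

lemma corr_witness:
  assumes "cmod a = 1" "cmod b = 1"
  shows "(cmod (corr a b (witness d) (replicate (length (witness d)) (False, False))))\<^sup>2 = (1 + Re ((cnj a * b) ^ (2 * d))) / 2"
proof -
  have "(- (cnj a)\<^sup>2) ^ d * cnj ((- (cnj b)\<^sup>2) ^ d) = ((cnj a * b)\<^sup>2) ^ d"
    by (simp add: power_mult_distrib flip: power_mult_distrib[of "- _" "- _"])
  hence "corr a b (witness d) (replicate (length (witness d)) (False, False)) = (1 / 2) * ((cnj a * b) ^ (2 * d) + 1)"
    unfolding corr_def sum_bool phase_witness phase_trivial by (simp add: power_mult)
  thus ?thesis using cmod_half_sum_sq[of "(cnj a * b) ^ (2 * d)" 1] assms
    by (simp only:) (simp add: norm_power norm_mult)
qed

text \<open>By minimality the powers with exponent below \<mu> are distinct, and there are only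
  \<mu> roots of unity for them to hit.\<close>

lemma power_hits_root:
  fixes s :: complex
  assumes \<mu>: "\<mu> > 0" and s: "s ^ \<mu> = 1" and least: "\<And>j. j > 0 \<Longrightarrow> s ^ j = 1 \<Longrightarrow> \<mu> \<le> j" and z: "z ^ \<mu> = 1"
  shows "\<exists>d. s ^ d = z"
proof -
  have s0: "s \<noteq> 0" using s \<mu> by (auto simp: power_0_left)
  have "i = j" if "i < \<mu>" "j < \<mu>" "s ^ i = s ^ j" for i j
  proof -
    have *: "\<not> i < j" if "i < \<mu>" "j < \<mu>" "s ^ i = s ^ j" for i j
    proof
      assume "i < j"
      hence "s ^ j = s ^ i * s ^ (j - i)" by (simp flip: power_add)
      hence "s ^ i * s ^ (j - i) = s ^ i * 1" using that by simp
      hence "s ^ (j - i) = 1" using s0 by simp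
      thus False using least[of "j - i"] \<open>i < j\<close> that by simp
    qed
    show ?thesis using *[of i j] *[of j i] that by simp
  qed
  hence inj: "inj_on (\<lambda>d. s ^ d) {..<\<mu>}" by (auto simp: inj_on_def)
  have fin: "finite {z::complex. z ^ \<mu> = 1}" "card {z::complex. z ^ \<mu> = 1} = \<mu>"
    using Complex.bij_betw_roots_unity[OF \<mu>] bij_betw_finite bij_betw_same_card by (fastforce, fastforce)
  have "(s ^ d) ^ \<mu> = 1" for d using s by (metis power_mult mult.commute power_one)
  hence "(\<lambda>d. s ^ d) ` {..<\<mu>} = {z. z ^ \<mu> = 1}"
    by (intro card_subset_eq) (auto simp: card_image inj fin)
  moreover have "z \<in> {z. z ^ \<mu> = 1}" using z by simp
  ultimately have "z \<in> (\<lambda>d. s ^ d) ` {..<\<mu>}" by (simp only:)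
  thus ?thesis by (auto simp: image_iff)
qed

theorem theorem1p15:
  fixes \<pi> :: "inf_mat \<Rightarrow> 'h::complex_hilbert_space \<Rightarrow> 'h"
    and \<Omega> :: 'h
    and a b :: complex
    and m :: nat
  assumes gns: "is_gns \<pi> \<Omega>"
    and a: "a \<in> cis ` {0..<pi}"
    and b: "b \<in> cis ` {0..<pi}"
    and ab: "a \<noteq> b"
    and m: "even m" "m \<ge> 4" "(cnj a * b) ^ m = 1"
    and m_least: "\<And>j. even j \<Longrightarrow> j > 0 \<Longrightarrow> (cnj a * b) ^ j = 1 \<Longrightarrow> m \<le> j"
  shows "(m = 4 \<longrightarrow>
            Ang \<Omega> (spin_subfactor \<pi> (hadamard_u a)) (spin_subfactor \<pi> (hadamard_u b)) = {pi / 2}) \<and>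
         (m \<ge> 6 \<longrightarrow>
            Ang \<Omega> (spin_subfactor \<pi> (hadamard_u a)) (spin_subfactor \<pi> (hadamard_u b)) =
              {2 * real k * pi / real m | k. 1 \<le> k \<and> int k \<le> \<lfloor>(real m - 2) / 4\<rfloor>})"
proof -
  interpret gns \<pi> \<Omega> by standard (rule gns)
  have a1: "cmod a = 1" and b1: "cmod b = 1" using a b by auto
  obtain \<mu> where \<mu>: "m = 2 * \<mu>" using m(1) by blast
  have \<mu>2: "\<mu> \<ge> 2" using m(2) \<mu> by simp
  \<comment> \<open>This includes 0 and, for even \<mu>, also \<open>pi / 2\<close>: they are needed
    for the vectors of \<open>Wvecs a\<close> outside the generic part.\<close>
  define \<Theta>s where "\<Theta>s = {pi * real k / real \<mu> | k. 2 * k \<le> \<mu>}"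
  have \<Theta>s_alt: "\<Theta>s = (\<lambda>k. pi * real k / real \<mu>) ` {..\<mu> div 2}"
    unfolding \<Theta>s_def by (auto simp: image_iff)
  interpret E: eigenangles "L2 a" "L2 b" \<Theta>s "Wvecs a"
  proof
    show "finite \<Theta>s" unfolding \<Theta>s_alt by simp
    show "\<Theta>s \<subseteq> {0..pi / 2}"
    proof
      fix \<theta> assume "\<theta> \<in> \<Theta>s"
      then obtain k where k: "\<theta> = pi * real k / real \<mu>" "2 * k \<le> \<mu>" by (auto simp: \<Theta>s_def)
      have "2 * real k \<le> real \<mu>" using k(2) by linarith
      hence "pi * (2 * real k) \<le> pi * real \<mu>" by (intro mult_left_mono) auto
      thus "\<theta> \<in> {0..pi / 2}" using \<mu>2 by (simp add: k(1) field_simps)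
    qed
    fix w assume "w \<in> Wvecs a"
    then obtain \<alpha> \<beta> where w: "w = W a \<alpha> \<beta> \<Omega>" "length \<alpha> = length \<beta>" by (auto simp: Wvecs_def)
    obtain k where "2 * k \<le> \<mu>" "(cmod (corr a b \<alpha> \<beta>))\<^sup>2 = (cos (pi * real k / real \<mu>))\<^sup>2"
      using corr_angle[OF a1 b1, of \<mu>] \<mu>2 m(3) \<mu> by auto
    thus "\<exists>\<theta>\<in>\<Theta>s. proj (L2 a) (proj (L2 b) w) = (cos \<theta>)\<^sup>2 *\<^sub>R w"
      unfolding w(1) proj_proj_L2_W[OF a1 b1 w(2)] by (auto simp: \<Theta>s_def)
  qed (fact csubspace_L2 closed_L2 Wvecs_L2 | rule L2_minimal; assumption)+
  have Ang: "Ang \<Omega> (spin_subfactor \<pi> (hadamard_u a)) (spin_subfactor \<pi> (hadamard_u b)) = Ang_proj E.p E.q"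
    by (simp add: Ang_def L2_space_spin_subfactor a1 b1)
  have \<Theta>s_cases: "E.\<Theta>' = {pi * real k / real \<mu> | k. 1 \<le> k \<and> 2 * k < \<mu>}"
  proof -
    have "0 < pi * real k / real \<mu> \<longleftrightarrow> 1 \<le> k" "pi * real k / real \<mu> < pi / 2 \<longleftrightarrow> 2 * k < \<mu>" for k
    proof -
      show "0 < pi * real k / real \<mu> \<longleftrightarrow> 1 \<le> k" using \<mu>2 by (simp add: zero_less_divide_iff zero_less_mult_iff Suc_le_eq)
      have "pi * real k / real \<mu> < pi / 2 \<longleftrightarrow> pi * (2 * real k) < pi * real \<mu>" using \<mu>2 by (simp add: field_simps)
      also have "\<dots> \<longleftrightarrow> 2 * real k < real \<mu>" by (rule mult_less_cancel_left_pos) simp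
      also have "\<dots> \<longleftrightarrow> 2 * k < \<mu>" by linarith
      finally show "pi * real k / real \<mu> < pi / 2 \<longleftrightarrow> 2 * k < \<mu>" .
    qed
    thus ?thesis unfolding \<Theta>s_def by force
  qed
  show ?thesis
  proof (intro conjI impI)
    assume "m = 4"
    hence "\<mu> = 2" using \<mu> by simp
    \<comment> \<open>Only \<open>k = 0\<close> and \<open>k = 1\<close> satisfy
      \<open>2 * k \<le> 2\<close>.\<close>
    hence "\<Theta>s \<subseteq> {0, pi / 2}" unfolding \<Theta>s_def by (auto simp: le_Suc_eq numeral_2_eq_2)
    thus "Ang \<Omega> (spin_subfactor \<pi> (hadamard_u a)) (spin_subfactor \<pi> (hadamard_u b)) = {pi / 2}"
      unfolding Ang by (rule E.Ang_proj_trivial)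
  next
    assume m6: "m \<ge> 6"
    have "Ang_proj E.p E.q = E.\<Theta>'"
    proof (rule E.Ang_proj_eq)
      show "E.\<Theta>' \<noteq> {}" unfolding \<Theta>s_cases using m6 \<mu> by (auto intro!: exI[of _ 1])
    next
      fix \<theta> assume "\<theta> \<in> E.\<Theta>'"
      then obtain k where k: "\<theta> = pi * real k / real \<mu>" unfolding \<Theta>s_cases by blast
      \<comment> \<open>Since \<open>m\<close> is the least positive even exponent,
        \<open>(cnj a * b)^2\<close> has order exactly \<mu>, and its powers reach the root of unity
        with argument \<open>2 * \<theta>\<close>.\<close>
      have "\<exists>d. ((cnj a * b)\<^sup>2) ^ d = cis (2 * pi * real k / real \<mu>)"
      proof (rule power_hits_root)
        show "\<mu> > 0" using \<mu>2 by simp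
        show "((cnj a * b)\<^sup>2) ^ \<mu> = 1" using m(3) by (simp add: \<mu> power_mult)
        show "\<mu> \<le> j" if "j > 0" "((cnj a * b)\<^sup>2) ^ j = 1" for j
          using m_least[of "2 * j"] that by (simp add: \<mu> power_mult)
        have "real \<mu> * (2 * pi * real k / real \<mu>) = 2 * pi * real k" using \<mu>2 by simp
        thus "cis (2 * pi * real k / real \<mu>) ^ \<mu> = 1"
          unfolding Complex.DeMoivre by (simp only:) (simp add: cis_multiple_2pi)
      qed
      then obtain d where d: "(cnj a * b) ^ (2 * d) = cis (2 * pi * real k / real \<mu>)" by (auto simp: power_mult)
      let ?\<beta> = "replicate (length (witness d)) (False, False)"
      have "(cmod (corr a b (witness d) ?\<beta>))\<^sup>2 = (cos \<theta>)\<^sup>2"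
        unfolding corr_witness[OF a1 b1] d k using half_one_plus_cos[of "pi * real k / real \<mu>"] by (simp add: mult.assoc)
      moreover have len: "length (witness d) = length ?\<beta>" by simp
      ultimately have "proj (L2 a) (proj (L2 b) (W a (witness d) ?\<beta> \<Omega>)) = (cos \<theta>)\<^sup>2 *\<^sub>R W a (witness d) ?\<beta> \<Omega>"
        using proj_proj_L2_W[OF a1 b1 len] by simp
      moreover have "W a (witness d) ?\<beta> \<Omega> \<in> L2 a" using Wvecs_L2[of a] len unfolding Wvecs_def by blast
      moreover have "W a (witness d) ?\<beta> \<Omega> \<noteq> 0" by (rule W_nonzero[OF a1 len])
      ultimately show "\<exists>w\<in>L2 a. w \<noteq> 0 \<and> E.p (E.q w) = (cos \<theta>)\<^sup>2 *\<^sub>R w" by blast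
    qed
    also have "\<dots> = {2 * real k * pi / real m | k. 1 \<le> k \<and> int k \<le> \<lfloor>(real m - 2) / 4\<rfloor>}"
    proof -
      \<comment> \<open>As \<open>m\<close> is even, \<open>4 * k < m\<close> is the same as
        \<open>4 * k \<le> m - 2\<close>.\<close>
      have "int k \<le> \<lfloor>(real m - 2) / 4\<rfloor> \<longleftrightarrow> 2 * k < \<mu>" for k
        unfolding le_floor_iff using \<mu> by (auto simp: field_simps)
      moreover have "2 * real k * pi / real m = pi * real k / real \<mu>" for k using \<mu>2 by (simp add: \<mu> field_simps)
      ultimately show ?thesis unfolding \<Theta>s_cases by simp
    qed
    finally show "Ang \<Omega> (spin_subfactor \<pi> (hadamard_u a)) (spin_subfactor \<pi> (hadamard_u b)) =
        {2 * real k * pi / real m | k. 1 \<le> k \<and> int k \<le> \<lfloor>(real m - 2) / 4\<rfloor>}"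
      unfolding Ang .
  qed
qed

end
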